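(* There exists a tight simplex of $27$ points in $\mathbb{O}\mathbb{P}^2$. Moreover, there is such a simplex in a neighborhood of which the space of tight $27$-point simplices in $\mathbb{O}\mathbb{P}^2$, taken modulo the isometry group $F_4$ of $\mathbb{O}\mathbb{P}^2$, has dimension $56$.
   Context: $\mathbb{O}$ denotes the octonions. The octonionic projective plane $\mathbb{O}\mathbb{P}^2$ is the set of $3\times 3$ octonionic Hermitian matrices $\Pi$ with $\Pi^2=\Pi$ and $\operatorname{Tr}\Pi = 1$; each such $\Pi$ has the form $\Pi = (a,b,c)^t(\bar a,\bar b,\bar c)$ with $|a|^2+|b|^2+|c|^2=1$ and $(ab)c=a(bc)$. On Hermitian matrices use the inner product $\langle A,B\rangle = \operatorname{Re}\operatorname{Tr}(AB)$; the chordal distance is $\rho(\Pi_1,\Pi_2)=\sqrt{1-\langle \Pi_1,\Pi_2\rangle}$. A tight simplex of $N$ points in $\mathbb{O}\mathbb{P}^2$ is a set of $N$ distinct points $\Pi_1,\dots,\Pi_N$ with $\langle \Pi_i,\Pi_j\rangle = \frac{N-3}{3(N-1)}$ for all $i\ne j$. *)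

theory Defs
  imports "HOL-Analysis.Analysis" "HOL-Library.Numeral_Type"
begin

text \<open>Cayley--Dickson doubling: (a,b)(c,d) = (ac - d* b, da + b c*), (a,b)* = (a*, -b).
  Quaternions are pairs of complex numbers, octonions are pairs of quaternions.\<close>

type_synonym quat = "complex \<times> complex"
type_synonym oct = "quat \<times> quat"

definition qmul :: "quat \<Rightarrow> quat \<Rightarrow> quat" where
  "qmul x y = (fst x * fst y - cnj (snd y) * snd x, snd y * fst x + snd x * cnj (fst y))"

definition qcnj :: "quat \<Rightarrow> quat" where
  "qcnj x = (cnj (fst x), - snd x)"

definition omul :: "oct \<Rightarrow> oct \<Rightarrow> oct" where
  "omul x y = (qmul (fst x) (fst y) - qmul (qcnj (snd y)) (snd x),
               qmul (snd y) (fst x) + qmul (snd x) (qcnj (fst y)))"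

definition ocnj :: "oct \<Rightarrow> oct" where
  "ocnj x = (qcnj (fst x), - snd x)"

definition oct_re :: "oct \<Rightarrow> real" where
  "oct_re x = Re (fst (fst x))"

definition oct_of_real :: "real \<Rightarrow> oct" where
  "oct_of_real r = ((complex_of_real r, 0), 0)"

type_synonym omat = "3 \<Rightarrow> 3 \<Rightarrow> oct"

definition ohermitian :: "omat \<Rightarrow> bool" where
  "ohermitian A \<longleftrightarrow> (\<forall>i j. A j i = ocnj (A i j))"

definition omat_mult :: "omat \<Rightarrow> omat \<Rightarrow> omat" where
  "omat_mult A B = (\<lambda>i j. \<Sum>k\<in>UNIV. omul (A i k) (B k j))"

definition otrace :: "omat \<Rightarrow> oct" where
  "otrace A = (\<Sum>i\<in>UNIV. A i i)"

definition OP2 :: "omat set" where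
  "OP2 = {P. ohermitian P \<and> omat_mult P P = P \<and> otrace P = oct_of_real 1}"

definition oinner :: "omat \<Rightarrow> omat \<Rightarrow> real" where
  "oinner A B = oct_re (otrace (omat_mult A B))"

definition chordal :: "omat \<Rightarrow> omat \<Rightarrow> real" where
  "chordal P Q = sqrt (1 - oinner P Q)"

definition tight_simplex :: "nat \<Rightarrow> omat set \<Rightarrow> bool" where
  "tight_simplex N S \<longleftrightarrow> S \<subseteq> OP2 \<and> finite S \<and> card S = N \<and>
     (\<forall>P\<in>S. \<forall>Q\<in>S. P \<noteq> Q \<longrightarrow> oinner P Q = (real N - 3) / (3 * (real N - 1)))"

definition tight27 :: "(27 \<Rightarrow> omat) set" where
  "tight27 = {p. inj p \<and> tight_simplex 27 (range p)}"

definition F4 :: "(omat \<Rightarrow> omat) set" where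
  "F4 = {g. bij_betw g OP2 OP2 \<and> (\<forall>P\<in>OP2. \<forall>Q\<in>OP2. chordal (g P) (g Q) = chordal P Q)}"

text \<open>The orbit space tight27 / F4 is locally Euclidean of dimension d at (the orbit of) p:
  there is an F4-invariant relatively open neighbourhood U of p in tight27 and a continuous,
  open map phi from U onto an open subset of R^d whose fibres are exactly the F4-orbits,
  i.e. phi induces a homeomorphism of U/F4 (open in the quotient) onto an open set of R^d.\<close>
definition quotient_locally_euclidean_at ::
    "(27 \<Rightarrow> omat) \<Rightarrow> ('n::finite) itself \<Rightarrow> bool" where
  "quotient_locally_euclidean_at p (_ :: 'n itself) \<longleftrightarrow>
     (\<exists>U (\<phi> :: (27 \<Rightarrow> omat) \<Rightarrow> real ^ 'n).
        p \<in> U \<and> openin (top_of_set tight27) U \<and>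
        (\<forall>q\<in>U. \<forall>g\<in>F4. g \<circ> q \<in> U) \<and>
        continuous_on U \<phi> \<and> open (\<phi> ` U) \<and>
        (\<forall>V. openin (top_of_set U) V \<longrightarrow> open (\<phi> ` V)) \<and>
        (\<forall>q\<in>U. \<forall>r\<in>U. \<phi> q = \<phi> r \<longleftrightarrow> (\<exists>g\<in>F4. r = g \<circ> q)))"

end

theory Submission
  imports Defs
begin

text \<open>The Albert algebra has a model on the real functions on the elementary abelian group of order 27 in which all
  translations are automorphisms. In Fourier coordinates a vector whose nonzero coefficients are a cubic Gauss
  sum modulo 13 on one half of the characters and its conjugate on the other half is a point of the plane. Its 27
  translates form a tight simplex, because all nontrivial coefficients have the same modulus, and the configuration
  has a further symmetry of order 13.

  By these symmetries the infinitesimal deformations split into 27 blocks of three kinds. Each block has dimension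
  4, and the derivations take up 2 dimensions of each block except the trivial one, so there are \<open>27 * 4 = 108\<close>
  infinitesimal deformations, of which \<open>26 * 2 = 52\<close> are trivial.

  The equations of tight simplices are not independent; they satisfy relations, those of the cone \<open>x \<times> x = 0\<close> and 27 coming
  from \<open>(\<Sum>b\<in>Basis. b \<times> b) = - 8 e\<close>, which account exactly for the cokernel of the derivative, so that tight
  simplices near the given one form a manifold of dimension 108. The product of two distinct points of the plane
  is a multiple of the unique point orthogonal to both, so isometries of the plane preserve the cubic form, and the
  values of the cubic form on triples of points separate the orbits of tight simplices. They have constant rank
  \<open>108 - 52 = 56\<close>, and 56 of their linear combinations are a chart of the quotient.\<close>

section \<open>Projections and dimensions\<close>

text \<open>Counting naively, 27 points with 16 parameters each and 27 * 26 / 2 = 351 inner products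
  leave 432 - 351 = 81 degrees of freedom. The true number is 432 - (351 - 27): the derivative of
  the inner products is not onto, so the implicit function theorem does not apply to the equations
  as they stand. The remedy is to carry along linear maps \<open>R q\<close> with
  \<open>R q (C q) = 0\<close> whose kernel at the given simplex is exactly the image of the
  derivative; nearby, the vanishing of independent equations then forces that of the others. The
  count 108 is a lower bound at every tight simplex, so only the upper bound needs the explicit
  configuration. The symmetry of order 13 and complex conjugation permute the 26 nontrivial
  characters transitively, which leaves two linear systems to solve. Their coefficients lie in the
  ring spanned over the Eisenstein integers by 1, the Gauss sum and its conjugate, where integer
  certificates settle invertibility. Constancy of the rank of the cubic form is structural: a tight
  simplex is a basis, so the common kernel is always the whole algebra of derivations.\<close>

definition is_oproj :: "'a::euclidean_space set \<Rightarrow> ('a \<Rightarrow> 'a) \<Rightarrow> bool" where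
  "is_oproj S P \<longleftrightarrow> linear P \<and> range P \<subseteq> S \<and> (\<forall>x\<in>S. P x = x) \<and> (\<forall>x. \<forall>y\<in>S. (x - P x) \<bullet> y = 0)
     \<and> (\<Sum>b\<in>Basis. P b \<bullet> b) = real (dim S)"

definition oproj :: "'a::euclidean_space set \<Rightarrow> 'a \<Rightarrow> 'a" where
  "oproj S = (SOME P. is_oproj S P)"

text \<open>The projection is written in an orthonormal basis of \<open>S\<close>; exchanging two
  sums shows that its trace counts that basis. The trace clause of \<open>is_oproj\<close> is what
  turns dimension counts into trace computations.\<close>

lemma is_oproj_oproj:
  fixes S :: "'a::euclidean_space set"
  assumes "subspace S"
  shows "is_oproj S (oproj S)"
proof -
  obtain B where B: "B \<subseteq> S" "pairwise orthogonal B" "\<And>x. x \<in> B \<Longrightarrow> norm x = 1"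
      "independent B" "card B = dim S" "span B = S"
    using orthonormal_basis_subspace[OF assms] by metis
  have fB: "finite B" using B(4) by (rule independent_imp_finite)
  define P where "P x = (\<Sum>b\<in>B. (x \<bullet> b) *\<^sub>R b)" for x
  have lin: "linear P" unfolding P_def
    by (intro linearI) (simp_all add: inner_left_distrib scaleR_left_distrib sum.distrib scaleR_sum_right)
  have orth: "b \<bullet> b' = (if b = b' then 1 else 0)" if "b \<in> B" "b' \<in> B" for b b'
    using B(2,3) that by (auto simp: pairwise_def orthogonal_def dot_square_norm)
  have ran: "range P \<subseteq> S"
  proof (rule image_subsetI)
    fix x
    have "(\<Sum>b\<in>B. (x \<bullet> b) *\<^sub>R b) \<in> span B" by (intro span_sum span_scale span_base)
    then show "P x \<in> S" using B(6) by (simp add: P_def)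
  qed
  have perp: "(x - P x) \<bullet> y = 0" if "y \<in> S" for x y
  proof -
    have "(x - P x) \<bullet> b = 0" if "b \<in> B" for b
      using that fB by (simp add: P_def inner_diff_left inner_sum_left orth if_distrib cong: if_cong)
    moreover have "y \<in> span B" using that B(6) by simp
    ultimately show ?thesis
      by (metis (no_types, lifting) orthogonal_def orthogonal_to_span)
  qed
  have fix_S: "P x = x" if "x \<in> S" for x
  proof -
    have "x - P x \<in> S" using that ran assms by (auto intro: subspace_diff)
    then have "(x - P x) \<bullet> (x - P x) = 0" by (rule perp)
    then show ?thesis by simp
  qed
  have "(\<Sum>f\<in>Basis. P f \<bullet> f) = (\<Sum>f\<in>Basis. \<Sum>b\<in>B. (f \<bullet> b)\<^sup>2)"
    by (intro sum.cong refl) (simp add: P_def inner_sum_left power2_eq_square, simp add: inner_commute)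
  also have "\<dots> = (\<Sum>b\<in>B. \<Sum>f\<in>Basis. (f \<bullet> b)\<^sup>2)" by (rule sum.swap)
  also have "\<dots> = (\<Sum>b\<in>B. b \<bullet> b)"
    by (intro sum.cong refl) (simp add: euclidean_inner[of b b for b] power2_eq_square inner_commute)
  also have "\<dots> = real (dim S)" using B(5) orth by simp
  finally have "is_oproj S P" unfolding is_oproj_def using lin ran fix_S perp by blast
  then show ?thesis unfolding oproj_def by (rule someI[of "is_oproj S"])
qed

lemma
  fixes S :: "'a::euclidean_space set"
  assumes "subspace S"
  shows linear_oproj: "linear (oproj S)"
    and oproj_in: "oproj S x \<in> S"
    and oproj_id: "x \<in> S \<Longrightarrow> oproj S x = x"
    and oproj_orth: "y \<in> S \<Longrightarrow> (x - oproj S x) \<bullet> y = 0"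
    and trace_oproj: "(\<Sum>b\<in>Basis. oproj S b \<bullet> b) = real (dim S)"
  using is_oproj_oproj[OF assms] unfolding is_oproj_def by auto

text \<open>A symmetric idempotent is the orthogonal projection to its range, so its trace is its
  rank. This counts dimensions of matrix and tangent spaces without exhibiting bases.\<close>

lemma dim_range_idempotent:
  fixes P :: "'a::euclidean_space \<Rightarrow> 'a"
  assumes "linear P" "\<And>x. P (P x) = P x" "\<And>x y. P x \<bullet> y = x \<bullet> P y"
  shows "real (dim (range P)) = (\<Sum>b\<in>Basis. P b \<bullet> b)"
proof -
  have S: "subspace (range P)" using assms(1) by (simp add: linear_subspace_image)
  define Q where "Q = oproj (range P)"
  note Q = linear_oproj[OF S, folded Q_def] oproj_in[OF S, folded Q_def] oproj_id[OF S, folded Q_def]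
    oproj_orth[OF S, folded Q_def] trace_oproj[OF S, folded Q_def]
  have "Q x = P x" for x
  proof -
    obtain y where "Q x = P y" using Q(2)[of x] by blast
    then have QP: "P (Q x) = Q x" using assms(2) by simp
    have "(Q x - P x) \<bullet> (Q x - P x) = (x - Q x) \<bullet> P x - (x - Q x) \<bullet> Q x - (x - P x) \<bullet> P x + (x - P x) \<bullet> Q x"
      by (simp add: inner_diff_left inner_diff_right inner_commute)
    also have "\<dots> = 0"
    proof -
      have "(x - P x) \<bullet> P y = 0" for y
        by (metis assms(2,3) diff_self inner_diff_left)
      from this[of x] this[of "Q x"] have "(x - P x) \<bullet> P x = 0" "(x - P x) \<bullet> Q x = 0" using QP by simp_all
      moreover have "(x - Q x) \<bullet> P x = 0" "(x - Q x) \<bullet> Q x = 0"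
        using Q(2)[of x] by (auto intro!: Q(4))
      ultimately show ?thesis by simp
    qed
    finally show ?thesis by simp
  qed
  then show ?thesis using Q(5) by simp
qed

text \<open>On the orthogonal complement \<open>M\<close> of the kernel within \<open>S\<close> the
  map is injective and has the same image as on \<open>S\<close>.\<close>

lemma dim_kernel_plus_dim_image:
  fixes f :: "'a::euclidean_space \<Rightarrow> 'b::euclidean_space"
  assumes "linear f" "subspace S"
  shows "dim {x\<in>S. f x = 0} + dim (f ` S) = dim S"
proof -
  define N where "N = {x\<in>S. f x = 0}"
  have sN: "subspace N"
    unfolding N_def using assms
    by (auto simp: subspace_def linear_add linear_scale linear_0)
  have NS: "N \<subseteq> S" by (auto simp: N_def)
  define M where "M = {y\<in>S. \<forall>x\<in>N. orthogonal x y}"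
  have sM: "subspace M" unfolding M_def using assms(2)
    by (auto simp: subspace_def orthogonal_def inner_add_right)
  have d: "dim N + dim M = dim S"
    using dim_subspace_orthogonal_to_vectors[OF sN assms(2) NS] by (simp add: M_def add.commute)
  have inj: "inj_on f M"
  proof (rule inj_onI)
    fix x y assume xy: "x \<in> M" "y \<in> M" "f x = f y"
    then have z: "x - y \<in> M" using sM by (simp add: subspace_diff)
    then have "x - y \<in> N" using xy assms(1) by (simp add: N_def M_def linear_diff)
    with z have "orthogonal (x - y) (x - y)" by (auto simp: M_def)
    then show "x = y" by (simp add: orthogonal_def)
  qed
  have im: "f ` S = f ` M"
  proof
    show "f ` M \<subseteq> f ` S" by (auto simp: M_def)
    show "f ` S \<subseteq> f ` M"
    proof
      fix y assume "y \<in> f ` S"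
      then obtain x where x: "x \<in> S" "y = f x" by auto
      define P where "P = oproj N"
      note P = linear_oproj[OF sN, folded P_def] oproj_in[OF sN, folded P_def]
        oproj_id[OF sN, folded P_def] oproj_orth[OF sN, folded P_def]
      have "P x \<in> N" using P(2) by auto
      then have "x - P x \<in> M" "f (x - P x) = f x"
        using x P(4)[of _ x] NS assms
        by (auto simp: M_def N_def orthogonal_def inner_commute subspace_diff linear_diff)
      then show "y \<in> f ` M" using x by (metis imageI)
    qed
  qed
  have "dim (f ` M) = dim M"
    using assms(1) inj sM by (metis dim_image_eq span_eq_iff)
  then show ?thesis using d im by (simp add: N_def)
qed

section \<open>Constant rank along a redundantly defined zero set\<close>

text \<open>Injectivity is an open condition: the pair of \<open>R p\<close> and \<open>Q\<close> is
  bounded below by some \<open>B\<close>, and for \<open>q\<close> near \<open>p\<close> the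
  operator \<open>R q\<close> differs from \<open>R p\<close> by less than \<open>B\<close>.\<close>

lemma injective_pair_nearby:
  fixes R :: "'x::metric_space \<Rightarrow> 'b::euclidean_space \<Rightarrow> 'd::euclidean_space"
    and Q :: "'b \<Rightarrow> 'e::euclidean_space"
  assumes "open N" "p \<in> N" "\<And>q. q \<in> N \<Longrightarrow> linear (R q)" "\<And>v. continuous_on N (\<lambda>q. R q v)"
    and "linear Q" "\<And>y. R p y = 0 \<Longrightarrow> Q y = 0 \<Longrightarrow> y = 0"
  obtains N' where "open N'" "p \<in> N'" "N' \<subseteq> N" "\<And>q y. q \<in> N' \<Longrightarrow> R q y = 0 \<Longrightarrow> Q y = 0 \<Longrightarrow> y = 0"
proof -
  define L where "L y = (R p y, Q y)" for y
  have linL: "linear L" unfolding L_def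
    using assms(2,3,5) by (auto intro!: linearI simp: linear_add linear_scale)
  have injL: "inj L" unfolding linear_injective_0[OF linL] using assms(6)
    by (auto simp: L_def zero_prod_def)
  obtain B where B: "B > 0" "\<And>x. B * norm x \<le> norm (L x)"
    using linear_inj_bounded_below_pos[OF linL injL] by metis
  define S where "S q = (\<Sum>b\<in>Basis. norm (R q b - R p b))" for q
  have bd: "norm (R q y - R p y) \<le> S q * norm y" if "q \<in> N" for q y
  proof -
    have lq: "linear (R q)" "linear (R p)" using assms that by auto
    have "R q y - R p y = (\<Sum>b\<in>Basis. (y \<bullet> b) *\<^sub>R (R q b - R p b))"
      by (subst (1 2) euclidean_representation[symmetric, of y])
        (simp add: linear_sum[OF lq(1)] linear_sum[OF lq(2)] linear_scale[OF lq(1)] linear_scale[OF lq(2)]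
          scaleR_diff_right sum_subtractf)
    also have "norm \<dots> \<le> (\<Sum>b\<in>Basis. norm (R q b - R p b) * norm y)"
      by (rule sum_norm_le) (simp add: Basis_le_norm mult.commute mult_right_mono)
    finally show ?thesis by (simp add: S_def sum_distrib_right)
  qed
  have "continuous_on N S" unfolding S_def
    by (intro continuous_intros assms(4))
  then have "open (S -` {..<B} \<inter> N)"
    using assms(1) continuous_on_open_vimage[of N S] by (metis open_lessThan)
  moreover have "S -` {..<B} \<inter> N = {q\<in>N. S q < B}" by auto
  ultimately have "open {q\<in>N. S q < B}" by simp
  moreover have "S p = 0" by (simp add: S_def)
  moreover have "y = 0" if "q \<in> {q\<in>N. S q < B}" "R q y = 0" "Q y = 0" for q y
  proof (rule ccontr)
    assume "y \<noteq> 0"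
    have "norm (L y) = norm (R p y)" using that(3) by (simp add: L_def norm_Pair)
    moreover have "norm (R p y) \<le> S q * norm y" using bd[of q y] that by simp
    moreover have "S q * norm y < B * norm y" using that \<open>y \<noteq> 0\<close> by simp
    ultimately show False using B(2)[of y] by linarith
  qed
  ultimately show ?thesis using that[of "{q\<in>N. S q < B}"] assms(2) B(1) by auto
qed

text \<open>The product rule for \<open>R q (C q) = 0\<close> at a zero of \<open>C\<close>: the
  term containing a derivative of \<open>R\<close> is multiplied by \<open>C q = 0\<close>. Dividing
  by \<open>t\<close> along a line and passing to the limit therefore works with \<open>R\<close>
  merely continuous.\<close>

lemma derivative_of_redundancy:
  fixes C :: "'a::euclidean_space \<Rightarrow> 'b::euclidean_space"
    and R :: "'a \<Rightarrow> 'b \<Rightarrow> 'd::euclidean_space"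
  assumes "open N" "q \<in> N" "\<And>q. q \<in> N \<Longrightarrow> linear (R q)" "\<And>v. continuous_on N (\<lambda>q. R q v)"
    and "\<And>q. q \<in> N \<Longrightarrow> R q (C q) = 0" "C q = 0" "(C has_derivative C') (at q)"
  shows "R q (C' v) = 0"
proof -
  have lin: "linear C'" using assms(7) has_derivative_linear by blast
  have expand: "R x y = (\<Sum>b\<in>Basis. (y \<bullet> b) *\<^sub>R R x b)" if "x \<in> N" for x y
    by (subst (1) euclidean_representation[symmetric, of y])
      (simp add: linear_sum[OF assms(3)[OF that]] linear_scale[OF assms(3)[OF that]])
  have vd: "((\<lambda>t. C (q + t *\<^sub>R v)) has_vector_derivative C' v) (at 0)"
  proof -
    have "((\<lambda>t. C (q + t *\<^sub>R v)) has_derivative (\<lambda>t. C' (t *\<^sub>R v))) (at 0)"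
      by (rule has_derivative_compose[where f="\<lambda>t. q + t *\<^sub>R v" and g=C])
        (auto intro!: derivative_eq_intros simp: assms(7))
    then show ?thesis using lin by (simp add: has_vector_derivative_def linear_scale)
  qed
  have l1: "((\<lambda>t. (1/t) *\<^sub>R C (q + t *\<^sub>R v)) \<longlongrightarrow> C' v) (at 0)"
  proof -
    from vd have l0: "((\<lambda>h. norm (C (q + h *\<^sub>R v) - h *\<^sub>R C' v) / norm h) \<longlongrightarrow> 0) (at 0)"
      by (simp add: has_vector_derivative_def has_derivative_at assms(6))
    have "eventually (\<lambda>h. norm (C (q + h *\<^sub>R v) - h *\<^sub>R C' v) / norm h =
        norm ((1/h) *\<^sub>R C (q + h *\<^sub>R v) - C' v)) (at (0::real))"
      unfolding eventually_at_filter
    proof (rule eventuallyI, intro impI)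
      fix h :: real assume "h \<noteq> 0"
      then have "(1/h) *\<^sub>R C (q + h *\<^sub>R v) - C' v = (1/h) *\<^sub>R (C (q + h *\<^sub>R v) - h *\<^sub>R C' v)"
        by (simp add: scaleR_diff_right)
      then show "norm (C (q + h *\<^sub>R v) - h *\<^sub>R C' v) / norm h = norm ((1/h) *\<^sub>R C (q + h *\<^sub>R v) - C' v)"
        by simp
    qed
    from tendsto_cong[OF this] l0 have "((\<lambda>h. norm ((1/h) *\<^sub>R C (q + h *\<^sub>R v) - C' v)) \<longlongrightarrow> 0) (at 0)"
      by blast
    then show ?thesis by (subst Lim_null) (rule tendsto_norm_zero_cancel)
  qed
  have cont: "((\<lambda>t. R (q + t *\<^sub>R v) b) \<longlongrightarrow> R q b) (at 0)" for b
  proof -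
    have "isCont (\<lambda>x. R x b) q"
      using assms(1,2,4) continuous_on_eq_continuous_at by blast
    then show ?thesis
      by (rule isCont_tendsto_compose) (auto intro!: tendsto_eq_intros)
  qed
  have l2: "((\<lambda>t. \<Sum>b\<in>Basis. (((1/t) *\<^sub>R C (q + t *\<^sub>R v)) \<bullet> b) *\<^sub>R R (q + t *\<^sub>R v) b)
      \<longlongrightarrow> (\<Sum>b\<in>Basis. (C' v \<bullet> b) *\<^sub>R R q b)) (at 0)"
    by (intro tendsto_intros l1 cont)
  have ev: "eventually (\<lambda>t. q + t *\<^sub>R v \<in> N) (at 0)"
  proof -
    have "((\<lambda>t. q + t *\<^sub>R v) \<longlongrightarrow> q) (at 0)" by (auto intro!: tendsto_eq_intros)
    then show ?thesis using assms(1,2) by (simp add: topological_tendstoD)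
  qed
  have "eventually (\<lambda>t. (\<Sum>b\<in>Basis. (((1/t) *\<^sub>R C (q + t *\<^sub>R v)) \<bullet> b) *\<^sub>R R (q + t *\<^sub>R v) b) = 0) (at 0)"
    using ev
  proof eventually_elim
    case (elim t)
    have "R (q + t *\<^sub>R v) ((1/t) *\<^sub>R C (q + t *\<^sub>R v)) = 0"
      using assms(3,5)[OF elim] by (simp add: linear_scale)
    then show ?case by (subst (asm) expand[OF elim])
  qed
  from tendsto_cong[OF this] l2 have "((\<lambda>t. 0::'d) \<longlongrightarrow> (\<Sum>b\<in>Basis. (C' v \<bullet> b) *\<^sub>R R q b)) (at (0::real))"
    by blast
  from tendsto_unique[OF _ this tendsto_const] have "(\<Sum>b\<in>Basis. (C' v \<bullet> b) *\<^sub>R R q b) = 0"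
    by simp
  then show ?thesis by (subst expand[OF assms(2)])
qed


text \<open>Exactness at \<open>p\<close> says that \<open>R p\<close> is injective modulo the image
  of \<open>C' p\<close>. This persists nearby, so near \<open>p\<close> the projection of
  \<open>C\<close> to that image has the same zeros as \<open>C\<close>, and the zero set is a
  manifold with tangent space the kernel of \<open>C' p\<close>. On it \<open>c\<close> has constant
  rank by \<open>dimker\<close>, and \<open>\<Lambda>\<close> selects independent linear
  combinations of its components, as many as the rank.\<close>

proposition constant_rank_on_redundant_zero_set:
  fixes C :: "'a::euclidean_space \<Rightarrow> 'b::euclidean_space"
    and c :: "'a \<Rightarrow> 'c::euclidean_space"
    and R :: "'a \<Rightarrow> 'b \<Rightarrow> 'd::euclidean_space"
    and C' :: "'a \<Rightarrow> 'a \<Rightarrow>\<^sub>L 'b" and c' :: "'a \<Rightarrow> 'a \<Rightarrow>\<^sub>L 'c"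
  assumes derC: "\<And>x. (C has_derivative C' x) (at x)" and contC: "continuous_on UNIV C'"
    and derc: "\<And>x. (c has_derivative c' x) (at x)" and contc: "continuous_on UNIV c'"
    and N: "open N" "p \<in> N"
    and linR: "\<And>q. q \<in> N \<Longrightarrow> linear (R q)" and contR: "\<And>v. continuous_on N (\<lambda>q. R q v)"
    and red: "\<And>q. q \<in> N \<Longrightarrow> R q (C q) = 0"
    and exact: "\<And>v. R p v = 0 \<Longrightarrow> v \<in> range (C' p)"
    and Cp: "C p = 0"
    and dimker: "\<And>q. q \<in> N \<Longrightarrow> C q = 0 \<Longrightarrow> dim {v. C' q v = 0 \<and> c' q v = 0} = m"
    and dimZ: "dim {v. C' p v = 0} = m + CARD('n::finite)"
  obtains W and \<Lambda> :: "'c \<Rightarrow> real ^ 'n"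
  where "open W" "p \<in> W" "W \<subseteq> N" "linear \<Lambda>"
    "\<And>V. open V \<Longrightarrow> V \<subseteq> W \<Longrightarrow> open ((\<lambda>x. \<Lambda> (c x)) ` {q\<in>V. C q = 0})"
    "\<And>q r. \<lbrakk>q \<in> W; r \<in> W; C q = 0; C r = 0; \<Lambda> (c q) = \<Lambda> (c r)\<rbrakk> \<Longrightarrow> c q = c r"
proof -
  have linC: "linear (blinfun_apply (C' q))" and linc: "linear (blinfun_apply (c' q))" for q
    by (simp_all add: bounded_linear.linear blinfun.bounded_linear_right)
  \<comment> \<open>\<open>Z\<close> is the tangent space of the zero set, \<open>K0\<close> its
    directions in which \<open>c\<close> does not change to first order, \<open>K1\<close> a
    complement of \<open>K0\<close> in \<open>Z\<close>, whose dimension is the rank of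
    \<open>c\<close> on the zero set.\<close>
  define Z where "Z = {v. C' p v = 0}"
  define K0 where "K0 = {v. C' p v = 0 \<and> c' p v = 0}"
  define K1 where "K1 = {v\<in>Z. \<forall>w\<in>K0. orthogonal w v}"
  define ZP where "ZP = {v. \<forall>w\<in>Z. orthogonal w v}"
  define I where "I = range (C' p)"
  have sub: "subspace Z" "subspace K0" "subspace I"
  proof -
    show "subspace Z" unfolding Z_def by (rule linear_subspace_kernel[OF linC])
    have "K0 = {v. C' p v = 0} \<inter> {v. c' p v = 0}" by (auto simp: K0_def)
    then show "subspace K0"
      using subspace_inter[OF linear_subspace_kernel[OF linC] linear_subspace_kernel[OF linc]] by simp
    show "subspace I" unfolding I_def by (rule linear_subspace_image[OF linC subspace_UNIV])
  qed
  have subZP: "subspace ZP" and subK1: "subspace K1"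
    unfolding ZP_def K1_def using sub(1)
    by (auto simp: subspace_def orthogonal_def inner_add_right)
  have K0Z: "K0 \<subseteq> Z" by (auto simp: K0_def Z_def)
  have dK0: "dim K0 = m" using dimker[OF N(2) Cp] by (simp add: K0_def)
  have dK1: "dim K1 = CARD('n)"
    using dim_subspace_orthogonal_to_vectors[OF sub(2,1) K0Z] dimZ dK0
    by (simp add: K1_def Z_def)
  define P0 where "P0 = oproj K0"
  define PZ where "PZ = oproj Z"
  define Q where "Q = oproj I"
  note P0 = linear_oproj[OF sub(2), folded P0_def] oproj_in[OF sub(2), folded P0_def]
        oproj_id[OF sub(2), folded P0_def] oproj_orth[OF sub(2), folded P0_def]
  note PZ = linear_oproj[OF sub(1), folded PZ_def] oproj_in[OF sub(1), folded PZ_def]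
        oproj_id[OF sub(1), folded PZ_def] oproj_orth[OF sub(1), folded PZ_def]
  note Q = linear_oproj[OF sub(3), folded Q_def] oproj_in[OF sub(3), folded Q_def]
        oproj_id[OF sub(3), folded Q_def] oproj_orth[OF sub(3), folded Q_def]
  have PZ_ZP: "x - PZ x \<in> ZP" for x using PZ(4) by (auto simp: ZP_def orthogonal_def inner_commute)
  have PZ0: "PZ x = 0" if "x \<in> ZP" for x
  proof -
    have "x \<bullet> PZ x = 0" "(x - PZ x) \<bullet> PZ x = 0"
      using that PZ(2)[of x] PZ(4)[of "PZ x" x] by (auto simp: ZP_def orthogonal_def inner_commute)
    then show ?thesis by (simp add: inner_diff_left)
  qed
  have P0_0: "P0 x = 0" if "x \<in> ZP \<or> x \<in> K1" for x
  proof -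
    have "x \<bullet> P0 x = 0" "(x - P0 x) \<bullet> P0 x = 0"
      using that P0(2)[of x] K0Z P0(4)[of "P0 x" x]
      by (auto simp: ZP_def K1_def orthogonal_def inner_commute)
    then show ?thesis by (simp add: inner_diff_left)
  qed
  have inj: "inj_on (C' p) ZP"
  proof (rule inj_onI)
    fix x y assume "x \<in> ZP" "y \<in> ZP" "C' p x = C' p y"
    then have "x - y \<in> Z" "x - y \<in> ZP"
      using subZP by (auto simp: Z_def blinfun.diff_right subspace_diff)
    then have "orthogonal (x - y) (x - y)" by (simp add: ZP_def)
    then show "x = y" by (simp add: orthogonal_def)
  qed
  obtain g where g: "range g \<subseteq> ZP" "linear g" "\<And>v. v \<in> ZP \<Longrightarrow> g (C' p v) = v"
    using linear_exists_left_inverse_on[OF linC subZP inj] by metis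
  \<comment> \<open>\<open>A\<close> inverts \<open>C' p\<close> after projection to its image, so
    that \<open>A\<close> after \<open>C' p\<close> is the projection along
    \<open>Z\<close>.\<close>
  define A where "A y = g (Q y)" for y
  have linA: "linear A" unfolding A_def using linear_compose[OF Q(1) g(2)] by (simp add: o_def)
  have A_ZP: "A y \<in> ZP" for y using g(1) by (auto simp: A_def)
  have A_C: "A (C' p v) = v - PZ v" for v
  proof -
    have "C' p v = C' p (v - PZ v)" using PZ(2)[of v] by (simp add: blinfun.diff_right Z_def)
    then show ?thesis using g(3)[OF PZ_ZP[of v]] Q(3)[of "C' p v"] by (simp add: A_def I_def)
  qed
  have A0: "Q y = 0" if "A y = 0" for y
  proof -
    obtain v where v: "Q y = C' p v" using Q(2)[of y] by (auto simp: I_def)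
    have "A (C' p v) = 0" using that v Q(3)[OF Q(2)[of y]] by (simp add: A_def)
    then have "v = PZ v" using A_C by simp
    then show ?thesis using PZ(2)[of v] v by (simp add: Z_def)
  qed
  have injK1: "inj_on (c' p) K1"
  proof (rule inj_onI)
    fix x y assume xy: "x \<in> K1" "y \<in> K1" "c' p x = c' p y"
    then have K1: "x - y \<in> K1" using subK1 by (simp add: subspace_diff)
    have "x - y \<in> K0" using xy by (auto simp: K0_def K1_def Z_def blinfun.diff_right)
    with K1 have "orthogonal (x - y) (x - y)" by (simp add: K1_def)
    then show "x = y" by (simp add: orthogonal_def)
  qed
  obtain h where h: "range h \<subseteq> K1" "linear h" "\<And>v. v \<in> K1 \<Longrightarrow> h (c' p v) = v"
    using linear_exists_left_inverse_on[OF linc subK1 injK1] by metis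
  obtain B :: "'a \<Rightarrow> real ^ 'n" where B: "linear B" "B ` K1 = UNIV" "inj_on B K1"
    using subspace_isomorphism[OF subK1, of "UNIV :: (real^'n) set"] dK1 by (auto simp: dim_UNIV)
  obtain B' where B': "range B' \<subseteq> K1" "linear B'" "\<And>v. v \<in> K1 \<Longrightarrow> B' (B v) = v"
    using linear_exists_left_inverse_on[OF B(1) subK1 B(3)] by metis
  have BB': "B (B' w) = w" for w
    by (metis B(2) B'(3) UNIV_I imageE)
  \<comment> \<open>On the image of \<open>K1\<close> this undoes \<open>c' p\<close>, followed by
    an identification of \<open>K1\<close> with the coordinate space.\<close>
  define \<Lambda> where "\<Lambda> y = B (h y)" for y
  have lin\<Lambda>: "linear \<Lambda>" unfolding \<Lambda>_def using linear_compose[OF h(2) B(1)] by (simp add: o_def)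
  define D where "D q v = A (C' q v) + B' (\<Lambda> (c' q v)) + P0 v" for q v
  have Bin: "B' w \<in> K1" for w using B'(1) by auto
  \<comment> \<open>The three summands of \<open>D\<close> lie in the mutually orthogonal spaces \<open>ZP\<close>, \<open>K1\<close>, \<open>K0\<close>.\<close>
  have split: "PZ (a + b + d) = b + d" "P0 (a + b + d) = d"
    if "a \<in> ZP" "b \<in> K1" "d \<in> K0" for a b d
  proof -
    have "b + d \<in> Z" using that K0Z sub(1) by (auto simp: K1_def subspace_add)
    then show "PZ (a + b + d) = b + d"
      using PZ(3)[of "b+d"] PZ0[OF that(1)] linear_add[OF PZ(1), of a "b + d"] by (simp add: add.assoc)
    show "P0 (a + b + d) = d"
      using P0_0[of a] P0_0[of b] that P0(3)[of d] by (simp add: linear_add[OF P0(1)])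
  qed
  have comp: "A y = x - PZ x" "B' w = PZ x - P0 x" if "x = A y + B' w + P0 v" for x y w v
    using split[OF A_ZP[of y] Bin[of w] P0(2)[of v]] that by simp_all
  \<comment> \<open>A chart at \<open>p\<close>: its \<open>ZP\<close> component cuts out the zero
    set, its \<open>K1\<close> component records \<open>\<Lambda> (c x)\<close>, and its
    \<open>K0\<close> component fills up the remaining directions.\<close>
  define F where "F x = A (C x) + B' (\<Lambda> (c x)) + P0 x" for x
  have blA: "bounded_linear A" and blB: "bounded_linear (\<lambda>y. B' (\<Lambda> y))" and blP: "bounded_linear P0"
    using linA P0(1) linear_compose[OF lin\<Lambda> B'(2)] by (simp_all add: linear_conv_bounded_linear o_def)
  define F' where "F' q = (Blinfun A o\<^sub>L C' q) + (Blinfun (\<lambda>y. B' (\<Lambda> y)) o\<^sub>L c' q) + Blinfun P0" for q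
  have F'D: "blinfun_apply (F' q) = D q" for q
    by (rule ext) (simp add: F'_def D_def blinfun.add_left bounded_linear_Blinfun_apply[OF blA]
        bounded_linear_Blinfun_apply[OF blB] bounded_linear_Blinfun_apply[OF blP])
  have derF: "(F has_derivative F' q) (at q)" for q
    unfolding F'D unfolding F_def D_def
    by (intro derivative_intros bounded_linear.has_derivative[OF blA] bounded_linear.has_derivative[OF blB]
        bounded_linear_imp_has_derivative[OF blP] derC derc)
  have contF: "continuous_on UNIV F'"
    unfolding F'_def by (intro continuous_intros contC contc)
  have "inj (D p)"
  proof -
    have lin: "linear (D p)" using bounded_linear.linear[OF blinfun.bounded_linear_right[of "F' p"]] by (simp add: F'D)
    have "v = 0" if "D p v = 0" for v
    proof -
      have "0 = A (C' p v) + B' (\<Lambda> (c' p v)) + P0 v" using that by (simp add: D_def)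
      note cp = comp[OF this] split[OF A_ZP Bin P0(2), of "C' p v" "\<Lambda> (c' p v)" v]
      have z: "PZ 0 = 0" "P0 0 = 0" by (simp_all add: linear_0[OF PZ(1)] linear_0[OF P0(1)])
      have "A (C' p v) = 0" "B' (\<Lambda> (c' p v)) = 0" using cp(1,2) z by simp_all
      moreover have P0v: "P0 v = 0" using that calculation by (simp add: D_def)
      ultimately have "v = PZ v" "\<Lambda> (c' p v) = 0" using A_C[of v] BB'[of "\<Lambda> (c' p v)"] linear_0[OF B(1)] by simp_all
      have "v \<in> Z" using \<open>v = PZ v\<close> PZ(2)[of v] by simp
      then have "v \<in> K1" using P0(4)[of _ v] P0v by (auto simp: K1_def orthogonal_def inner_commute)
      then have "B v = 0" using \<open>\<Lambda> (c' p v) = 0\<close> h(3) by (simp add: \<Lambda>_def)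
      then show "v = 0" using B'(3)[OF \<open>v \<in> K1\<close>] linear_0[OF B'(2)] by simp
    qed
    then show ?thesis using linear_injective_0[OF lin] by blast
  qed
  then obtain G where G: "linear G" "\<And>x. G (D p x) = x"
    using linear_injective_left_inverse[of "D p"] bounded_linear.linear[OF blinfun.bounded_linear_right[of "F' p"]]
    by (metis F'D comp_apply id_apply)
  have invG: "Blinfun G o\<^sub>L F' p = id_blinfun"
    using G by (intro blinfun_eqI)
      (simp add: F'D bounded_linear_Blinfun_apply linear_conv_bounded_linear[symmetric])
  \<comment> \<open>On \<open>N'\<close> the vanishing of the projection \<open>Q (C q)\<close>
    forces \<open>C q = 0\<close>, because \<open>R q (C q) = 0\<close> holds there as well.\<close>
  obtain N' where N': "open N'" "p \<in> N'" "N' \<subseteq> N" "\<And>q y. q \<in> N' \<Longrightarrow> R q y = 0 \<Longrightarrow> Q y = 0 \<Longrightarrow> y = 0"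
  proof (rule injective_pair_nearby[OF N linR contR Q(1)])
    fix y assume "R p y = 0" "Q y = 0"
    then have "y \<in> I" using exact by (simp add: I_def)
    then show "y = 0" using Q(3) \<open>Q y = 0\<close> by simp
  qed auto
  obtain U' V g g' where IF: "open U'" "U' \<subseteq> N'" "p \<in> U'" "open V" "F p \<in> V" "homeomorphism U' V F g"
    "\<And>y. y \<in> V \<Longrightarrow> (g has_derivative (g' y)) (at y)"
    "\<And>y. y \<in> V \<Longrightarrow> g' y = inv (blinfun_apply (F' (g y)))"
    "\<And>y. y \<in> V \<Longrightarrow> bij (blinfun_apply (F' (g y)))"
    using inverse_function_theorem[OF N'(1) derF continuous_on_subset[OF contF subset_UNIV] N'(2) invG]
    by metis
  \<comment> \<open>A ball is taken because it is convex: segments in the chart between two of its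
    points must stay inside.\<close>
  obtain \<rho> where \<rho>: "\<rho> > 0" "ball (F p) \<rho> \<subseteq> V" using IF(4,5) openE by blast
  define W where "W = g ` ball (F p) \<rho>"
  have hom: "homeomorphism (ball (F p) \<rho>) W g F"
    unfolding W_def using IF(6) \<rho>(2) homeomorphism_symD homeomorphism_of_subsets
    by (metis homeomorphism_image1 homeomorphism_symD image_mono)
  have gF: "g (F q) = q" "F q \<in> ball (F p) \<rho>" if "q \<in> W" for q
    using hom that by (auto simp: homeomorphism_def)
  have Fg: "F (g y) = y" "g y \<in> W" if "y \<in> ball (F p) \<rho>" for y
    using hom that by (auto simp: homeomorphism_def)
  have WU: "W \<subseteq> U'" unfolding W_def using IF(6) \<rho>(2) by (auto simp: homeomorphism_def)
  have openV: "open (F ` X)" if "open X" "X \<subseteq> W" for X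
  proof -
    have "openin (top_of_set U') X" using that WU by (simp add: openin_open_eq[OF IF(1)] order_trans)
    then have "openin (top_of_set V) (F ` X)" using homeomorphism_imp_open_map[OF IF(6)] by blast
    then show ?thesis using IF(4) openin_open_eq by blast
  qed
  have "open W"
  proof -
    have "openin (top_of_set V) (ball (F p) \<rho>)" using \<rho>(2) by (simp add: openin_open_eq[OF IF(4)])
    then have "openin (top_of_set U') W" unfolding W_def
      using homeomorphism_imp_open_map[OF homeomorphism_symD[OF IF(6)]] by blast
    then show ?thesis using IF(1) openin_open_eq by blast
  qed
  moreover have "p \<in> W"
    unfolding W_def using IF(3,6) \<rho>(1) by (force simp: homeomorphism_def image_iff intro!: bexI[of _ "F p"])
  moreover have "W \<subseteq> N" using WU IF(2) N'(3) by blast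
  moreover note lin\<Lambda>
  moreover
  have C0: "C q = 0 \<longleftrightarrow> F q - PZ (F q) = 0" and \<Lambda>F: "\<Lambda> (c q) = B (PZ (F q) - P0 (F q))" if "q \<in> W" for q
  proof -
    have q: "q \<in> N'" using that WU IF(2) by blast
    note cp = comp[of "F q" "C q" "\<Lambda> (c q)" q, OF F_def]
    have "C q = 0" if "A (C q) = 0"
      using N'(4)[OF q] red N'(3) q A0[OF that] by blast
    then show "C q = 0 \<longleftrightarrow> F q - PZ (F q) = 0" using cp(1) linear_0[OF linA] by metis
    show "\<Lambda> (c q) = B (PZ (F q) - P0 (F q))" using cp(2) BB' by metis
  qed
  have "open ((\<lambda>x. \<Lambda> (c x)) ` {q\<in>X. C q = 0})" if X: "open X" "X \<subseteq> W" for X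
    unfolding open_contains_ball
  proof
    fix w assume "w \<in> (\<lambda>x. \<Lambda> (c x)) ` {q\<in>X. C q = 0}"
    then obtain q where q: "q \<in> X" "C q = 0" "w = \<Lambda> (c q)" by auto
    obtain e where e: "e > 0" "ball (F q) e \<subseteq> F ` X"
      using openV[OF X] q(1) openE by blast
    have "isCont B' 0" using B'(2) by (simp add: linear_continuous_at linear_conv_bounded_linear)
    then obtain d where d: "d > 0" "\<And>x. norm x < d \<Longrightarrow> norm (B' x) < e"
      using e(1) linear_0[OF B'(2)] unfolding continuous_at_eps_delta
      by (metis diff_0_right dist_norm)
    have "w' \<in> (\<lambda>x. \<Lambda> (c x)) ` {q\<in>X. C q = 0}" if "dist w w' < d" for w'
    proof -
      \<comment> \<open>Changing only the \<open>K1\<close> coordinate stays in the zero set and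
        moves the value of \<open>\<Lambda>\<close> by any small prescribed amount.\<close>
      define y where "y = F q + B' (w' - w)"
      have "norm (w' - w) < d" using that by (simp add: dist_norm norm_minus_commute)
      then have "y \<in> ball (F q) e" using d(2) by (simp add: y_def dist_norm)
      then obtain r where r: "r \<in> X" "F r = y" using e(2) by auto
      have bz: "B' (w' - w) \<in> Z" using Bin[of "w' - w"] by (auto simp: K1_def)
      have "PZ y = PZ (F q) + B' (w' - w)"
        using PZ(3)[OF bz] by (simp add: y_def linear_add[OF PZ(1)])
      moreover have "P0 y = P0 (F q)" using P0_0[of "B' (w' - w)"] Bin by (simp add: y_def linear_add[OF P0(1)])
      moreover have "F q - PZ (F q) = 0" "w = B (PZ (F q) - P0 (F q))"
        using q C0 \<Lambda>F X(2) by blast+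
      ultimately have "y - PZ y = 0" "w' = B (PZ y - P0 y)"
        using BB'[of "w' - w"] by (simp_all add: y_def linear_add[OF B(1)] linear_diff[OF B(1)])
      then have "C r = 0" "w' = \<Lambda> (c r)" using r C0[of r] \<Lambda>F[of r] X(2) by auto
      then show ?thesis using r(1) by auto
    qed
    then show "\<exists>d>0. ball w d \<subseteq> (\<lambda>x. \<Lambda> (c x)) ` {q\<in>X. C q = 0}"
      using d(1) by (intro exI[of _ d]) auto
  qed
  moreover
  have "c q = c r" if qr: "q \<in> W" "r \<in> W" "C q = 0" "C r = 0" "\<Lambda> (c q) = \<Lambda> (c r)" for q r
  proof -
    \<comment> \<open>For two zeros with equal values of \<open>\<Lambda>\<close> the chart
      coordinates differ only by a \<open>K0\<close> component, so the segment between them is a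
      path in the zero set along which \<open>c\<close> turns out to be stationary.\<close>
    define k where "k = F r - F q"
    define y where "y t = F q + t *\<^sub>R k" for t
    have PZq: "PZ (F q) = F q" "PZ (F r) = F r" using C0 qr by simp_all
    have "PZ (F q) - P0 (F q) = PZ (F r) - P0 (F r)"
    proof -
      have "PZ (F x) - P0 (F x) \<in> K1" if "C x = 0" "x \<in> W" for x
        using comp(2)[of "F x" "C x" "\<Lambda> (c x)" x, OF F_def] Bin by metis
      then show ?thesis using \<Lambda>F qr B'(3) by metis
    qed
    moreover have "k = (F r - P0 (F r)) - (F q - P0 (F q)) + (P0 (F r) - P0 (F q))" by (simp add: k_def)
    ultimately have k: "k = P0 (F r) - P0 (F q)" using PZq by simp
    then have kK0: "k \<in> K0" using P0(2) sub(2) by (simp add: subspace_diff)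
    have kZ: "PZ k = k" using kK0 K0Z PZ(3) by blast
    have yb: "y t \<in> ball (F p) \<rho>" if "t \<in> {0..1}" for t
    proof -
      have "y t = (1 - t) *\<^sub>R F q + t *\<^sub>R F r" by (simp add: y_def k_def algebra_simps)
      then show ?thesis using convex_ball[of "F p" \<rho>] gF(2) qr(1,2) that
        by (auto simp: convex_alt)
    qed
    have deriv0: "((\<lambda>t. c (g (y t))) has_derivative (\<lambda>h. 0)) (at t within {0..1})" if t: "t \<in> {0..1}" for t
    proof -
      define x where "x = g (y t)"
      have x: "x \<in> W" "F x = y t" using Fg yb[OF t] by (auto simp: x_def)
      have yV: "y t \<in> V" using yb[OF t] \<rho>(2) by blast
      have PZy: "PZ (y t) = y t" using PZq kZ by (simp add: y_def linear_add[OF PZ(1)] linear_scale[OF PZ(1)])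
      have Cx: "C x = 0" using C0[OF x(1)] x(2) PZy by simp
      define v where "v = g' (y t) k"
      have Dv: "D x v = k"
        using IF(8)[OF yV] IF(9)[OF yV] by (simp add: v_def F'D x_def bij_is_surj surj_f_inv_f)
      have xN': "x \<in> N'" "x \<in> N" using x(1) WU IF(2) N'(3) by auto
      have RC: "R x (C' x v) = 0" for v
        by (rule derivative_of_redundancy[OF N(1) xN'(2) linR contR red Cx derC])
      \<comment> \<open>Near \<open>p\<close> the common kernel of \<open>A \<circ> C'\<close> and \<open>\<Lambda> \<circ> c'\<close> has dimension at most \<open>m\<close>,
        hence equals the common kernel of \<open>C'\<close> and \<open>c'\<close>.\<close>
      define S where "S = {v. A (C' x v) = 0 \<and> \<Lambda> (c' x v) = 0}"
      have subS: "subspace S" unfolding S_def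
        using linear_compose[OF linC[of x] linA] linear_compose[OF linc[of x] lin\<Lambda>]
        by (auto simp: subspace_def o_def blinfun.add_right blinfun.scaleR_right linear_0[OF linA] linear_0[OF lin\<Lambda>]
            linear_add[OF linA] linear_add[OF lin\<Lambda>] linear_scale[OF linA] linear_scale[OF lin\<Lambda>])
      have "dim S \<le> dim K0"
      proof -
        have "bij (D x)" using IF(9)[OF yV] by (simp add: F'D x_def)
        moreover have "D x v = P0 v" if "v \<in> S" for v
          using that linear_0[OF B'(2)] by (simp add: S_def D_def)
        ultimately have "inj_on P0 S" by (metis (no_types, lifting) bij_is_inj inj_onI injD)
        then have "dim (P0 ` S) = dim S" using P0(1) subS by (metis dim_image_eq span_eq_iff)
        moreover have "P0 ` S \<subseteq> K0" using P0(2) by auto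
        ultimately show ?thesis by (metis dim_subset)
      qed
      moreover define T where "T = {v. C' x v = 0 \<and> c' x v = 0}"
      have "T \<subseteq> S" by (auto simp: S_def T_def linear_0[OF linA] linear_0[OF lin\<Lambda>])
      moreover have "subspace T" by (auto simp: T_def subspace_def blinfun.add_right blinfun.scaleR_right)
      moreover have "dim T = m" using dimker[OF xN'(2) Cx] by (simp add: T_def)
      ultimately have "T = S" using subS dK0 subspace_dim_equal by metis
      moreover have "v \<in> S"
      proof -
        have "k = A (C' x v) + B' (\<Lambda> (c' x v)) + P0 v" using Dv by (simp add: D_def)
        note cp = comp[OF this]
        have "P0 k = k" using kK0 P0(3) by blast
        then have "A (C' x v) = 0" "B' (\<Lambda> (c' x v)) = 0" using cp kZ by simp_all
        then show ?thesis using BB'[of "\<Lambda> (c' x v)"] linear_0[OF B(1)] by (simp add: S_def)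
      qed
      ultimately have cv: "c' x v = 0" unfolding T_def by blast
      have "(y has_derivative (\<lambda>h. h *\<^sub>R k)) (at t within {0..1})"
        unfolding y_def by (auto intro!: derivative_eq_intros)
      then have "((\<lambda>t. g (y t)) has_derivative (\<lambda>h. g' (y t) (h *\<^sub>R k))) (at t within {0..1})"
        by (rule has_derivative_compose) (rule IF(7)[OF yV])
      then have "((\<lambda>t. c (g (y t))) has_derivative (\<lambda>h. c' x (g' (y t) (h *\<^sub>R k)))) (at t within {0..1})"
        by (rule has_derivative_compose) (simp add: derc x_def)
      moreover have "c' x (g' (y t) (h *\<^sub>R k)) = 0" for h
        using cv has_derivative_linear[OF IF(7)[OF yV]] by (simp add: linear_scale v_def[symmetric] blinfun.scaleR_right)
      ultimately show ?thesis by simp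
    qed
    have "c (g (y 0)) = c (g (y 1))"
      using has_derivative_zero_constant[of "{0..1}" "\<lambda>t. c (g (y t))"] deriv0
      by (metis atLeastAtMost_iff convex_real_interval(5) dual_order.refl zero_le_one)
    then show ?thesis using gF(1) qr(1,2) by (simp add: y_def k_def)
  qed
  ultimately show thesis by (rule that)
qed

lemma double_cancel: "a + a = b + b \<Longrightarrow> a = (b::'a::real_vector)"
  by (metis scaleR_2 scaleR_left_imp_eq zero_neq_numeral)

lemma scaleR_3: "3 *\<^sub>R a = a + a + (a::'a::real_vector)"
  using scaleR_left_distrib[of 2 1 a] by (simp add: scaleR_2)

section \<open>Cubic Jordan algebras of Albert type\<close>

text \<open>Freudenthal's cross product, normalised so that \<open>cr x x\<close> is twice the
  adjoint of \<open>x\<close> and \<open>cr x x \<bullet> x\<close> is six times the norm. The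
  adjoint identity is the full polarisation of the rule that the adjoint of the adjoint of
  \<open>x\<close> is the norm of \<open>x\<close> times \<open>x\<close>. The factor -8 agrees with
  pairing by \<open>e\<close>: 3 - 27 = -8 * 3.\<close>

locale albert = cr: bounded_bilinear cr
  for cr :: "'j::euclidean_space \<Rightarrow> 'j \<Rightarrow> 'j" +
  fixes e :: 'j
  assumes cr_commute: "cr x y = cr y x"
    and cr_cyclic: "cr x y \<bullet> z = x \<bullet> cr y z"
    and adjoint_identity: "cr (cr x y) (cr z w) + cr (cr x z) (cr y w) + cr (cr x w) (cr y z) =
      (cr x y \<bullet> z) *\<^sub>R w + (cr x y \<bullet> w) *\<^sub>R z + (cr x z \<bullet> w) *\<^sub>R y + (cr y z \<bullet> w) *\<^sub>R x"
    and cr_unit: "cr e x = (x \<bullet> e) *\<^sub>R e - x"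
    and unit_unit: "e \<bullet> e = 3"
    and sum_cr_Basis: "(\<Sum>b\<in>Basis. cr b b) = (-8) *\<^sub>R e"
    and dim27: "DIM('j) = 27"
begin

section \<open>Points of the projective plane and products of points\<close>

definition plane :: "'j set" where
  "plane = {x. cr x x = 0 \<and> x \<bullet> e = 1}"

lemmas cr_simps = cr.add_left cr.add_right cr.diff_left cr.diff_right cr.scaleR_left cr.scaleR_right
  cr.minus_left cr.minus_right cr.zero_left cr.zero_right

lemma cr_unit_right: "cr x e = (x \<bullet> e) *\<^sub>R e - x"
  by (simp add: cr_commute[of x] cr_unit)

lemma cr_exchange: "cr x y \<bullet> z = cr x z \<bullet> y"
  by (metis cr_commute cr_cyclic inner_commute)

text \<open>In the adjoint identity at \<open>r, r, p, p\<close> only the two copies of the square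
  of \<open>cr r p\<close> survive. Hence a nonzero product of two points is proportional to a
  point.\<close>

lemma cr_null_product:
  assumes "cr p p = 0" "cr r r = 0"
  shows "cr (cr r p) (cr r p) = 0"
proof -
  have "cr r p \<bullet> p = 0" using assms by (simp add: cr_cyclic)
  then have "cr (cr r p) (cr r p) + cr (cr r p) (cr r p) = 0"
    using adjoint_identity[of r r p p] assms by (simp add: cr_simps)
  then show ?thesis by (simp add: scaleR_2[symmetric])
qed

lemma plane_norm: "p \<in> plane \<Longrightarrow> p \<bullet> p = 1"
  using cr_cyclic[of p p e] by (simp add: plane_def cr_unit_right inner_diff_right)

lemma cr_plane_unit: "p \<in> plane \<Longrightarrow> cr p (e - p) = e - p"
  by (simp add: plane_def cr_simps cr_unit_right)

text \<open>The Peirce decomposition of the idempotent \<open>p\<close> in one formula: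
  \<open>cr p\<close> acts as 1 on \<open>e - p\<close>, and otherwise has only the eigenvalues 0
  and -1.\<close>

lemma cr_plane_square:
  assumes "p \<in> plane"
  shows "cr p (cr p y) = (y \<bullet> (e - p)) *\<^sub>R (e - p) - cr p y"
proof -
  have p: "cr p p = 0" "p \<bullet> e = 1" using assms by (auto simp: plane_def)
  have k: "cr p y \<bullet> e = y \<bullet> (e - p)"
    using p by (simp add: cr_commute[of p y] cr_cyclic cr_unit_right)
  have z: "cr p y \<bullet> p = 0" using p cr_exchange[of p y p] by simp
  have "cr (cr p y) (cr p e) + cr (cr p y) (cr p e) = (cr p y \<bullet> e) *\<^sub>R p + (cr p y \<bullet> e) *\<^sub>R p"
    using adjoint_identity[of p p y e] p by (simp add: cr_simps cr_exchange[of p e y] cr_commute[of "cr p e"])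
  then have "cr (cr p y) (cr p e) = (cr p y \<bullet> e) *\<^sub>R p"
    by (rule double_cancel)
  then have "(cr p y \<bullet> e) *\<^sub>R e - cr p y - cr p (cr p y) = (cr p y \<bullet> e) *\<^sub>R p"
    using p by (simp add: cr_unit_right cr_simps cr_commute[of "cr p y" p])
  then show ?thesis by (simp add: k algebra_simps)
qed

lemma cr_plane_cube: "p \<in> plane \<Longrightarrow> cr p (cr p (cr p y)) = cr p y"
  by (simp add: cr_plane_square[of p y] cr_simps cr_plane_unit)
    (simp add: cr_plane_square plane_def cr_simps cr_unit_right inner_diff_right)

text \<open>Two orthogonal points are completed to a frame by their product: \<open>cr r p\<close>
  equals \<open>e - r - p\<close>, because the difference has norm zero. Multiplying by
  \<open>r\<close> again returns \<open>p\<close>.\<close>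

lemma cr_plane_orthogonal:
  assumes "p \<in> plane" "r \<in> plane" "p \<bullet> r = 0"
  shows "cr r (cr r p) = p"
proof -
  have r: "r \<bullet> e = 1" "r \<bullet> r = 1" and p: "p \<bullet> e = 1" "p \<bullet> p = 1" "cr p p = 0" "cr r r = 0"
    using assms plane_norm by (auto simp: plane_def)
  have sq: "cr (cr r p) (cr r p) = 0" using p by (intro cr_null_product)
  have tr: "cr r p \<bullet> e = 1"
    using p r assms(3) by (simp add: cr_cyclic cr_unit_right inner_diff_right inner_commute[of r p])
  have "cr r p \<in> plane" using sq tr by (simp add: plane_def)
  then have n: "cr r p \<bullet> cr r p = 1" by (rule plane_norm)
  have "cr r p \<bullet> r = 0" "cr r p \<bullet> p = 0"
    using p cr_exchange[of r p r] by (simp_all add: cr_cyclic)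
  then have "(cr r p - (e - r - p)) \<bullet> (cr r p - (e - r - p)) = 0"
    using n tr p r assms(3) unit_unit by (simp add: inner_diff_left inner_diff_right inner_commute)
  then have "cr r p = e - r - p" by simp
  moreover have "cr r (cr r p) = e - r - cr r p"
    using cr_plane_square[OF assms(2), of p] p r assms(3) by (simp add: inner_diff_right inner_commute)
  ultimately show ?thesis by simp
qed


text \<open>Multiplication by \<open>r\<close> is an involution on the points orthogonal to
  \<open>r\<close>, so both points can be written as multiples \<open>cr r p'\<close> and
  \<open>cr r q'\<close>. The adjoint identity at \<open>r, r, p', q'\<close> then leaves only a
  multiple of \<open>r\<close>, and pairing with \<open>e\<close> finds the factor.\<close>

lemma cr_plane_third_point:
  assumes "p \<in> plane" "q \<in> plane" "r \<in> plane" "r \<bullet> p = 0" "r \<bullet> q = 0"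
  shows "cr p q = (1 - p \<bullet> q) *\<^sub>R r"
proof -
  define p' where "p' = cr r p"
  define q' where "q' = cr r q"
  have p: "p = cr r p'" and q: "q = cr r q'"
    using cr_plane_orthogonal assms by (simp_all add: p'_def q'_def inner_commute)
  have r: "cr r r = 0" "r \<bullet> e = 1" and pe: "q \<bullet> e = 1" using assms by (auto simp: plane_def)
  have "cr r p' \<bullet> r = 0" "cr r q' \<bullet> r = 0" using r cr_exchange[of r p' r] cr_exchange[of r q' r] by simp_all
  then have "cr p q + cr p q = (cr r p' \<bullet> q') *\<^sub>R r + (cr r p' \<bullet> q') *\<^sub>R r"
    using adjoint_identity[of r r p' q'] r by (simp add: cr_simps p[symmetric] q[symmetric] cr_commute[of q])
  then have *: "cr p q = (cr r p' \<bullet> q') *\<^sub>R r" by (rule double_cancel)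
  have "cr p q \<bullet> e = p \<bullet> e - p \<bullet> q"
    using pe by (simp add: cr_cyclic cr_unit_right inner_diff_right)
  moreover have "cr p q \<bullet> e = cr r p' \<bullet> q'" using * r by simp
  ultimately show ?thesis using * assms(1) by (simp add: plane_def)
qed

lemma plane_inner_eq_1: "\<lbrakk>p \<in> plane; q \<in> plane; p \<bullet> q = 1\<rbrakk> \<Longrightarrow> p = q"
proof -
  assume "p \<in> plane" "q \<in> plane" "p \<bullet> q = 1"
  then have "(p - q) \<bullet> (p - q) = 0"
    using plane_norm by (simp add: inner_diff_left inner_diff_right inner_commute)
  then show ?thesis by simp
qed

text \<open>The cubic form is determined on the plane by the metric: the product of two distinct points
  is a multiple of the unique point orthogonal to both.\<close>

lemma plane_isometry_preserves_cubic:
  assumes g: "\<And>x. x \<in> plane \<Longrightarrow> g x \<in> plane" "\<And>x y. x \<in> plane \<Longrightarrow> y \<in> plane \<Longrightarrow> g x \<bullet> g y = x \<bullet> y"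
    and P: "p \<in> plane" "q \<in> plane" "s \<in> plane"
  shows "cr (g p) (g q) \<bullet> g s = cr p q \<bullet> s"
proof (cases "p = q")
  case True
  then show ?thesis using g(1)[OF P(1)] P(1) by (simp add: plane_def)
next
  case False
  define k where "k = 1 - p \<bullet> q"
  have k: "k \<noteq> 0" using plane_inner_eq_1[OF P(1,2)] False by (auto simp: k_def)
  \<comment> \<open>The point orthogonal to both \<open>p\<close> and \<open>q\<close>. The map
    \<open>g\<close> is only an isometry of the set of points, but it carries \<open>r\<close> to a
    point orthogonal to \<open>g p\<close> and \<open>g q\<close>, which is enough to identify their
    product.\<close>
  define r where "r = (1/k) *\<^sub>R cr p q"
  have pq: "cr p p = 0" "cr q q = 0" "p \<bullet> e = 1" "q \<bullet> e = 1" using P by (auto simp: plane_def)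
  have "cr p q \<bullet> e = k"
    using pq by (simp add: k_def cr_cyclic cr_unit_right inner_diff_right)
  then have r: "r \<in> plane"
    using k cr_null_product[OF pq(2,1)] by (simp add: plane_def r_def cr_simps)
  have o: "r \<bullet> p = 0" "r \<bullet> q = 0"
    using pq cr_exchange[of p q p] by (simp_all add: r_def cr_cyclic)
  have "cr (g p) (g q) = k *\<^sub>R g r"
    using cr_plane_third_point[of "g p" "g q" "g r"] g P r o by (simp add: k_def)
  moreover have "cr p q = k *\<^sub>R r" using k by (simp add: r_def)
  ultimately show ?thesis using g(2)[OF r P(3)] by simp
qed

section \<open>The relation obeyed by squares, and tangent spaces of the plane\<close>

definition redundancy :: "'j \<Rightarrow> 'j \<Rightarrow> 'j" where
  "redundancy x y = (x \<bullet> e) *\<^sub>R ((y \<bullet> e) *\<^sub>R e - y) - cr x y - (y \<bullet> e) *\<^sub>R x - (1/3) *\<^sub>R (y \<bullet> x) *\<^sub>R e"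

text \<open>This is the adjoint identity at \<open>x, x, x, e\<close>, which becomes linear in the
  square once \<open>cr x x\<close> is treated as a separate variable \<open>y\<close>.\<close>

lemma redundancy_square: "redundancy x (cr x x) = 0"
proof -
  define y where "y = cr x x"
  have "3 *\<^sub>R cr y (cr x e) = 3 *\<^sub>R (y \<bullet> e) *\<^sub>R x + (y \<bullet> x) *\<^sub>R e"
    using adjoint_identity[of x x x e] cr_commute[of "cr x e" "cr x x"]
    unfolding scaleR_3 by (simp add: y_def ac_simps)
  then have "3 *\<^sub>R redundancy x y = 0"
    by (simp add: redundancy_def cr_simps cr_unit_right cr_commute[of y x] algebra_simps)
  then show ?thesis by (simp add: y_def)
qed

text \<open>Exactness for a single point: the derivative of \<open>cr x x\<close> at
  \<open>p\<close> is twice \<open>cr p\<close>, and the lemma places the kernel of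
  \<open>redundancy p\<close> in the range of \<open>cr p\<close>.\<close>

lemma redundancy_kernel:
  assumes "p \<in> plane" "redundancy p y = 0"
  shows "cr p (cr p y) = y" "y \<bullet> p = 0"
proof -
  have p: "p \<bullet> e = 1" "cr p p = 0" "p \<bullet> p = 1" using assms(1) plane_norm by (auto simp: plane_def)
  have z: "cr p y \<bullet> p = 0" using p cr_exchange[of p y p] by simp
  have eq: "(y \<bullet> e) *\<^sub>R e - y - cr p y - (y \<bullet> e) *\<^sub>R p - (1/3) *\<^sub>R (y \<bullet> p) *\<^sub>R e = 0"
    using assms(2) p by (simp add: redundancy_def)
  have "((y \<bullet> e) *\<^sub>R e - y - cr p y - (y \<bullet> e) *\<^sub>R p - (1/3) *\<^sub>R (y \<bullet> p) *\<^sub>R e) \<bullet> p = 0"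
    unfolding eq by simp
  then show yp: "y \<bullet> p = 0"
    using z p by (simp add: inner_diff_left inner_commute[of e p])
  have "cr p y = (y \<bullet> e) *\<^sub>R (e - p) - y" using eq yp by (simp add: algebra_simps)
  then show "cr p (cr p y) = y" using cr_plane_square[OF assms(1), of y] yp
    by (simp add: inner_diff_right)
qed

definition tangent :: "'j \<Rightarrow> 'j set" where
  "tangent p = {v. cr p v = 0 \<and> v \<bullet> e = 0}"

lemma subspace_tangent: "subspace (tangent p)"
  by (auto simp: tangent_def subspace_def cr_simps inner_add_left)

lemma tangent_orthogonal:
  assumes "p \<in> plane" "v \<in> tangent p" shows "v \<bullet> p = 0"
proof -
  have "cr p v \<bullet> e = p \<bullet> cr v e" by (rule cr_cyclic)
  then show ?thesis using assms by (simp add: tangent_def cr_unit_right inner_commute)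
qed

text \<open>Since the cube of \<open>cr p\<close> is \<open>cr p\<close>, its square is the
  projection to its range; removing that range and the line of \<open>p\<close> leaves the tangent
  space.\<close>

definition tangent_proj :: "'j \<Rightarrow> 'j \<Rightarrow> 'j" where
  "tangent_proj p x = x - (x \<bullet> p) *\<^sub>R p - cr p (cr p x)"

lemma tangent_proj:
  assumes "p \<in> plane"
  shows "tangent_proj p x \<in> tangent p" "v \<in> tangent p \<Longrightarrow> tangent_proj p v = v"
    "tangent_proj p x \<bullet> y = x \<bullet> tangent_proj p y" "linear (tangent_proj p)"
    "(\<Sum>b\<in>Basis. tangent_proj p b \<bullet> b) = 16"
proof -
  have p: "p \<bullet> e = 1" "cr p p = 0" "p \<bullet> p = 1" using assms plane_norm by (auto simp: plane_def)
  have sym: "cr p a \<bullet> b = a \<bullet> cr p b" for a b by (metis cr_commute cr_cyclic)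
  have "cr p (cr p e) = e - p" using cr_plane_unit[OF assms] p by (simp add: cr_unit_right)
  then have "cr p (cr p x) \<bullet> e = x \<bullet> (e - p)" by (simp add: sym)
  then show "tangent_proj p x \<in> tangent p"
    using p by (simp add: tangent_def tangent_proj_def cr_simps cr_plane_cube[OF assms] inner_diff_left inner_diff_right)
  show "tangent_proj p v = v" if "v \<in> tangent p" for v
    using that tangent_orthogonal[OF assms that] by (simp add: tangent_proj_def tangent_def cr_simps)
  show "tangent_proj p x \<bullet> y = x \<bullet> tangent_proj p y"
    by (simp add: tangent_proj_def inner_diff_left inner_diff_right sym inner_commute[of p y])
  show "linear (tangent_proj p)"
    by (intro linearI) (simp_all add: tangent_proj_def cr_simps inner_add_left algebra_simps)
  \<comment> \<open>The axiom on the sum of squares enters here: the trace is the squared norm 2 of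
    \<open>e - p\<close> plus 8, so the range of \<open>cr p\<close> has dimension 10 and 27 - 1 -
    10 = 16 remain.\<close>
  have "(\<Sum>b\<in>Basis. cr p (cr p b) \<bullet> b) = (\<Sum>b\<in>Basis. (b \<bullet> (e - p)) * (b \<bullet> (e - p)) - cr b b \<bullet> p)"
  proof (intro sum.cong refl)
    fix b
    have "cr p b \<bullet> b = cr b b \<bullet> p" by (metis cr_cyclic inner_commute)
    then show "cr p (cr p b) \<bullet> b = (b \<bullet> (e - p)) * (b \<bullet> (e - p)) - cr b b \<bullet> p"
      by (simp add: cr_plane_square[OF assms] inner_diff_left inner_commute[of b "e - p"])
  qed
  also have "\<dots> = (e - p) \<bullet> (e - p) - (\<Sum>b\<in>Basis. cr b b) \<bullet> p"
    by (simp add: sum_subtractf inner_sum_left inner_sum_right euclidean_inner[of "e - p" "e - p"] inner_commute)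
  also have "\<dots> = 10"
    unfolding sum_cr_Basis using p unit_unit by (simp add: inner_diff_left inner_diff_right inner_commute)
  finally have 1: "(\<Sum>b\<in>Basis. cr p (cr p b) \<bullet> b) = 10" .
  have 2: "(\<Sum>b\<in>Basis. (b \<bullet> p) * (p \<bullet> b)) = 1"
    using euclidean_inner[of p p] p by (simp add: inner_commute)
  have 3: "(\<Sum>b\<in>(Basis::'j set). b \<bullet> b) = 27" using dim27 by simp
  show "(\<Sum>b\<in>Basis. tangent_proj p b \<bullet> b) = 16"
    using 1 2 3 by (simp add: tangent_proj_def inner_diff_left sum_subtractf)
qed


end

section \<open>Dual bases, and tight simplices as bases of the algebra\<close>

definition is_dual :: "('k \<Rightarrow> 'j::euclidean_space) \<Rightarrow> ('k \<Rightarrow> 'j) \<Rightarrow> bool" where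
  "is_dual f g \<longleftrightarrow> (\<forall>i j. f i \<bullet> g j = (if i = j then 1 else 0))"

lemma dual_expand:
  fixes f g :: "'k::finite \<Rightarrow> 'j::euclidean_space"
  assumes "is_dual f g" "CARD('k) = DIM('j)"
  shows "x = (\<Sum>i\<in>UNIV. (x \<bullet> f i) *\<^sub>R g i)"
proof -
  define \<Phi> where "\<Phi> a = (\<Sum>i\<in>UNIV. (a $ i) *\<^sub>R g i)" for a :: "real^'k"
  have lin: "linear \<Phi>" unfolding \<Phi>_def
    by (intro linearI) (simp_all add: scaleR_left_distrib sum.distrib scaleR_sum_right)
  have coord: "\<Phi> a \<bullet> f j = a $ j" for a j
  proof -
    have gf: "g i \<bullet> f j = (if i = j then 1 else 0)" for i
      using assms(1) unfolding is_dual_def by (subst inner_commute) auto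
    show ?thesis by (simp add: \<Phi>_def inner_sum_left gf if_distrib cong: if_cong)
  qed
  have "inj \<Phi>" by (intro injI) (metis coord vec_eq_iff)
  then have "dim (range \<Phi>) = DIM('j)"
    using dim_image_eq[OF lin, of UNIV] assms(2) by (simp add: dim_UNIV)
  then have "range \<Phi> = UNIV"
    using dim_eq_full[of "range \<Phi>"] span_eq_iff[of "range \<Phi>"] linear_subspace_image[OF lin subspace_UNIV] by simp
  then obtain a where a: "x = \<Phi> a" by (metis UNIV_I imageE)
  then show ?thesis using coord[of a] by (simp add: \<Phi>_def)
qed

lemma dual_eqI:
  fixes f g :: "'k::finite \<Rightarrow> 'j::euclidean_space"
  assumes "is_dual f g" "CARD('k) = DIM('j)" "\<And>i. x \<bullet> g i = y \<bullet> g i"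
  shows "x = y"
proof -
  have "(x - y) \<bullet> z = 0" for z
    by (subst dual_expand[OF assms(1,2), of z]) (simp add: inner_sum_right inner_diff_left assms(3))
  from this[of "x - y"] show ?thesis by simp
qed

text \<open>The points are indexed by an arbitrary type with 27 elements, so that the index set can
  later be the translation group itself.\<close>

locale albert_index = albert cr e
  for cr :: "'j::euclidean_space \<Rightarrow> 'j \<Rightarrow> 'j" and e :: 'j +
  fixes idx :: "'k::finite itself"
  assumes card27: "CARD('k) = 27"
begin

lemma card_dim: "CARD('k) = DIM('j)" by (simp add: card27 dim27)

text \<open>The number 4/13 is (N - 3) / (3 (N - 1)) at N = 27.\<close>

definition tight :: "'j ^ 'k \<Rightarrow> bool" where
  "tight q \<longleftrightarrow> (\<forall>i. q $ i \<in> plane) \<and> (\<forall>i j. i \<noteq> j \<longrightarrow> q $ i \<bullet> q $ j = 4/13)"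

lemma tight_gram: "tight q \<Longrightarrow> q $ i \<bullet> q $ j = 4/13 + (if i = j then 9/13 else 0)"
  using plane_norm by (auto simp: tight_def)

text \<open>The equality case of Cauchy-Schwarz: with \<open>s\<close> the sum,
  \<open>s \<bullet> s\<close> is 27 * 9 = 243 and \<open>s \<bullet> e\<close> is 27, while
  \<open>e \<bullet> e\<close> is 3, so \<open>s - 9 *\<^sub>R e\<close> has norm zero.\<close>

lemma tight_sum:
  assumes "tight q" shows "(\<Sum>i\<in>UNIV. q $ i) = 9 *\<^sub>R e"
proof -
  define s where "s = (\<Sum>i\<in>UNIV. q $ i)"
  have "s \<bullet> q $ j = 9" for j
    using card27 by (simp add: s_def inner_sum_left tight_gram[OF assms] sum.distrib)
  then have ss: "s \<bullet> s = 243"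
    by (subst (2) s_def) (simp add: inner_sum_right card27)
  have "s \<bullet> e = 27" using assms by (simp add: s_def inner_sum_left tight_def plane_def card27)
  then have "(s - 9 *\<^sub>R e) \<bullet> (s - 9 *\<^sub>R e) = 0"
    using ss unit_unit by (simp add: inner_diff_left inner_diff_right inner_commute)
  then show ?thesis by (simp add: s_def)
qed

text \<open>The Gram matrix is 9/13 times the identity plus 4/13 times the all-ones matrix. As every
  point pairs to 1 with \<open>e\<close>, subtracting \<open>(4/13) *\<^sub>R e\<close> removes the
  second summand.\<close>

definition tdual :: "'j ^ 'k \<Rightarrow> 'k \<Rightarrow> 'j" where
  "tdual q i = (13/9) *\<^sub>R (q $ i - (4/13) *\<^sub>R e)"

lemma tight_dual: "tight q \<Longrightarrow> is_dual (tdual q) (($) q)"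
  unfolding is_dual_def
  by (simp add: tdual_def inner_diff_left tight_gram inner_commute[of e]) (simp add: tight_def plane_def)

lemmas tight_expand = dual_expand[OF tight_dual card_dim]

definition cubics :: "'j ^ 'k \<Rightarrow> real ^ 'k ^ 'k ^ 'k" where
  "cubics q = (\<chi> i j l. cr (q $ i) (q $ j) \<bullet> q $ l)"

definition cubics' :: "'j ^ 'k \<Rightarrow> 'j ^ 'k \<Rightarrow> real ^ 'k ^ 'k ^ 'k" where
  "cubics' q v = (\<chi> i j l. cr (v $ i) (q $ j) \<bullet> q $ l + cr (q $ i) (v $ j) \<bullet> q $ l + cr (q $ i) (q $ j) \<bullet> v $ l)"

text \<open>The diagonal of the last component is set to zero, since norm 1 already follows from the
  first two components.\<close>

definition constr :: "'j ^ 'k \<Rightarrow> ('j ^ 'k) \<times> (real ^ 'k) \<times> (real ^ 'k ^ 'k)" where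
  "constr q = (\<chi> i. cr (q $ i) (q $ i), \<chi> i. q $ i \<bullet> e - 1,
     \<chi> i j. if i = j then 0 else q $ i \<bullet> q $ j - 4/13)"

definition constr' :: "'j ^ 'k \<Rightarrow> 'j ^ 'k \<Rightarrow> ('j ^ 'k) \<times> (real ^ 'k) \<times> (real ^ 'k ^ 'k)" where
  "constr' q v = (\<chi> i. cr (q $ i) (v $ i) + cr (v $ i) (q $ i), \<chi> i. v $ i \<bullet> e,
     \<chi> i j. if i = j then 0 else q $ i \<bullet> v $ j + v $ i \<bullet> q $ j)"

lemma constr_eq_0: "constr q = 0 \<longleftrightarrow> tight q"
  by (auto simp: constr_def tight_def plane_def zero_prod_def vec_eq_iff)

lemma constr'_eq_0:
  assumes "tight q"
  shows "constr' q v = 0 \<longleftrightarrow> (\<forall>i. v $ i \<in> tangent (q $ i)) \<and> (\<forall>i j. q $ i \<bullet> v $ j + v $ i \<bullet> q $ j = 0)"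
    (is "?l \<longleftrightarrow> ?r")
proof
  assume l: ?l
  have t: "v $ i \<in> tangent (q $ i)" for i
  proof -
    have "cr (q $ i) (v $ i) + cr (q $ i) (v $ i) = 0 + 0" "v $ i \<bullet> e = 0"
      using l by (auto simp: constr'_def zero_prod_def vec_eq_iff cr_commute[of "v $ _"])
    then show ?thesis using double_cancel[of "cr (q $ i) (v $ i)" 0] by (simp add: tangent_def)
  qed
  moreover have "q $ i \<bullet> v $ j + v $ i \<bullet> q $ j = 0" for i j
  proof (cases "i = j")
    case True
    then show ?thesis using tangent_orthogonal[OF _ t[of i]] assms by (simp add: tight_def inner_commute)
  next
    case False
    have "\<forall>i j. (if i = j then 0 else q $ i \<bullet> v $ j + v $ i \<bullet> q $ j) = 0"
      using l by (simp add: constr'_def zero_prod_def vec_eq_iff)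
    with False show ?thesis by metis
  qed
  ultimately show ?r by blast
next
  assume ?r
  then show ?l
    by (auto simp: constr'_def zero_prod_def vec_eq_iff tangent_def cr_commute[of "v $ _"])
qed

definition infinitesimal :: "'j ^ 'k \<Rightarrow> ('j ^ 'k) set" where
  "infinitesimal q = {v. constr' q v = 0}"

definition trivial_inf :: "'j ^ 'k \<Rightarrow> ('j ^ 'k) set" where
  "trivial_inf q = {v. constr' q v = 0 \<and> cubics' q v = 0}"

text \<open>As a tight simplex is a basis, a family of velocities amounts to a linear operator;
  conditions on the velocities become skew-symmetry and the derivation rule.\<close>

definition extend :: "'j ^ 'k \<Rightarrow> 'j ^ 'k \<Rightarrow> 'j \<Rightarrow> 'j" where
  "extend q v x = (\<Sum>i\<in>UNIV. (x \<bullet> tdual q i) *\<^sub>R v $ i)"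

lemma extend_linear: "linear (extend q v)"
  unfolding extend_def
  by (intro linearI) (simp_all add: inner_add_left scaleR_left_distrib sum.distrib scaleR_sum_right)

lemma extend_at: "tight q \<Longrightarrow> extend q v (q $ j) = v $ j"
  using tight_dual[of q]
  by (simp add: extend_def is_dual_def inner_commute[of "q $ j"] if_distrib[of "\<lambda>x. x *\<^sub>R _"] cong: if_cong)

lemma linear_eq_on_tight:
  fixes f g :: "'j \<Rightarrow> 'b::real_vector"
  assumes "tight q" "linear f" "linear g" "\<And>i. f (q $ i) = g (q $ i)"
  shows "f x = g x"
  by (subst (1 2) tight_expand[OF assms(1), of x])
    (simp add: linear_sum[OF assms(2)] linear_sum[OF assms(3)] linear_scale[OF assms(2)] linear_scale[OF assms(3)] assms(4))

definition skew_derivation :: "('j \<Rightarrow> 'j) \<Rightarrow> bool" where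
  "skew_derivation X \<longleftrightarrow> linear X \<and> (\<forall>x y. X x \<bullet> y + x \<bullet> X y = 0) \<and>
     (\<forall>x y z. cr (X x) y \<bullet> z + cr x (X y) \<bullet> z + cr x y \<bullet> X z = 0)"

lemma skew_on_tight:
  assumes q: "tight q" and X: "linear X" and "\<And>i j. q $ i \<bullet> X (q $ j) + X (q $ i) \<bullet> q $ j = 0"
  shows "X x \<bullet> y + x \<bullet> X y = 0"
proof -
  have lin: "linear (\<lambda>y. X x \<bullet> y + x \<bullet> X y)" "linear (\<lambda>x. X x \<bullet> y + x \<bullet> X y)" for x y
    by (auto intro!: linearI simp: linear_add[OF X] linear_scale[OF X] inner_add_left inner_add_right algebra_simps)
  have l0: "linear (\<lambda>_::'j. 0::real)" by (simp add: linear_iff)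
  have "X (q $ i) \<bullet> y + q $ i \<bullet> X y = 0" for i
    using linear_eq_on_tight[OF q lin(1) l0, of "q $ i" y] assms(3) by (simp add: add.commute)
  then show ?thesis using linear_eq_on_tight[OF q lin(2) l0, of y x] by simp
qed

lemma derivation_on_tight:
  assumes q: "tight q" and X: "linear X"
    and "\<And>i j l. cr (X (q $ i)) (q $ j) \<bullet> q $ l + cr (q $ i) (X (q $ j)) \<bullet> q $ l + cr (q $ i) (q $ j) \<bullet> X (q $ l) = 0"
  shows "cr (X x) y \<bullet> z + cr x (X y) \<bullet> z + cr x y \<bullet> X z = 0"
proof -
  let ?D = "\<lambda>x y z. cr (X x) y \<bullet> z + cr x (X y) \<bullet> z + cr x y \<bullet> X z"
  have lin: "linear (?D x y)" "linear (\<lambda>y. ?D x y z)" "linear (\<lambda>x. ?D x y z)" for x y z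
    by (auto intro!: linearI simp: linear_add[OF X] linear_scale[OF X] cr_simps inner_add_left inner_add_right algebra_simps)
  have l0: "linear (\<lambda>_::'j. 0::real)" by (simp add: linear_iff)
  have "?D (q $ i) (q $ j) z = 0" for i j
    using linear_eq_on_tight[OF q lin(1) l0] assms(3) by blast
  then have "?D (q $ i) y z = 0" for i using linear_eq_on_tight[OF q lin(2) l0] by blast
  then show ?thesis using linear_eq_on_tight[OF q lin(3) l0] by blast
qed

lemma trivial_inf_extend:
  assumes q: "tight q" and v: "v \<in> trivial_inf q"
  shows "skew_derivation (extend q v)"
proof -
  have l: "linear (extend q v)" by (rule extend_linear)
  have "extend q v x \<bullet> y + x \<bullet> extend q v y = 0" for x y
    by (rule skew_on_tight[OF q l]) (use v constr'_eq_0[OF q] in \<open>simp add: trivial_inf_def extend_at[OF q]\<close>)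
  moreover have "cr (extend q v x) y \<bullet> z + cr x (extend q v y) \<bullet> z + cr x y \<bullet> extend q v z = 0" for x y z
    by (rule derivation_on_tight[OF q l])
      (use v in \<open>simp add: trivial_inf_def extend_at[OF q] cubics'_def vec_eq_iff\<close>)
  ultimately show ?thesis using l by (simp add: skew_derivation_def)
qed

text \<open>Differentiating \<open>cr p p = 0\<close> along a derivation gives the first tangency
  condition; pairing the result with \<open>e\<close> and using skew-symmetry gives trace
  zero.\<close>

lemma skew_derivation_trivial_inf:
  assumes q: "tight q" and X: "skew_derivation X"
  shows "(\<chi> i. X (q $ i)) \<in> trivial_inf q"
proof -
  have sk: "X x \<bullet> y + x \<bullet> X y = 0" and der: "cr (X x) y \<bullet> z + cr x (X y) \<bullet> z + cr x y \<bullet> X z = 0" for x y z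
    using X by (auto simp: skew_derivation_def)
  have "X (q $ i) \<in> tangent (q $ i)" for i
  proof -
    have p: "q $ i \<in> plane" "cr (q $ i) (q $ i) = 0" using q by (auto simp: tight_def plane_def)
    have "cr (q $ i) (X (q $ i)) \<bullet> z = 0" for z
      using der[of "q $ i" "q $ i" z] p by (simp add: cr_commute[of "X (q $ i)"])
    from this[of "cr (q $ i) (X (q $ i))"] have "cr (q $ i) (X (q $ i)) = 0" by simp
    moreover have "cr (q $ i) (X (q $ i)) \<bullet> e = X (q $ i) \<bullet> e - X (q $ i) \<bullet> q $ i"
      using p(1) by (subst cr_commute, subst cr_cyclic) (simp add: cr_unit_right plane_def inner_diff_right)
    moreover have "X (q $ i) \<bullet> q $ i = 0" using sk[of "q $ i" "q $ i"] by (simp add: inner_commute)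
    ultimately show ?thesis by (simp add: tangent_def)
  qed
  then show ?thesis
    using sk der by (simp add: trivial_inf_def constr'_eq_0[OF q] cubics'_def vec_eq_iff add.commute)
qed

lemma linear_constr': "linear (constr' q)"
  by (intro linearI) (auto simp: constr'_def vec_eq_iff cr_simps inner_add_left inner_add_right algebra_simps)

lemma linear_cubics': "linear (cubics' q)"
  by (intro linearI) (auto simp: cubics'_def vec_eq_iff cr_simps inner_add_left inner_add_right algebra_simps)

lemma subspace_infinitesimal: "subspace (infinitesimal q)"
  unfolding infinitesimal_def by (rule linear_subspace_kernel[OF linear_constr'])

text \<open>Both spaces are the algebra of skew derivations, evaluated on two different bases. This
  makes the rank of \<open>cubics\<close> constant on the set of tight simplices.\<close>

lemma dim_trivial_inf_le:
  assumes p: "tight p" and q: "tight q"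
  shows "dim (trivial_inf p) \<le> dim (trivial_inf q)"
proof -
  define L where "L v = (\<chi> i. extend p v (q $ i))" for v
  have lin: "linear L" unfolding L_def extend_def
    by (intro linearI) (simp_all add: vec_eq_iff scaleR_add_right sum.distrib scaleR_sum_right mult.commute)
  have "inj L"
    unfolding linear_injective_0[OF lin]
  proof (intro allI impI)
    fix v assume "L v = 0"
    then have "extend p v (q $ i) = 0" for i by (simp add: L_def vec_eq_iff)
    then have "extend p v x = 0" for x
      using linear_eq_on_tight[OF q extend_linear, of "\<lambda>_. 0"] by (simp add: linear_iff)
    then have "v $ i = 0" for i using extend_at[OF p, of v i] by simp
    then show "v = 0" by (simp add: vec_eq_iff)
  qed
  then have "dim (L ` trivial_inf p) = dim (trivial_inf p)"
    using dim_image_eq[OF lin] by (metis inj_on_subset subset_UNIV)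
  moreover have "L ` trivial_inf p \<subseteq> trivial_inf q"
    unfolding L_def using skew_derivation_trivial_inf[OF q trivial_inf_extend[OF p]] by auto
  ultimately show ?thesis by (metis dim_subset)
qed

lemma dim_trivial_inf_eq: "tight p \<Longrightarrow> tight q \<Longrightarrow> dim (trivial_inf p) = dim (trivial_inf q)"
  by (simp add: dim_trivial_inf_le order_antisym)

text \<open>The linear map matching the two bases preserves inner products by tightness and triple
  products by assumption. It fixes \<open>e\<close>, which is one ninth of the sum of the points of
  either simplex; so it is an automorphism and preserves the plane.\<close>

lemma same_cubics_automorphism:
  assumes q: "tight q" and r: "tight r" and eq: "cubics q = cubics r"
  obtains L where "linear L" "\<And>i. L (q $ i) = r $ i" "\<And>x y. L x \<bullet> L y = x \<bullet> y"
    "\<And>x. L x \<in> plane \<longleftrightarrow> x \<in> plane" "bij L"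
proof -
  define L where "L = extend q r"
  define M where "M = extend r q"
  have lin: "linear L" "linear M" by (simp_all add: L_def M_def extend_linear)
  have ats: "L (q $ i) = r $ i" "M (r $ i) = q $ i" for i
    using extend_at[OF q] extend_at[OF r] by (simp_all add: L_def M_def)
  have MoL: "M (L x) = x" for x
    using linear_eq_on_tight[OF q linear_compose[OF lin] linear_id, of x] ats by (simp add: o_def)
  have LoM: "L (M x) = x" for x
    using linear_eq_on_tight[OF r linear_compose[OF lin(2,1)] linear_id, of x] ats by (simp add: o_def)
  have bij: "bij L" using MoL LoM by (metis bijI')
  have inn: "L x \<bullet> L y = x \<bullet> y" for x y
  proof -
    have l: "linear (\<lambda>y. L x \<bullet> L y)" "linear (\<lambda>y. x \<bullet> y)" "linear (\<lambda>x. L x \<bullet> L y)" "linear (\<lambda>x. x \<bullet> y)" for x y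
      by (auto intro!: linearI simp: linear_add[OF lin(1)] linear_scale[OF lin(1)] inner_add_left inner_add_right)
    have "L (q $ i) \<bullet> L y = q $ i \<bullet> y" for i
      by (rule linear_eq_on_tight[OF q l(1)[of "q $ i"] l(2)[of "q $ i"]]) (simp add: ats tight_gram[OF q] tight_gram[OF r])
    then show ?thesis using linear_eq_on_tight[OF q l(3,4)] by blast
  qed
  have cub: "cr (L x) (L y) \<bullet> L z = cr x y \<bullet> z" for x y z
  proof -
    have l: "linear (\<lambda>z. cr (L x) (L y) \<bullet> L z)" "linear (\<lambda>z. cr x y \<bullet> z)"
      "linear (\<lambda>y. cr (L x) (L y) \<bullet> L z)" "linear (\<lambda>y. cr x y \<bullet> z)"
      "linear (\<lambda>x. cr (L x) (L y) \<bullet> L z)" "linear (\<lambda>x. cr x y \<bullet> z)" for x y z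
      by (auto intro!: linearI simp: linear_add[OF lin(1)] linear_scale[OF lin(1)] inner_add_left inner_add_right cr_simps)
    have "cr (L (q $ i)) (L (q $ j)) \<bullet> L z = cr (q $ i) (q $ j) \<bullet> z" for i j z
      by (rule linear_eq_on_tight[OF q l(1)[of "q $ i" "q $ j"] l(2)[of "q $ i" "q $ j"]])
        (use eq in \<open>simp add: cubics_def vec_eq_iff ats\<close>)
    then have "cr (L (q $ i)) (L y) \<bullet> L z = cr (q $ i) y \<bullet> z" for i y z
      using linear_eq_on_tight[OF q l(3,4)] by blast
    then show ?thesis using linear_eq_on_tight[OF q l(5,6)] by blast
  qed
  have "L (\<Sum>i\<in>UNIV. q $ i) = (\<Sum>i\<in>UNIV. r $ i)"
    by (simp add: linear_sum[OF lin(1)] ats)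
  then have "L (9 *\<^sub>R e) = 9 *\<^sub>R e" by (simp add: tight_sum[OF r] tight_sum[OF q])
  then have Le: "L e = e" by (simp add: linear_scale[OF lin(1)])
  have "cr (L x) (L y) = L (cr x y)" for x y
  proof -
    have "(cr (L x) (L y) - L (cr x y)) \<bullet> L z = 0" for z
      using cub[of x y z] inn[of "cr x y" z] by (simp add: inner_diff_left)
    from this[of "M (cr (L x) (L y) - L (cr x y))"] show ?thesis by (simp add: LoM)
  qed
  moreover have "L x = 0 \<longleftrightarrow> x = 0" for x using MoL by (metis linear_0[OF lin(1)])
  moreover have "L x \<bullet> e = x \<bullet> e" for x using inn[of x e] Le by simp
  ultimately have "L x \<in> plane \<longleftrightarrow> x \<in> plane" for x by (simp add: plane_def)
  then show thesis using that lin(1) ats(1) inn bij by blast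
qed

end

lemma sum_Basis_vec:
  fixes f :: "'a::euclidean_space ^ 'k \<Rightarrow> real"
  shows "(\<Sum>b\<in>Basis. f b) = (\<Sum>i\<in>UNIV. \<Sum>u\<in>Basis. f (axis i u))"
proof -
  have "bij_betw (\<lambda>(i, u). axis i u) (UNIV \<times> Basis) (Basis :: ('a^'k) set)"
    unfolding bij_betw_def Basis_vec_def
    by (auto simp: inj_on_def axis_eq_axis dest: nonzero_Basis)
  from sum.reindex_bij_betw[OF this, of f]
  have "(\<Sum>b\<in>Basis. f b) = (\<Sum>(i,u)\<in>UNIV \<times> Basis. f (axis i u))"
    by (simp add: case_prod_unfold)
  then show ?thesis by (simp add: sum.cartesian_product)
qed

lemma has_derivative_vec_lambda:
  fixes f :: "'x::real_normed_vector \<Rightarrow> 'k::finite \<Rightarrow> 'z::euclidean_space"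
  assumes "\<And>i. ((\<lambda>q. f q i) has_derivative (\<lambda>v. f' v i)) F"
  shows "((\<lambda>q. \<chi> i. f q i) has_derivative (\<lambda>v. \<chi> i. f' v i)) F"
proof -
  have e: "(\<chi> i. g i) = (\<Sum>i\<in>UNIV. axis i (g i))" for g :: "'k \<Rightarrow> 'z"
    by (simp add: vec_eq_iff axis_def if_distrib cong: if_cong)
  have "bounded_linear (axis i :: 'z \<Rightarrow> 'z^'k)" for i
    by (simp add: linear_conv_bounded_linear[symmetric] linear_iff vec_eq_iff axis_def)
  then show ?thesis unfolding e
    by (intro has_derivative_sum bounded_linear.has_derivative[OF _ assms]) auto
qed

lemma continuous_on_det:
  fixes F :: "'x::topological_space \<Rightarrow> real ^ 'k ^ 'k"
  assumes "\<And>i j. continuous_on S (\<lambda>x. F x $ i $ j)"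
  shows "continuous_on S (\<lambda>x. det (F x))"
  unfolding det_def by (intro continuous_intros assms)

context albert_index
begin

section \<open>Counting infinitesimal deformations\<close>

definition hollow :: "(real ^ 'k ^ 'k) set" where
  "hollow = {E. \<forall>i j. E $ i $ j = E $ j $ i \<and> E $ i $ i = 0}"

lemma subspace_hollow: "subspace hollow"
  by (auto simp: subspace_def hollow_def)

lemma dim_hollow: "dim hollow = 351"
proof -
  define H :: "real^'k^'k \<Rightarrow> real^'k^'k" where "H E = (\<chi> i j. if i = j then 0 else (E $ i $ j + E $ j $ i) / 2)" for E
  have lin: "linear H" unfolding H_def by (intro linearI) (auto simp: vec_eq_iff algebra_simps add_divide_distrib)
  have "H E \<in> hollow" for E by (simp add: H_def hollow_def add.commute)
  moreover have fix_h: "H E = E" if "E \<in> hollow" for E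
  proof -
    have "E $ i $ i = 0" "E $ j $ i = E $ i $ j" for i j using that unfolding hollow_def by blast+
    then show ?thesis by (simp add: H_def vec_eq_iff)
  qed
  ultimately have ran: "range H = hollow" by (metis (no_types, lifting) image_subset_iff rangeI subsetI subset_antisym)
  have idem: "H (H E) = H E" for E using fix_h ran by auto
  have sym: "H E \<bullet> F = E \<bullet> H F" for E F
  proof -
    have "(\<Sum>i\<in>UNIV. \<Sum>j\<in>UNIV. (if i = j then 0 else (E $ j $ i) / 2) * F $ i $ j) =
      (\<Sum>i\<in>UNIV. \<Sum>j\<in>UNIV. (if i = j then 0 else (E $ i $ j) / 2) * F $ j $ i)"
      by (subst sum.swap) (auto intro!: sum.cong)
    moreover have "H E \<bullet> F = (\<Sum>i\<in>UNIV. \<Sum>j\<in>UNIV. (if i = j then 0 else (E $ i $ j) / 2) * F $ i $ j) +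
       (\<Sum>i\<in>UNIV. \<Sum>j\<in>UNIV. (if i = j then 0 else (E $ j $ i) / 2) * F $ i $ j)"
      unfolding inner_vec_def H_def
      by (simp add: sum.distrib[symmetric]) (intro sum.cong refl, auto simp: algebra_simps add_divide_distrib)
    moreover have "E \<bullet> H F = (\<Sum>i\<in>UNIV. \<Sum>j\<in>UNIV. (if i = j then 0 else (E $ i $ j) / 2) * F $ i $ j) +
       (\<Sum>i\<in>UNIV. \<Sum>j\<in>UNIV. (if i = j then 0 else (E $ i $ j) / 2) * F $ j $ i)"
      unfolding inner_vec_def H_def
      by (simp add: sum.distrib[symmetric]) (intro sum.cong refl, auto simp: algebra_simps add_divide_distrib)
    ultimately show ?thesis by simp
  qed
  have b1: "(\<Sum>u\<in>Basis. f u) = f 1" for f :: "real \<Rightarrow> real" by simp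
  have "real (dim (range H)) = (\<Sum>b\<in>Basis. H b \<bullet> b)"
    by (rule dim_range_idempotent[OF lin idem sym])
  also have "\<dots> = (\<Sum>i\<in>(UNIV::'k set). \<Sum>j\<in>UNIV. if i = j then 0 else 1/2)"
    unfolding sum_Basis_vec b1 by (intro sum.cong refl) (simp add: inner_axis H_def, simp add: axis_def)
  also have "\<dots> = (\<Sum>i\<in>(UNIV::'k set). real (card (UNIV - {i})) / 2)"
  proof (rule sum.cong[OF refl])
    fix i :: 'k
    have "(\<Sum>j\<in>UNIV. if i = j then 0 else 1/2 :: real) = (\<Sum>j\<in>UNIV - {i}. 1/2)"
      by (rule sum.mono_neutral_cong_right) auto
    then show "(\<Sum>j\<in>UNIV. if i = j then 0 else 1/2 :: real) = real (card (UNIV - {i})) / 2" by simp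
  qed
  also have "\<dots> = 351" by (simp add: card27)
  finally show ?thesis by (simp add: ran)
qed

definition tangents :: "'j ^ 'k \<Rightarrow> ('j ^ 'k) set" where
  "tangents p = {v. \<forall>i. v $ i \<in> tangent (p $ i)}"

lemma subspace_tangents: "subspace (tangents p)"
  using subspace_tangent by (auto simp: subspace_def tangents_def)

lemma dim_tangents:
  assumes "tight p" shows "dim (tangents p) = 432"
proof -
  define H where "H v = (\<chi> i. tangent_proj (p $ i) (v $ i))" for v
  have pl: "p $ i \<in> plane" for i using assms by (simp add: tight_def)
  note T = tangent_proj[OF pl]
  have lin: "linear H" unfolding H_def
    by (intro linearI) (simp_all add: vec_eq_iff linear_add[OF T(4)] linear_scale[OF T(4)])
  have ran: "range H = tangents p"
  proof
    show "range H \<subseteq> tangents p" using T(1) by (auto simp: H_def tangents_def)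
    show "tangents p \<subseteq> range H"
    proof
      fix v assume "v \<in> tangents p"
      then have "H v = v" using T(2) by (simp add: H_def tangents_def vec_eq_iff)
      then show "v \<in> range H" by (metis rangeI)
    qed
  qed
  have idem: "H (H v) = H v" for v using T(1,2) by (simp add: H_def vec_eq_iff)
  have sym: "H v \<bullet> w = v \<bullet> H w" for v w by (simp add: inner_vec_def H_def T(3))
  have "real (dim (range H)) = (\<Sum>b\<in>Basis. H b \<bullet> b)"
    by (rule dim_range_idempotent[OF lin idem sym])
  also have "\<dots> = (\<Sum>i\<in>UNIV. \<Sum>b\<in>Basis. tangent_proj (p $ i) b \<bullet> b)"
    unfolding sum_Basis_vec by (intro sum.cong refl) (simp add: inner_axis H_def)
  also have "\<dots> = 432" by (simp add: T(5) card27)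
  finally show ?thesis by (simp add: ran)
qed

definition gram' :: "'j ^ 'k \<Rightarrow> 'j ^ 'k \<Rightarrow> real ^ 'k ^ 'k" where
  "gram' p v = (\<chi> i j. p $ i \<bullet> v $ j + v $ i \<bullet> p $ j)"

lemma linear_gram': "linear (gram' p)"
  unfolding gram'_def by (intro linearI) (simp_all add: vec_eq_iff inner_add_left inner_add_right algebra_simps)

definition contract :: "'j ^ 'k \<Rightarrow> real ^ 'k ^ 'k \<Rightarrow> 'j" where
  "contract p E = (\<Sum>i\<in>UNIV. \<Sum>j\<in>UNIV. (E $ i $ j) *\<^sub>R cr (p $ i) (p $ j))"

lemma linear_contract: "linear (contract p)"
  unfolding contract_def
  by (intro linearI) (simp_all add: scaleR_left_distrib sum.distrib scaleR_sum_right)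

lemma infinitesimal_eq: "tight p \<Longrightarrow> infinitesimal p = {v\<in>tangents p. gram' p v = 0}"
  by (auto simp: infinitesimal_def constr'_eq_0 tangents_def gram'_def vec_eq_iff)

text \<open>The expansion in the dual basis, solved for the frame operator: on the complement of
  \<open>e\<close> it is the multiple 9/13 of the identity.\<close>

lemma tight_frame:
  assumes "tight p"
  shows "(\<Sum>i\<in>UNIV. (x \<bullet> p $ i) *\<^sub>R p $ i) = (9/13) *\<^sub>R (x + (4 * (x \<bullet> e)) *\<^sub>R e)"
proof -
  define S where "S = (\<Sum>i\<in>UNIV. (x \<bullet> p $ i) *\<^sub>R p $ i)"
  have "x = (\<Sum>i\<in>UNIV. (13/9) *\<^sub>R (x \<bullet> p $ i) *\<^sub>R p $ i - (4/9 * (x \<bullet> e)) *\<^sub>R p $ i)"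
    by (subst tight_expand[OF assms, of x], intro sum.cong refl)
      (simp add: tdual_def inner_diff_right scaleR_diff_left algebra_simps)
  also have "\<dots> = (13/9) *\<^sub>R S - (4/9 * (x \<bullet> e)) *\<^sub>R (\<Sum>i\<in>UNIV. p $ i)"
    by (simp only: sum_subtractf scaleR_sum_right S_def)
  finally have "(13/9) *\<^sub>R S = x + (4 * (x \<bullet> e)) *\<^sub>R e"
    unfolding tight_sum[OF assms] by (simp add: algebra_simps)
  moreover have "S = (9/13) *\<^sub>R ((13/9) *\<^sub>R S)" by simp
  ultimately show ?thesis unfolding S_def by simp
qed

text \<open>These are 27 linear relations among first-order changes of the Gram matrix. By the frame
  identity the inner sum reassembles a multiple of \<open>v $ j\<close>, whose product with
  \<open>p $ j\<close> vanishes for a tangent vector.\<close>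

lemma gram'_contract:
  assumes "tight p" "v \<in> tangents p"
  shows "contract p (gram' p v) = 0"
proof -
  have t: "cr (p $ j) (v $ j) = 0" "v $ j \<bullet> e = 0" for j using assms(2) by (auto simp: tangents_def tangent_def)
  have "(\<Sum>i\<in>UNIV. (v $ j \<bullet> p $ i) *\<^sub>R cr (p $ i) (p $ j)) = 0" for j
  proof -
    have "(\<Sum>i\<in>UNIV. (v $ j \<bullet> p $ i) *\<^sub>R cr (p $ i) (p $ j)) = cr (\<Sum>i\<in>UNIV. (v $ j \<bullet> p $ i) *\<^sub>R p $ i) (p $ j)"
      by (simp add: cr.sum_left cr_simps)
    also have "\<dots> = 0" using t by (simp add: tight_frame[OF assms(1)] cr_simps cr_commute[of "v $ j"])
    finally show ?thesis .
  qed
  then have "(\<Sum>j\<in>UNIV. \<Sum>i\<in>UNIV. (v $ j \<bullet> p $ i) *\<^sub>R cr (p $ i) (p $ j)) = 0" by simp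
  moreover have "(\<Sum>j\<in>UNIV. \<Sum>i\<in>UNIV. (v $ j \<bullet> p $ i) *\<^sub>R cr (p $ i) (p $ j)) =
     (\<Sum>i\<in>UNIV. \<Sum>j\<in>UNIV. (p $ i \<bullet> v $ j) *\<^sub>R cr (p $ i) (p $ j))"
    by (subst sum.swap) (simp add: inner_commute)
  moreover have "(\<Sum>j\<in>UNIV. \<Sum>i\<in>UNIV. (v $ j \<bullet> p $ i) *\<^sub>R cr (p $ i) (p $ j)) =
     (\<Sum>i\<in>UNIV. \<Sum>j\<in>UNIV. (v $ i \<bullet> p $ j) *\<^sub>R cr (p $ i) (p $ j))"
    by (simp add: cr_commute)
  ultimately show ?thesis by (simp add: contract_def gram'_def scaleR_left_distrib sum.distrib)
qed

lemma gram'_hollow: "tight p \<Longrightarrow> v \<in> tangents p \<Longrightarrow> gram' p v \<in> hollow"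
  using tangent_orthogonal by (fastforce simp: hollow_def gram'_def tangents_def tight_def inner_commute)

text \<open>The 27 relations are independent: a vector \<open>A\<close> orthogonal to all products
  of points satisfies \<open>cr (p $ i) A = 0\<close> for every \<open>i\<close>, hence
  \<open>cr e A = 0\<close> by summation, and \<open>cr e\<close> is injective.\<close>

lemma contract_surj:
  assumes "tight p" shows "contract p ` hollow = UNIV"
proof -
  have sub: "subspace (contract p ` hollow)" by (rule linear_subspace_image[OF linear_contract subspace_hollow])
  have "A = 0" if A: "\<And>x. x \<in> contract p ` hollow \<Longrightarrow> orthogonal x A" for A
  proof -
    have pp: "cr (p $ i) (p $ i) = 0" for i using assms by (simp add: tight_def plane_def)
    have "cr (p $ i) (p $ j) \<bullet> A = 0" for i j
    proof (cases "i = j")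
      case True then show ?thesis by (simp add: pp)
    next
      case False
      define E :: "real^'k^'k" where "E = axis i (axis j 1) + axis j (axis i 1)"
      have "E \<in> hollow" using False by (auto simp: E_def hollow_def axis_def)
      then have "contract p E \<bullet> A = 0" using A by (simp add: orthogonal_def)
      moreover have "contract p E = cr (p $ i) (p $ j) + cr (p $ j) (p $ i)"
      proof -
        have ax: "contract p (axis i (axis j 1)) = cr (p $ i) (p $ j)" for i j
          by (simp add: contract_def axis_def if_distrib[of "\<lambda>x. x $ _"] if_distrib[of "\<lambda>x. x *\<^sub>R _"] cong: if_cong)
            (simp add: if_distrib[of "\<lambda>x. sum x _"] sum.If_cases)?
        show ?thesis by (simp add: E_def linear_add[OF linear_contract] ax)
      qed
      ultimately show ?thesis by (simp add: cr_commute[of "p $ j"] inner_add_left)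
    qed
    then have "cr (p $ i) A \<bullet> p $ j = 0" for i j using cr_exchange[of "p $ i" A "p $ j"] by simp
    then have "cr (p $ i) A = 0" for i
      using dual_eqI[OF tight_dual[OF assms] card_dim, of "cr (p $ i) A" 0] by simp
    then have "cr (\<Sum>i\<in>UNIV. p $ i) A = 0" by (simp add: cr.sum_left)
    then have "cr e A = 0" by (simp add: tight_sum[OF assms] cr_simps)
    then have *: "A = (A \<bullet> e) *\<^sub>R e" by (simp add: cr_unit)
    then have "A \<bullet> e = (A \<bullet> e) * 3" by (metis inner_scaleR_left unit_unit)
    then show "A = 0" using * by simp
  qed
  then have "dim (contract p ` hollow) = DIM('j)"
    using dim_subspace_orthogonal_to_vectors[OF sub subspace_UNIV] 
    by (metis (mono_tags, lifting) add.left_neutral dim_UNIV dim_eq_0 mem_Collect_eq singletonI subsetI subset_UNIV)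
  then show ?thesis using dim_eq_full[of "contract p ` hollow"] span_eq_iff sub by metis
qed

text \<open>The derivative of the Gram matrix lands in the kernel of \<open>contract\<close>, of
  dimension 351 - 27 = 324, so at least 432 - 324 = 108 infinitesimal deformations exist. The
  assumed upper bound forces equality and with it surjectivity onto that kernel.\<close>

lemma infinitesimal_complete:
  assumes "tight p" "dim (infinitesimal p) \<le> 108"
  shows "dim (infinitesimal p) = 108"
    "\<lbrakk>E \<in> hollow; contract p E = 0\<rbrakk> \<Longrightarrow> \<exists>w\<in>tangents p. gram' p w = E"
proof -
  let ?V = "{E\<in>hollow. contract p E = 0}"
  have d1: "dim ?V = 324"
    using dim_kernel_plus_dim_image[OF linear_contract subspace_hollow, of p] contract_surj[OF assms(1)]
    by (simp add: dim_hollow dim_UNIV dim27)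
  have d2: "dim (infinitesimal p) + dim (gram' p ` tangents p) = 432"
    using dim_kernel_plus_dim_image[OF linear_gram' subspace_tangents, of p p]
    by (simp add: infinitesimal_eq[OF assms(1)] dim_tangents[OF assms(1)])
  have sub: "gram' p ` tangents p \<subseteq> ?V"
    using gram'_contract[OF assms(1)] gram'_hollow[OF assms(1)] by auto
  have sV: "subspace ?V"
    using subspace_inter[OF subspace_hollow linear_subspace_kernel[OF linear_contract, of p]]
    by (simp add: Int_def)
  have eq: "gram' p ` tangents p = ?V"
    by (rule subspace_dim_equal[OF linear_subspace_image[OF linear_gram' subspace_tangents] sV sub])
      (use d1 d2 assms(2) in simp)
  then show "dim (infinitesimal p) = 108" using d1 d2 by simp
  show "\<exists>w\<in>tangents p. gram' p w = E" if "E \<in> hollow" "contract p E = 0"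
    using eq that by (metis (mono_tags, lifting) image_iff mem_Collect_eq)
qed


section \<open>Relations between the equations near a tight simplex\<close>

definition gram :: "'j ^ 'k \<Rightarrow> real ^ 'k ^ 'k" where
  "gram q = (\<chi> i j. q $ i \<bullet> q $ j)"

text \<open>Cramer's rule, which is visibly continuous in \<open>q\<close>; the closed form
  \<open>tdual\<close> gives the dual basis at tight simplices, while the relations are required in
  a neighbourhood.\<close>

definition dual :: "'j ^ 'k \<Rightarrow> 'k \<Rightarrow> 'j" where
  "dual q i = (\<Sum>k\<in>UNIV. (det (\<chi> a b. if b = k then axis i 1 $ a else gram q $ a $ b) / det (gram q)) *\<^sub>R q $ k)"

lemma is_dual_dual:
  assumes "det (gram q) \<noteq> 0"
  shows "is_dual (dual q) (($) q)"
proof -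
  have "dual q i \<bullet> q $ j = (if i = j then 1 else 0)" for i j
  proof -
    define x where "x = (\<chi> k. det (\<chi> a b. if b = k then axis i 1 $ a else gram q $ a $ b) / det (gram q))"
    have "gram q *v x = axis i 1" using cramer[OF assms, of x "axis i 1"] by (simp add: x_def)
    then have "(gram q *v x) $ j = axis i 1 $ j" by simp
    moreover have "(gram q *v x) $ j = dual q i \<bullet> q $ j"
      by (simp add: matrix_vector_mult_def gram_def dual_def x_def inner_sum_left inner_commute[of "q $ j"] mult.commute)
    ultimately show ?thesis by (simp add: axis_def)
  qed
  then show ?thesis by (simp add: is_dual_def)
qed

lemma continuous_on_gram: "continuous_on S (\<lambda>q. gram q $ i $ j)"
  by (simp add: gram_def) (intro continuous_intros)

lemma continuous_on_det_gram: "continuous_on S (\<lambda>q. det (gram q))"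
  by (intro continuous_on_det continuous_on_gram)

lemma continuous_on_dual: "continuous_on {q. det (gram q) \<noteq> 0} (\<lambda>q. dual q i)"
proof -
  have "continuous_on S (\<lambda>q. det (\<chi> a b. if b = k then axis i 1 $ a else gram q $ a $ b))" for S k
    by (rule continuous_on_det, case_tac "j = k") (simp_all add: continuous_on_gram)
  then show ?thesis unfolding dual_def
    by (intro continuous_intros continuous_on_det_gram) auto
qed

lemma det_gram_tight:
  assumes "tight q" shows "det (gram q) \<noteq> 0"
proof -
  have "x = 0" if "gram q *v x = 0" for x
  proof -
    define s where "s = (\<Sum>j\<in>UNIV. x $ j)"
    have "(gram q *v x) $ i = 4/13 * s + 9/13 * x $ i" for i
    proof -
      have "(gram q *v x) $ i = (\<Sum>j\<in>UNIV. 4/13 * x $ j + (if i = j then 9/13 * x $ j else 0))"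
        unfolding matrix_vector_mult_def gram_def
        by (simp add: tight_gram[OF assms]) (intro sum.cong refl, simp add: distrib_right)
      then show ?thesis by (simp add: sum.distrib s_def sum_distrib_left)
    qed
    then have x: "9 * x $ i = - 4 * s" for i using that by (simp add: vec_eq_iff field_simps) (metis add.commute add_eq_0_iff mult_minus_left)
    have "9 * s = (\<Sum>i\<in>UNIV. 9 * x $ i)" by (simp add: s_def sum_distrib_left)
    also have "\<dots> = - 108 * s" by (simp add: x card27)
    finally have "s = 0" by simp
    then show "x = 0" using x by (simp add: vec_eq_iff)
  qed
  then have "\<exists>B. B ** gram q = mat 1" using matrix_left_invertible_ker by blast
  then show ?thesis by (metis invertible_det_nz invertible_left_inverse)
qed

lemma dual_tight: "tight q \<Longrightarrow> dual q = tdual q"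
proof
  fix i assume q: "tight q"
  show "dual q i = tdual q i"
    by (rule dual_eqI[OF tight_dual[OF q] card_dim])
      (use is_dual_dual[OF det_gram_tight[OF q]] tight_dual[OF q] in \<open>simp add: is_dual_def\<close>)
qed

lemma dual_swap:
  assumes "is_dual f (g :: 'k \<Rightarrow> 'j)"
  shows "(\<Sum>i\<in>UNIV. (x \<bullet> g i) *\<^sub>R f i) = x"
proof -
  have "is_dual g f" using assms unfolding is_dual_def by (metis inner_commute)
  from dual_expand[OF this card_dim, of x] show ?thesis by simp
qed

text \<open>The sum of the tensors of dual and basis vectors does not depend on the basis, so the
  value for an orthonormal basis carries over.\<close>

lemma sum_cr_dual:
  assumes "is_dual f (g :: 'k \<Rightarrow> 'j)"
  shows "(\<Sum>i\<in>UNIV. cr (f i) (g i)) = (-8) *\<^sub>R e"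
proof -
  have "(\<Sum>i\<in>UNIV. cr (f i) (g i)) = (\<Sum>i\<in>UNIV. \<Sum>b\<in>Basis. cr ((f i \<bullet> b) *\<^sub>R b) (g i))"
    by (subst (1) euclidean_representation[of "f _", symmetric]) (simp add: cr.sum_left)
  also have "\<dots> = (\<Sum>b\<in>Basis. \<Sum>i\<in>UNIV. cr b ((b \<bullet> f i) *\<^sub>R g i))"
    by (subst sum.swap) (simp add: cr_simps inner_commute)
  also have "\<dots> = (\<Sum>b\<in>Basis. cr b b)"
    by (intro sum.cong refl) (simp add: cr.sum_right[symmetric] dual_expand[OF assms card_dim, symmetric])
  finally show ?thesis by (simp add: sum_cr_Basis)
qed

text \<open>The deviation of the Gram matrix from that of a tight simplex, written linearly in the
  values \<open>w\<close> of the equations. On the diagonal this uses that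
  \<open>q \<bullet> q\<close> is the square of \<open>q \<bullet> e\<close> minus
  \<open>cr q q \<bullet> e\<close>.\<close>

definition defect :: "'j ^ 'k \<Rightarrow> ('j ^ 'k) \<times> (real ^ 'k) \<times> (real ^ 'k ^ 'k) \<Rightarrow> 'k \<Rightarrow> 'k \<Rightarrow> real" where
  "defect q w i j = (if i = j then (q $ i \<bullet> e + 1) * fst (snd w) $ i - fst w $ i \<bullet> e else snd (snd w) $ i $ j)"

text \<open>For every basis \<open>q\<close> the dual basis satisfies
  \<open>(\<Sum>i. cr (dual q i) (q $ i)) = -8 e\<close>; expressing both sides through the deviation of \<open>q\<close> from a tight
  simplex gives 27 relations between the equations.\<close>

definition relation :: "'j ^ 'k \<Rightarrow> ('j ^ 'k) \<times> (real ^ 'k) \<times> (real ^ 'k ^ 'k) \<Rightarrow> 'j" where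
  "relation q w = (\<Sum>i\<in>UNIV. \<Sum>j\<in>UNIV. defect q w i j *\<^sub>R cr (dual q i) (q $ j)) - (\<Sum>i\<in>UNIV. fst w $ i)
     - (4/13) *\<^sub>R cr (\<Sum>i\<in>UNIV. (fst (snd w) $ i) *\<^sub>R dual q i) (\<Sum>i\<in>UNIV. q $ i)
     + (4/13) *\<^sub>R cr e (\<Sum>i\<in>UNIV. ((\<Sum>j\<in>UNIV. defect q w i j) - 9 * fst (snd w) $ i) *\<^sub>R dual q i)"

text \<open>Since the Gram equations are kept as a full square matrix, their symmetry and zero
  diagonal are listed as relations too.\<close>

definition relations :: "'j ^ 'k \<Rightarrow> ('j ^ 'k) \<times> (real ^ 'k) \<times> (real ^ 'k ^ 'k) \<Rightarrow>
    ('j ^ 'k) \<times> (real ^ 'k ^ 'k) \<times> (real ^ 'k) \<times> 'j" where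
  "relations q w = (\<chi> i. redundancy (q $ i) (fst w $ i), \<chi> i j. snd (snd w) $ i $ j - snd (snd w) $ j $ i,
     \<chi> i. snd (snd w) $ i $ i, relation q w)"

lemma relation_constr:
  assumes "det (gram q) \<noteq> 0"
  shows "relation q (constr q) = 0"
proof -
  note dl = is_dual_dual[OF assms]
  define s where "s = (\<Sum>i\<in>UNIV. q $ i)"
  define T where "T = (\<Sum>i\<in>UNIV. (q $ i \<bullet> e - 1) *\<^sub>R dual q i)"
  have defect: "defect q (constr q) i j = q $ i \<bullet> q $ j - 4/13 - (if i = j then 9/13 else 0)" for i j
  proof -
    have "cr (q $ i) (q $ i) \<bullet> e = (q $ i \<bullet> e) * (q $ i \<bullet> e) - q $ i \<bullet> q $ i"
      by (simp add: cr_cyclic cr_unit_right inner_diff_right)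
    then show ?thesis by (cases "i = j") (simp_all add: defect_def constr_def algebra_simps)
  qed
  have "e = (\<Sum>i\<in>UNIV. (e \<bullet> q $ i) *\<^sub>R dual q i)" by (simp add: dual_swap[OF dl])
  also have "\<dots> = T + (\<Sum>i\<in>UNIV. dual q i)"
    by (simp add: T_def sum.distrib[symmetric] scaleR_diff_left inner_commute)
  finally have eps: "(\<Sum>i\<in>UNIV. dual q i) = e - T" by (simp add: algebra_simps)
  \<comment> \<open>Pairing \<open>s - 9 *\<^sub>R e\<close> with each \<open>q $ i\<close> recovers
    its dual coordinates; the constants cancel because 27 * 4/13 + 9/13 = 9.\<close>
  have d: "(\<Sum>i\<in>UNIV. ((\<Sum>j\<in>UNIV. defect q (constr q) i j) - 9 * fst (snd (constr q)) $ i) *\<^sub>R dual q i) = s - 9 *\<^sub>R e"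
  proof -
    have "(\<Sum>j\<in>UNIV. defect q (constr q) i j) - 9 * fst (snd (constr q)) $ i = (s - 9 *\<^sub>R e) \<bullet> q $ i" for i
    proof -
      have "fst (snd (constr q)) $ i = q $ i \<bullet> e - 1" by (simp add: constr_def)
      then show ?thesis
        unfolding defect inner_diff_left s_def inner_sum_left inner_commute[of _ "q $ i"]
        by (simp add: sum_subtractf card27 inner_sum_right inner_diff_right)
    qed
    then show ?thesis by (simp add: dual_swap[OF dl])
  qed
  have "(\<Sum>i\<in>UNIV. \<Sum>j\<in>UNIV. defect q (constr q) i j *\<^sub>R cr (dual q i) (q $ j)) =
      (\<Sum>i\<in>UNIV. \<Sum>j\<in>UNIV. (q $ i \<bullet> q $ j) *\<^sub>R cr (dual q i) (q $ j)) -
      (4/13) *\<^sub>R (\<Sum>i\<in>UNIV. \<Sum>j\<in>UNIV. cr (dual q i) (q $ j)) -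
      (\<Sum>i\<in>UNIV. \<Sum>j\<in>UNIV. if i = j then (9/13) *\<^sub>R cr (dual q i) (q $ i) else 0)"
    unfolding defect
    by (simp add: scaleR_diff_left sum_subtractf scaleR_sum_right if_distrib[of "\<lambda>x. x *\<^sub>R _"] cong: if_cong)
  also have "(\<Sum>i\<in>UNIV. \<Sum>j\<in>UNIV. (q $ i \<bullet> q $ j) *\<^sub>R cr (dual q i) (q $ j)) = (\<Sum>j\<in>UNIV. cr (q $ j) (q $ j))"
  proof -
    have "(\<Sum>i\<in>UNIV. (q $ i \<bullet> q $ j) *\<^sub>R cr (dual q i) (q $ j)) = cr (\<Sum>i\<in>UNIV. (q $ j \<bullet> q $ i) *\<^sub>R dual q i) (q $ j)" for j
      by (simp add: cr.sum_left cr_simps inner_commute)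
    then show ?thesis by (subst sum.swap) (simp add: dual_swap[OF dl])
  qed
  also have "(\<Sum>i\<in>UNIV. \<Sum>j\<in>UNIV. cr (dual q i) (q $ j)) = cr (e - T) s"
    by (simp add: eps[symmetric] s_def cr.sum_left cr.sum_right) (rule sum.swap)
  also have "(\<Sum>i\<in>UNIV. \<Sum>j\<in>UNIV. if i = j then (9/13) *\<^sub>R cr (dual q i) (q $ i) else 0) = (9/13) *\<^sub>R (-8) *\<^sub>R e"
    by (simp only: sum_cr_dual[OF dl, symmetric] scaleR_sum_right) simp
  \<comment> \<open>The constant terms balance: 9/13 * 8 on one side, and 4/13 * 9 * 2 on the other
    since \<open>cr e e\<close> is twice \<open>e\<close>; both are 72/13.\<close>
  finally have "relation q (constr q) = - (4/13) *\<^sub>R cr (e - T) s + (72/13) *\<^sub>R e - (4/13) *\<^sub>R cr T s + (4/13) *\<^sub>R cr e (s - 9 *\<^sub>R e)"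
    unfolding relation_def d by (simp add: constr_def T_def[symmetric] s_def[symmetric])
  also have "\<dots> = 0" by (simp add: cr_simps cr_unit[of e] unit_unit algebra_simps)
      (simp add: scaleR_left_distrib[symmetric])
  finally show ?thesis .
qed

lemma relations_constr: "det (gram q) \<noteq> 0 \<Longrightarrow> relations q (constr q) = 0"
  by (simp add: relations_def relation_constr zero_prod_def vec_eq_iff)
    (simp add: constr_def redundancy_square inner_commute)

lemma linear_redundancy: "linear (redundancy x)"
  by (intro linearI) (simp_all add: redundancy_def cr_simps inner_add_left algebra_simps)

lemma linear_relation: "linear (relation q)"
proof -
  have a: "defect q (v + w) i j = defect q v i j + defect q w i j" "defect q (c *\<^sub>R v) i j = c * defect q v i j" for v w c i j
    by (simp_all add: defect_def inner_add_left algebra_simps)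
  have 1: "linear (\<lambda>w. \<Sum>i\<in>UNIV. \<Sum>j\<in>UNIV. defect q w i j *\<^sub>R cr (dual q i) (q $ j))"
    by (intro linearI) (simp_all add: a scaleR_left_distrib sum.distrib scaleR_sum_right)
  have 2: "linear (\<lambda>w::('j ^ 'k) \<times> (real ^ 'k) \<times> (real ^ 'k ^ 'k). \<Sum>i\<in>UNIV. fst w $ i)"
    by (intro linearI) (simp_all add: sum.distrib scaleR_sum_right)
  have "linear (\<lambda>w::('j ^ 'k) \<times> (real ^ 'k) \<times> (real ^ 'k ^ 'k). \<Sum>i\<in>UNIV. (fst (snd w) $ i) *\<^sub>R dual q i)"
    by (intro linearI) (simp_all add: scaleR_left_distrib sum.distrib scaleR_sum_right)
  from linear_compose[OF this bounded_linear.linear[OF cr.bounded_linear_left]]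
  have 3: "linear (\<lambda>w::('j ^ 'k) \<times> (real ^ 'k) \<times> (real ^ 'k ^ 'k). cr (\<Sum>i\<in>UNIV. (fst (snd w) $ i) *\<^sub>R dual q i) (\<Sum>i\<in>UNIV. q $ i))"
    by (simp add: o_def)
  have "linear (\<lambda>w. \<Sum>i\<in>UNIV. ((\<Sum>j\<in>UNIV. defect q w i j) - 9 * fst (snd w) $ i) *\<^sub>R dual q i)"
  proof (intro linearI)
    fix v w c
    show "(\<Sum>i\<in>UNIV. ((\<Sum>j\<in>UNIV. defect q (v + w) i j) - 9 * fst (snd (v + w)) $ i) *\<^sub>R dual q i) =
      (\<Sum>i\<in>UNIV. ((\<Sum>j\<in>UNIV. defect q v i j) - 9 * fst (snd v) $ i) *\<^sub>R dual q i) +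
      (\<Sum>i\<in>UNIV. ((\<Sum>j\<in>UNIV. defect q w i j) - 9 * fst (snd w) $ i) *\<^sub>R dual q i)"
      unfolding sum.distrib[symmetric] scaleR_left_distrib[symmetric]
      by (intro sum.cong refl) (simp add: a sum.distrib algebra_simps)
    show "(\<Sum>i\<in>UNIV. ((\<Sum>j\<in>UNIV. defect q (c *\<^sub>R v) i j) - 9 * fst (snd (c *\<^sub>R v)) $ i) *\<^sub>R dual q i) =
      c *\<^sub>R (\<Sum>i\<in>UNIV. ((\<Sum>j\<in>UNIV. defect q v i j) - 9 * fst (snd v) $ i) *\<^sub>R dual q i)"
      unfolding scaleR_sum_right scaleR_scaleR
      by (intro sum.cong refl) (simp add: a sum_distrib_left[symmetric] algebra_simps)
  qed
  from linear_compose[OF this bounded_linear.linear[OF cr.bounded_linear_right]]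
  have 4: "linear (\<lambda>w. cr e (\<Sum>i\<in>UNIV. ((\<Sum>j\<in>UNIV. defect q w i j) - 9 * fst (snd w) $ i) *\<^sub>R dual q i))"
    by (simp add: o_def)
  show ?thesis unfolding relation_def[abs_def]
    by (intro linear_compose_add linear_compose_sub linear_compose_scale_right 1 2 3 4)
qed

lemma linear_relations: "linear (relations q)"
  by (intro linearI)
    (simp_all add: relations_def vec_eq_iff linear_add[OF linear_redundancy] linear_scale[OF linear_redundancy]
      linear_add[OF linear_relation] linear_scale[OF linear_relation] algebra_simps)

lemma continuous_on_relations: "continuous_on {q. det (gram q) \<noteq> 0} (\<lambda>q. relations q w)"
proof -
  have 1: "continuous_on S (\<lambda>q. defect q w i j)" for S i j
    unfolding defect_def by (cases "i = j") (simp_all, intro continuous_intros)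
  have 2: "continuous_on S (\<lambda>q. redundancy (q $ i) (fst w $ i))" for S i
    unfolding redundancy_def by (intro continuous_intros cr.continuous_on)
  show ?thesis unfolding relations_def relation_def
    by (intro continuous_intros continuous_on_vec_lambda cr.continuous_on continuous_on_dual 1 2)
qed


section \<open>Derivatives, exactness at the simplex, and the chart\<close>

lemma constr_has_derivative: "(constr has_derivative constr' q) (at q)"
proof -
  have n: "((\<lambda>q. q $ i) has_derivative (\<lambda>v. v $ i)) (at q)" for i
    by (intro bounded_linear_imp_has_derivative bounded_linear_vec_nth)
  have 1: "((\<lambda>q. cr (q $ i) (q $ i)) has_derivative (\<lambda>v. cr (q $ i) (v $ i) + cr (v $ i) (q $ i))) (at q)" for i
    by (rule cr.FDERIV[OF n n])
  have 2: "((\<lambda>q. if i = j then 0 else q $ i \<bullet> q $ j - 4/13) has_derivative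
      (\<lambda>v. if i = j then 0 else q $ i \<bullet> v $ j + v $ i \<bullet> q $ j)) (at q)" for i j
    by (cases "i = j") (auto intro!: derivative_eq_intros n)
  show ?thesis unfolding constr_def[abs_def] constr'_def[abs_def]
    by (intro has_derivative_Pair has_derivative_vec_lambda 1 2) (auto intro!: derivative_eq_intros n)
qed

lemma cubics_has_derivative: "(cubics has_derivative cubics' q) (at q)"
proof -
  have n: "((\<lambda>q. q $ i) has_derivative (\<lambda>v. v $ i)) (at q)" for i
    by (intro bounded_linear_imp_has_derivative bounded_linear_vec_nth)
  have 1: "((\<lambda>q. cr (q $ i) (q $ j)) has_derivative (\<lambda>v. cr (q $ i) (v $ j) + cr (v $ i) (q $ j))) (at q)" for i j
    by (rule cr.FDERIV[OF n n])
  have 2: "((\<lambda>q. cr (q $ i) (q $ j) \<bullet> q $ l) has_derivative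
      (\<lambda>v. cr (v $ i) (q $ j) \<bullet> q $ l + cr (q $ i) (v $ j) \<bullet> q $ l + cr (q $ i) (q $ j) \<bullet> v $ l)) (at q)" for i j l
    by (rule has_derivative_eq_rhs[OF has_derivative_inner[OF 1 n]]) (auto simp: inner_add_left)
  show ?thesis unfolding cubics_def[abs_def] cubics'_def[abs_def]
    by (intro has_derivative_vec_lambda 2)
qed

lemma continuous_blinfun_of_linear:
  fixes f :: "'a::t2_space \<Rightarrow> 'b::euclidean_space \<Rightarrow> 'c::euclidean_space"
  assumes "\<And>x. linear (f x)" "\<And>b. continuous_on S (\<lambda>x. f x b)"
  shows "continuous_on S (\<lambda>x. Blinfun (f x))"
  by (rule continuous_on_blinfun_componentwise)
    (simp add: bounded_linear_Blinfun_apply linear_conv_bounded_linear[symmetric] assms)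

text \<open>The equations for individual points are met by choosing each velocity separately. What
  remains is a hollow matrix, for which the last relation reduces to the vanishing of
  \<open>contract\<close>; tangent velocities then realise it by the dimension count.\<close>

lemma relations_exact:
  assumes p: "tight p" "dim (infinitesimal p) \<le> 108" and w: "relations p w = 0"
  shows "w \<in> range (constr' p)"
proof -
  obtain y \<tau> g where w_eq: "w = (y, \<tau>, g)" by (cases w) auto
  have pl: "p $ i \<in> plane" "p $ i \<bullet> e = 1" "cr (p $ i) (p $ i) = 0" for i
    using p(1) by (auto simp: tight_def plane_def)
  have r: "redundancy (p $ i) (y $ i) = 0" "g $ i $ j = g $ j $ i" "g $ i $ i = 0" for i j
    using w by (auto simp: relations_def w_eq zero_prod_def vec_eq_iff)
  \<comment> \<open>On the kernel of \<open>redundancy\<close> the operator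
    \<open>cr (p $ i)\<close> is an involution, so half of it inverts the derivative of the square.
    A multiple of \<open>p $ i\<close>, which \<open>cr (p $ i)\<close> kills, then adjusts the
    trace.\<close>
  define a where "a i = (1/2) *\<^sub>R cr (p $ i) (y $ i)" for i
  define u where "u = (\<chi> i. a i + (\<tau> $ i - a i \<bullet> e) *\<^sub>R p $ i)"
  have u1: "cr (p $ i) (u $ i) + cr (u $ i) (p $ i) = y $ i" for i
  proof -
    have "cr (p $ i) (u $ i) = (1/2) *\<^sub>R y $ i"
      using redundancy_kernel(1)[OF pl(1) r(1)] by (simp add: u_def a_def cr_simps pl)
    then show ?thesis by (simp add: cr_commute[of "u $ i"] scaleR_left_distrib[symmetric])
  qed
  have u2: "u $ i \<bullet> e = \<tau> $ i" for i by (simp add: u_def inner_add_left pl)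
  define g' where "g' = g - snd (snd (constr' p u))"
  have decomp: "w - constr' p u = (0, 0, g')"
    by (simp add: w_eq g'_def constr'_def u1 u2 vec_eq_iff zero_prod_def)
  have hol: "g' \<in> hollow"
    using r by (auto simp: hollow_def g'_def constr'_def inner_commute)
  have "relations p (constr' p u) = 0"
  proof (rule derivative_of_redundancy[where N="{q. det (gram q) \<noteq> 0}" and R=relations and C=constr])
    show "open {q::'j^'k. det (gram q) \<noteq> 0}"
      by (intro open_Collect_neq continuous_on_det_gram continuous_on_const)
  qed (use det_gram_tight[OF p(1)] linear_relations continuous_on_relations relations_constr constr_eq_0 p(1)
      constr_has_derivative in auto)
  then have "relations p (0, 0, g') = 0"
    using w linear_diff[OF linear_relations, of p w "constr' p u"] by (simp add: decomp)
  then have rel: "relation p (0, 0, g') = 0" by (simp add: relations_def zero_prod_def)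
  have df: "defect p (0, 0, g') i j = g' $ i $ j" for i j
    using hol by (simp add: defect_def hollow_def)
  define P where "P = (\<Sum>i\<in>UNIV. \<Sum>j\<in>UNIV. (g' $ i $ j) *\<^sub>R p $ i)"
  have P2: "(\<Sum>i\<in>UNIV. \<Sum>j\<in>UNIV. (g' $ i $ j) *\<^sub>R p $ j) = P"
  proof -
    have "g' $ i $ j = g' $ j $ i" for i j using hol unfolding hollow_def by blast
    then show ?thesis unfolding P_def by (subst sum.swap) (intro sum.cong refl, metis)
  qed
  define \<sigma> where "\<sigma> = (\<Sum>i\<in>UNIV. \<Sum>j\<in>UNIV. g' $ i $ j)"
  have t1: "(\<Sum>i\<in>UNIV. \<Sum>j\<in>UNIV. (g' $ i $ j) *\<^sub>R cr (tdual p i) (p $ j)) =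
      (13/9) *\<^sub>R (contract p g' - (4/13) *\<^sub>R cr e P)"
  proof -
    have "cr e P = (\<Sum>i\<in>UNIV. \<Sum>j\<in>UNIV. (g' $ i $ j) *\<^sub>R cr e (p $ j))"
      by (simp add: P2[symmetric] cr.sum_right cr_simps)
    then show ?thesis
      by (simp add: contract_def tdual_def cr_simps scaleR_sum_right sum_subtractf[symmetric] scaleR_diff_right)
        (simp add: mult.commute mult.left_commute)
  qed
  have t2: "(\<Sum>i\<in>UNIV. (\<Sum>j\<in>UNIV. g' $ i $ j) *\<^sub>R tdual p i) = (13/9) *\<^sub>R (P - ((4/13) * \<sigma>) *\<^sub>R e)"
  proof -
    have "P = (\<Sum>i\<in>UNIV. (\<Sum>j\<in>UNIV. g' $ i $ j) *\<^sub>R p $ i)" by (simp add: P_def scaleR_sum_left)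
    moreover have "\<sigma> *\<^sub>R e = (\<Sum>i\<in>UNIV. (\<Sum>j\<in>UNIV. g' $ i $ j) *\<^sub>R e)" by (simp add: \<sigma>_def scaleR_sum_left)
    ultimately have "P - (4/13) *\<^sub>R \<sigma> *\<^sub>R e = (\<Sum>i\<in>UNIV. (\<Sum>j\<in>UNIV. g' $ i $ j) *\<^sub>R (p $ i - (4/13) *\<^sub>R e))"
      by (simp add: scaleR_sum_right sum_subtractf[symmetric] scaleR_diff_right mult.commute)
    then show ?thesis
      by (simp add: tdual_def scaleR_sum_right) (simp add: mult.commute)
  qed
  have "relation p (0, 0, g') = (13/9) *\<^sub>R (contract p g' - ((32/169) * \<sigma>) *\<^sub>R e)"
    unfolding relation_def df dual_tight[OF p(1)] t1
    by (simp add: t2 cr_simps cr_unit[of e] unit_unit scaleR_diff_right algebra_simps)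
      (simp add: scaleR_left_distrib[symmetric])
  then have con: "contract p g' = ((32/169) * \<sigma>) *\<^sub>R e" using rel by simp
  \<comment> \<open>A second evaluation of the same number: the multiple of \<open>e\<close> just
    found gives 96/169 times \<open>\<sigma>\<close>, while products of distinct points pair with
    \<open>e\<close> to 1 - 4/13 = 9/13. Hence \<open>\<sigma>\<close> vanishes.\<close>
  have "contract p g' \<bullet> e = (9/13) * \<sigma>"
  proof -
    have s: "(g' $ i $ j) * (cr (p $ i) (p $ j) \<bullet> e) = (9/13) * g' $ i $ j" for i j
    proof -
      have "cr (p $ i) (p $ j) \<bullet> e = 1 - p $ i \<bullet> p $ j" by (simp add: cr_cyclic cr_unit_right inner_diff_right pl)
      moreover have "g' $ i $ i = 0" using hol unfolding hollow_def by blast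
      ultimately show ?thesis using tight_gram[OF p(1), of i j] by (cases "i = j") auto
    qed
    show ?thesis unfolding contract_def inner_sum_left inner_scaleR_left s \<sigma>_def sum_distrib_left ..
  qed
  then have "\<sigma> = 0" using con unit_unit by simp
  then have "contract p g' = 0" using con by simp
  then obtain v where v: "v \<in> tangents p" "gram' p v = g'"
    using infinitesimal_complete(2)[OF p hol] by blast
  have "constr' p v = (0, 0, g')"
    using v(1) hol by (auto simp: v(2)[symmetric] constr'_def gram'_def tangents_def tangent_def vec_eq_iff
        zero_prod_def hollow_def cr_commute[of "v $ _"])
  then have "w = constr' p (u + v)" using decomp by (simp add: linear_add[OF linear_constr'] algebra_simps)
  then show ?thesis by blast
qed

theorem moduli_chart:
  assumes p: "tight p" "dim (infinitesimal p) \<le> 108" and D: "dim (trivial_inf p) = 52"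
  obtains W and \<Lambda> :: "real ^ 'k ^ 'k ^ 'k \<Rightarrow> real ^ 56"
  where "open W" "p \<in> W" "linear \<Lambda>"
    "\<And>V. open V \<Longrightarrow> V \<subseteq> W \<Longrightarrow> open ((\<lambda>q. \<Lambda> (cubics q)) ` {q\<in>V. tight q})"
    "\<And>q r. \<lbrakk>q \<in> W; r \<in> W; tight q; tight r; \<Lambda> (cubics q) = \<Lambda> (cubics r)\<rbrakk> \<Longrightarrow> cubics q = cubics r"
proof -
  let ?N = "{q::'j^'k. det (gram q) \<noteq> 0}"
  let ?C' = "\<lambda>q. Blinfun (constr' q)" and ?c' = "\<lambda>q. Blinfun (cubics' q)"
  have bl: "blinfun_apply (?C' q) = constr' q" "blinfun_apply (?c' q) = cubics' q" for q
    using linear_constr' linear_cubics' by (simp_all add: bounded_linear_Blinfun_apply linear_conv_bounded_linear)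
  have oN: "open ?N" by (intro open_Collect_neq continuous_on_det_gram continuous_on_const)
  have cC: "continuous_on UNIV ?C'"
  proof (rule continuous_blinfun_of_linear[OF linear_constr'])
    fix b :: "'j ^ 'k"
    have "continuous_on UNIV (\<lambda>q. if i = j then 0 else q $ i \<bullet> b $ j + b $ i \<bullet> q $ j)" for i j
      by (cases "i = j") (simp_all, intro continuous_intros)
    then show "continuous_on UNIV (\<lambda>q. constr' q b)"
      unfolding constr'_def by (intro continuous_intros continuous_on_vec_lambda cr.continuous_on) auto
  qed
  have cc: "continuous_on UNIV ?c'"
    by (rule continuous_blinfun_of_linear[OF linear_cubics'])
      (unfold cubics'_def, intro continuous_intros continuous_on_vec_lambda cr.continuous_on)
  show thesis
  proof (rule constant_rank_on_redundant_zero_set[of constr ?C' cubics ?c' ?N p relations 52, where ?'n=56])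
    show "(constr has_derivative blinfun_apply (?C' x)) (at x)" for x unfolding bl by (rule constr_has_derivative)
    show "(cubics has_derivative blinfun_apply (?c' x)) (at x)" for x unfolding bl by (rule cubics_has_derivative)
    show "\<And>v. continuous_on ?N (\<lambda>q. relations q v)" by (rule continuous_on_relations)
    show "relations p v = 0 \<Longrightarrow> v \<in> range (blinfun_apply (?C' p))" for v
      unfolding bl by (rule relations_exact[OF p])
    show "dim {v. blinfun_apply (?C' q) v = 0 \<and> blinfun_apply (?c' q) v = 0} = 52" if "constr q = 0" for q
      unfolding bl using dim_trivial_inf_eq[OF p(1), of q] that D by (simp add: constr_eq_0 trivial_inf_def)
    show "dim {v. blinfun_apply (?C' p) v = 0} = 52 + CARD(56)"
      unfolding bl using infinitesimal_complete(1)[OF p] by (simp add: infinitesimal_def)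
  next
    fix W and \<Lambda> :: "real ^ 'k ^ 'k ^ 'k \<Rightarrow> real ^ 56"
    assume "open W" "p \<in> W" "W \<subseteq> ?N" "linear \<Lambda>"
      "\<And>V. open V \<Longrightarrow> V \<subseteq> W \<Longrightarrow> open ((\<lambda>x. \<Lambda> (cubics x)) ` {q\<in>V. constr q = 0})"
      "\<And>q r. \<lbrakk>q \<in> W; r \<in> W; constr q = 0; constr r = 0; \<Lambda> (cubics q) = \<Lambda> (cubics r)\<rbrakk> \<Longrightarrow> cubics q = cubics r"
    then show thesis using that[of W \<Lambda>] by (simp add: constr_eq_0)
  qed (use oN cC cc det_gram_tight[OF p(1)] linear_relations relations_constr constr_eq_0 p(1) in auto)
qed

end

section \<open>The group of order 27\<close>

text \<open>The field with three elements as an enumerated type, so that finite statements over it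
  can be split into cases and evaluated.\<close>

datatype tri = T0 | T1 | T2

lemma UNIV_tri: "UNIV = {T0, T1, T2}"
  using tri.exhaust by blast

instantiation tri :: comm_ring_1
begin

fun plus_tri :: "tri \<Rightarrow> tri \<Rightarrow> tri" where
  "T0 + x = x"
| "T1 + T0 = T1"
| "T1 + T1 = T2"
| "T1 + T2 = T0"
| "T2 + T0 = T2"
| "T2 + T1 = T0"
| "T2 + T2 = (T1::tri)"

fun uminus_tri :: "tri \<Rightarrow> tri" where
  "- T0 = T0"
| "- T1 = T2"
| "- T2 = (T1::tri)"

fun times_tri :: "tri \<Rightarrow> tri \<Rightarrow> tri" where
  "T0 * x = T0"
| "T1 * x = x"
| "T2 * x = - (x::tri)"

definition minus_tri :: "tri \<Rightarrow> tri \<Rightarrow> tri" where "x - y = x + - (y::tri)"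
definition zero_tri :: tri where "0 = T0"
definition one_tri :: tri where "1 = T1"

instance
proof
  fix a b c :: tri
  show "a + b + c = a + (b + c)" by (cases a; cases b; cases c) simp_all
  show "a + b = b + a" by (cases a; cases b) simp_all
  show "0 + a = a" by (simp add: zero_tri_def)
  show "- a + a = 0" by (cases a) (simp_all add: zero_tri_def)
  show "a - b = a + - b" by (simp add: minus_tri_def)
  show "a * b * c = a * (b * c)" by (cases a; cases b; cases c) simp_all
  show "a * b = b * a" by (cases a; cases b) simp_all
  show "1 * a = a" by (simp add: one_tri_def)
  show "(a + b) * c = a * c + b * c" by (cases a; cases b; cases c) simp_all
  show "(0::tri) \<noteq> 1" by (simp add: zero_tri_def one_tri_def)
qed

end

instance tri :: finite
  by standard (simp add: UNIV_tri)

lemma tri_sum: "(\<Sum>i\<in>UNIV. f i) = f T0 + f T1 + f T2"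
  by (simp add: UNIV_tri add.assoc)

lemma tri_all: "(\<forall>i. P i) \<longleftrightarrow> P T0 \<and> P T1 \<and> P T2"
  by (metis tri.exhaust)

lemma tri_double: "(x::tri) + x = - x"
  by (cases x) simp_all

type_synonym grp = "tri \<times> tri \<times> tri"

lemma card_tri: "CARD(tri) = 3"
  by (simp add: UNIV_tri)

lemma card_grp: "CARD(grp) = 27"
  by (simp add: card_tri)

lemma grp_sum: "(\<Sum>c\<in>UNIV. f c) = (\<Sum>i\<in>UNIV. \<Sum>j\<in>UNIV. \<Sum>k\<in>UNIV. f (i, j, k))"
  for f :: "grp \<Rightarrow> 'a::comm_monoid_add"
  by (simp add: sum.cartesian_product UNIV_Times_UNIV case_prod_unfold)

lemma grp_double: "(x::grp) + x = - x"
  by (cases x) (simp add: tri_double)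

definition omega :: complex where "omega = Complex (-1/2) (sqrt 3 / 2)"

lemma omega_square: "omega * omega = -1 - omega"
  by (simp add: omega_def complex_eq_iff field_simps)

lemma cnj_omega: "cnj omega = -1 - omega"
  by (simp add: omega_def complex_eq_iff)

fun om :: "tri \<Rightarrow> complex" where
  "om T0 = 1"
| "om T1 = omega"
| "om T2 = -1 - omega"

lemma om_add: "om (a + b) = om a * om b"
  by (cases a; cases b) (simp_all add: algebra_simps omega_square)

lemma om_0 [simp]: "om 0 = 1"
  by (simp add: zero_tri_def)

lemma om_uminus: "om (- a) = cnj (om a)"
  by (cases a) (simp_all add: cnj_omega)

lemma om_cnj: "om a * cnj (om a) = 1"
  by (simp add: om_uminus[symmetric] om_add[symmetric])

lemma om_nz [simp]: "om a \<noteq> 0"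
  using om_cnj[of a] by auto

lemma om_orthogonal: "(\<Sum>i\<in>UNIV. om (a * i)) = (if a = 0 then 3 else 0)"
  by (cases a) (simp_all add: tri_sum zero_tri_def card_tri)

fun dotp :: "grp \<Rightarrow> grp \<Rightarrow> tri" where
  "dotp (a, b, c) (d, e, f) = a * d + b * e + c * f"

lemma dotp_add: "dotp (x + y) z = dotp x z + dotp y z"
  by (cases x; cases y; cases z) (simp add: algebra_simps)

lemma dotp_add_right: "dotp z (x + y) = dotp z x + dotp z y"
  by (cases x; cases y; cases z) (simp add: algebra_simps)

lemma dotp_commute: "dotp x y = dotp y x"
  by (cases x; cases y) (simp add: mult.commute)

lemma dotp_uminus: "dotp (- x) z = - dotp x z"
  by (cases x; cases z) simp

lemma dotp_uminus_right: "dotp z (- x) = - dotp z x"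
  by (cases x; cases z) simp

lemma dotp_0 [simp]: "dotp 0 x = 0" "dotp x 0 = 0"
  by (cases x; simp add: zero_prod_def)+

definition chr :: "grp \<Rightarrow> grp \<Rightarrow> complex" where "chr c g = om (dotp c g)"

lemma chr_add: "chr (c + d) g = chr c g * chr d g" "chr c (g + h) = chr c g * chr c h"
  by (simp_all add: chr_def dotp_add dotp_add_right om_add)

lemma chr_uminus: "chr (- c) g = cnj (chr c g)" "chr c (- g) = cnj (chr c g)"
  by (simp_all add: chr_def dotp_uminus dotp_uminus_right om_uminus)

lemma chr_commute: "chr c g = chr g c"
  by (simp add: chr_def dotp_commute)

lemma chr_0 [simp]: "chr 0 g = 1" "chr g 0 = 1"
  by (simp_all add: chr_def)

lemma chr_diff: "chr (c - d) g = chr c g * cnj (chr d g)" "chr c (g - h) = chr c g * cnj (chr c h)"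
  unfolding diff_conv_add_uminus chr_add chr_uminus by simp_all

lemma chr_orthogonal: "(\<Sum>g\<in>UNIV. chr c g) = (if c = 0 then 27 else 0)"
proof -
  obtain a b d where c: "c = (a, b, d)" by (cases c)
  have "(\<Sum>g\<in>UNIV. chr c g) = (\<Sum>i\<in>UNIV. om (a * i)) * (\<Sum>j\<in>UNIV. om (b * j)) * (\<Sum>k\<in>UNIV. om (d * k))"
    by (simp add: grp_sum tri_sum c chr_def om_add algebra_simps)
  then show ?thesis by (simp add: om_orthogonal c zero_prod_def)
qed

lemma chr_orthogonal': "(\<Sum>c\<in>UNIV. chr c g) = (if g = 0 then 27 else 0)"
  using chr_orthogonal[of g] by (subst chr_commute)

lemma chr_inversion: "(\<Sum>c\<in>UNIV. chr c g * (\<Sum>h\<in>UNIV. cnj (chr c h) * f h)) = 27 * f g"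
proof -
  have "(\<Sum>c\<in>UNIV. chr c g * (\<Sum>h\<in>UNIV. cnj (chr c h) * f h)) = (\<Sum>c\<in>UNIV. \<Sum>h\<in>UNIV. f h * chr c (g - h))"
    unfolding sum_distrib_left chr_diff(2) by (intro sum.cong refl) (simp only: mult_ac)
  also have "\<dots> = (\<Sum>h\<in>UNIV. f h * (\<Sum>c\<in>UNIV. chr c (g - h)))"
    by (subst sum.swap) (simp only: sum_distrib_left)
  also have "\<dots> = (\<Sum>h\<in>UNIV. if h = g then 27 * f h else 0)"
    unfolding chr_orthogonal' by (intro sum.cong refl) auto
  finally show ?thesis by simp
qed

lemma sum_uminus_reindex: "(\<Sum>c\<in>UNIV. f (- c)) = (\<Sum>c\<in>UNIV. f (c::grp))"
  by (rule sum.reindex_bij_witness[of _ uminus uminus]) auto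

lemma chr_independent:
  assumes "\<And>g. (\<Sum>c\<in>UNIV. k c * chr c g) = 0"
  shows "k c = 0"
proof -
  have "(\<Sum>g\<in>UNIV. chr g (- c) * (\<Sum>h\<in>UNIV. cnj (chr g h) * k (- h))) = 27 * k c"
    using chr_inversion[of "- c" "\<lambda>h. k (- h)"] by simp
  moreover have "(\<Sum>h\<in>UNIV. cnj (chr g h) * k (- h)) = (\<Sum>c\<in>UNIV. k c * chr c g)" for g
    by (subst sum_uminus_reindex[symmetric]) (intro sum.cong refl, subst (2) chr_commute, simp add: chr_uminus)
  ultimately show ?thesis using assms by simp
qed

section \<open>Fourier coordinates\<close>

type_synonym alg = "real ^ grp"

text \<open>The factors 1/9 here and 1/3 in \<open>synth\<close> multiply to 1/27. With this split
  the unit has coordinate 1 at the trivial character and squared norm 3.\<close>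

definition xi :: "grp \<Rightarrow> alg \<Rightarrow> complex" where
  "xi c x = (\<Sum>g\<in>UNIV. cnj (chr c g) * complex_of_real (x $ g)) / 9"

definition synth :: "(grp \<Rightarrow> complex) \<Rightarrow> alg" where
  "synth \<zeta> = (\<chi> g. Re ((\<Sum>c\<in>UNIV. chr c g * \<zeta> c) / 3))"

definition hermitian :: "(grp \<Rightarrow> complex) \<Rightarrow> bool" where
  "hermitian \<zeta> \<longleftrightarrow> (\<forall>c. \<zeta> (- c) = cnj (\<zeta> c))"

lemma xi_add: "xi c (x + y) = xi c x + xi c y"
  by (simp add: xi_def distrib_left sum.distrib add_divide_distrib)

lemma xi_scaleR: "xi c (r *\<^sub>R x) = complex_of_real r * xi c x"
  by (simp add: xi_def sum_distrib_left algebra_simps)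

lemma xi_hermitian: "xi (- c) x = cnj (xi c x)"
  by (simp add: xi_def chr_uminus)

lemma synth_xi: "synth (\<lambda>c. xi c x) = x"
proof -
  have "(\<Sum>c\<in>UNIV. chr c g * xi c x) / 3 = complex_of_real (x $ g)" for g
    using chr_inversion[of g "\<lambda>h. complex_of_real (x $ h)"]
    by (simp add: xi_def times_divide_eq_right sum_divide_distrib[symmetric])
  then show ?thesis by (simp add: synth_def vec_eq_iff)
qed

lemma xi_inject: "(\<And>c. xi c x = xi c y) \<Longrightarrow> x = y"
  by (metis synth_xi ext)

lemma xi_synth:
  assumes "hermitian \<zeta>" shows "xi c (synth \<zeta>) = \<zeta> c"
proof -
  have \<zeta>: "\<zeta> (- c) = cnj (\<zeta> c)" for c using assms unfolding hermitian_def by blast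
  have "cnj (\<Sum>c\<in>UNIV. chr c g * \<zeta> c) = (\<Sum>c\<in>UNIV. chr c g * \<zeta> c)" for g
    using sum_uminus_reindex[of "\<lambda>c. chr c g * \<zeta> c"] by (simp add: \<zeta> chr_uminus)
  then have "cnj ((\<Sum>c\<in>UNIV. chr c g * \<zeta> c) / 3) = (\<Sum>c\<in>UNIV. chr c g * \<zeta> c) / 3" for g
    by (simp only: complex_cnj_divide complex_cnj_numeral)
  then have "complex_of_real (Re ((\<Sum>c\<in>UNIV. chr c g * \<zeta> c) / 3)) = (\<Sum>c\<in>UNIV. chr c g * \<zeta> c) / 3" for g
    by (simp only: Reals_cnj_iff[symmetric] of_real_Re)
  then have "xi c (synth \<zeta>) = (\<Sum>g\<in>UNIV. cnj (chr c g) * ((\<Sum>d\<in>UNIV. chr d g * \<zeta> d) / 3)) / 9"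
    by (simp add: xi_def synth_def)
  also have "\<dots> = (\<Sum>g\<in>UNIV. cnj (chr g c) * (\<Sum>d\<in>UNIV. chr g d * \<zeta> d)) / 27"
    by (subst (1 2) chr_commute) (simp add: sum_divide_distrib[symmetric])
  also have "\<dots> = cnj (\<Sum>g\<in>UNIV. chr g c * (\<Sum>d\<in>UNIV. cnj (chr g d) * cnj (\<zeta> d))) / 27"
    by simp
  also have "\<dots> = \<zeta> c" unfolding chr_inversion by simp
  finally show ?thesis .
qed

lemma xi_parseval: "complex_of_real (x \<bullet> y) = 3 * (\<Sum>c\<in>UNIV. xi c x * xi (- c) y)"
proof -
  have "27 * complex_of_real (x $ g) = 9 * (\<Sum>c\<in>UNIV. chr c g * xi c x)" for g
    using chr_inversion[of g "\<lambda>h. complex_of_real (x $ h)"]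
    by (simp add: xi_def times_divide_eq_right sum_divide_distrib[symmetric])
  then have x: "complex_of_real (x $ g) = (\<Sum>c\<in>UNIV. chr c g * xi c x) / 3" for g by (simp add: field_simps)
  have "complex_of_real (x \<bullet> y) = (\<Sum>g\<in>UNIV. complex_of_real (x $ g) * complex_of_real (y $ g))"
    by (simp add: inner_vec_def)
  also have "\<dots> = (\<Sum>g\<in>UNIV. \<Sum>c\<in>UNIV. xi c x * (chr c g * complex_of_real (y $ g))) / 3"
    unfolding x[of g for g] sum_divide_distrib sum_distrib_right by (simp add: sum_divide_distrib mult_ac)
  also have "\<dots> = (\<Sum>c\<in>UNIV. xi c x * (\<Sum>g\<in>UNIV. chr c g * complex_of_real (y $ g))) / 3"
    by (subst sum.swap) (simp add: sum_distrib_left)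
  also have "\<dots> = 3 * (\<Sum>c\<in>UNIV. xi c x * xi (- c) y)"
  proof -
    have "(\<Sum>g\<in>UNIV. chr c g * complex_of_real (y $ g)) = 9 * xi (- c) y" for c
      by (simp add: xi_def chr_uminus)
    then show ?thesis by (simp add: sum_distrib_left sum_divide_distrib mult_ac)
  qed
  finally show ?thesis .
qed

lemma xi_axis: "xi c (axis g 1) = cnj (chr c g) / 9"
  by (simp add: xi_def axis_def if_distrib cong: if_cong)

lemma xi_independent:
  assumes "\<And>x. (\<Sum>c\<in>UNIV. k c * xi c x) = 0"
  shows "k c = 0"
proof -
  have "(\<Sum>c\<in>UNIV. k c * chr c g) = 0" for g
    using assms[of "axis (- g) 1"] by (simp add: xi_axis chr_uminus sum_divide_distrib[symmetric])
  then show ?thesis by (rule chr_independent)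
qed

section \<open>The Albert algebra in Fourier coordinates\<close>

text \<open>The last coordinate says in which of three matrices of the Tits construction a Weyl
  matrix sits. The phase is the symplectic form of the first two coordinates, with a sign for the
  order in which the slots multiply and none within one slot.\<close>

fun coc :: "grp \<Rightarrow> grp \<Rightarrow> tri" where
  "coc (j, k, l) (j', k', l') = (l' - l) * (j * k' - k * j')"

text \<open>The coboundary of \<open>pot\<close> is added to the cocycle so that the structure constants become invariant
  under the map \<open>rot\<close> of order 13.\<close>

fun pot :: "grp \<Rightarrow> tri" where
  "pot (j, k, l) = - (k * k * l + l * l * j + j * j * k)"

definition ph :: "grp \<Rightarrow> grp \<Rightarrow> tri" where
  "ph c p = coc c p + pot c + pot p - pot (c + p)"

text \<open>The value 2 is -1 + 3; the additional 3 is the square term of the matrix adjugate in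
  \<open>weyl_adj3\<close>.\<close>

definition bc :: "grp \<Rightarrow> grp \<Rightarrow> complex" where
  "bc c p = (if c = p then 2 else - om (ph c p))"

lemma pot_uminus: "pot (- c) = - pot c"
  by (cases c) (simp add: algebra_simps)

lemma pot_0 [simp]: "pot 0 = 0"
  by (simp add: zero_prod_def)

lemma coc_commute: "coc c p = coc p c"
  by (cases c; cases p) (simp add: algebra_simps)

lemma coc_cyclic: "coc p (- c - p) = coc c p"
proof -
  obtain j k l j' k' l' where cp: "c = (j, k, l)" "p = (j', k', l')" by (cases c; cases p) auto
  have "- l - l' - l' = l' - l" using tri_double[of l'] by (simp add: algebra_simps add.assoc[symmetric])
  moreover have "j' * (- k - k') - k' * (- j - j') = j * k' - k * j'" by (simp add: algebra_simps)
  ultimately show ?thesis by (simp only: cp uminus_Pair diff_Pair coc.simps)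
qed

lemma coc_uminus: "coc (- c) (- p) = - coc c p"
  by (cases c; cases p) (simp add: algebra_simps)

lemma ph_commute: "ph c p = ph p c"
  by (simp add: ph_def coc_commute[of c] add.commute)

lemma ph_cyclic: "ph p (- c - p) = ph c p"
proof -
  have "pot (p + (- c - p)) = - pot c" by (simp add: pot_uminus)
  moreover have "pot (- c - p) = - pot (c + p)" using pot_uminus[of "c + p"] by (simp add: algebra_simps)
  ultimately show ?thesis by (simp add: ph_def coc_cyclic algebra_simps)
qed

lemma ph_uminus: "ph (- c) (- p) = - ph c p"
proof -
  have "pot (- c + - p) = - pot (c + p)" using pot_uminus[of "c + p"] by (simp add: algebra_simps)
  then show ?thesis unfolding ph_def coc_uminus pot_uminus by (simp add: algebra_simps)
qed

lemma bc_commute: "bc c p = bc p c"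
  by (simp add: bc_def ph_commute)

text \<open>Together with \<open>bc_commute\<close> this makes the trilinear form symmetric in three
  characters with sum zero. In characteristic 3, two of them coincide only if all three do.\<close>

lemma bc_cyclic: "bc p (- c - p) = bc c p"
proof -
  have "p = - c - p \<longleftrightarrow> c = p"
  proof -
    have "p = - c - p \<longleftrightarrow> p + p = - c" by (simp only: eq_diff_eq)
    then show ?thesis by (auto simp: grp_double simp del: split_paired_All)
  qed
  then show ?thesis by (simp add: bc_def ph_cyclic)
qed

lemma bc_uminus: "bc (- c) (- p) = cnj (bc c p)"
  by (simp add: bc_def ph_uminus om_uminus)

lemma ph_0: "ph 0 p = 0"
  by (cases p) (simp add: ph_def zero_prod_def)

lemma ph_neg: "ph c (- c) = 0"
proof -
  have "coc c (- c) = 0" by (cases c) (simp add: algebra_simps)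
  then show ?thesis by (simp add: ph_def pot_uminus)
qed

definition conv :: "alg \<Rightarrow> alg \<Rightarrow> grp \<Rightarrow> complex" where
  "conv x y t = (\<Sum>c\<in>UNIV. bc c (t - c) * xi c x * xi (t - c) y)"

definition cross :: "alg \<Rightarrow> alg \<Rightarrow> alg" where
  "cross x y = synth (conv x y)"

lemma conv_hermitian: "hermitian (conv x y)"
  unfolding hermitian_def
proof
  fix t
  have "conv x y (- t) = (\<Sum>c\<in>UNIV. bc (- c) (- t - - c) * xi (- c) x * xi (- t - - c) y)"
    unfolding conv_def by (subst sum_uminus_reindex) simp
  also have "\<dots> = (\<Sum>c\<in>UNIV. cnj (bc c (t - c) * xi c x * xi (t - c) y))"
  proof (intro sum.cong refl)
    fix c
    have "- t - - c = - (t - c)" by simp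
    then show "bc (- c) (- t - - c) * xi (- c) x * xi (- t - - c) y = cnj (bc c (t - c) * xi c x * xi (t - c) y)"
      by (simp only: bc_uminus xi_hermitian complex_cnj_mult)
  qed
  finally show "conv x y (- t) = cnj (conv x y t)" by (simp add: conv_def)
qed

lemma xi_cross: "xi t (cross x y) = conv x y t"
  unfolding cross_def by (rule xi_synth[OF conv_hermitian])

definition unit :: alg where
  "unit = synth (\<lambda>c. if c = 0 then 1 else 0)"

lemma xi_unit: "xi c unit = (if c = 0 then 1 else 0)"
  unfolding unit_def by (rule xi_synth) (auto simp: hermitian_def simp del: split_paired_All)

lemma inner_unit: "complex_of_real (x \<bullet> unit) = 3 * xi 0 x"
proof -
  have "(\<Sum>c\<in>UNIV. xi c x * xi (- c) unit) = (\<Sum>c\<in>(UNIV::grp set). if c = 0 then xi c x else 0)"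
    by (intro sum.cong refl) (auto simp: xi_unit)
  then show ?thesis by (simp add: xi_parseval)
qed

lemma conv_commute: "conv x y t = conv y x t"
  unfolding conv_def
  by (rule sum.reindex_bij_witness[of _ "\<lambda>c. t - c" "\<lambda>c. t - c"]) (auto simp: bc_commute mult_ac)

lemma cross_inner: "complex_of_real (cross x y \<bullet> z) =
    3 * (\<Sum>c\<in>UNIV. \<Sum>p\<in>UNIV. bc c p * xi c x * xi p y * xi (- c - p) z)"
proof -
  have "complex_of_real (cross x y \<bullet> z) = 3 * (\<Sum>t\<in>UNIV. \<Sum>c\<in>UNIV. bc c (t - c) * xi c x * xi (t - c) y * xi (- t) z)"
    by (simp add: xi_parseval xi_cross conv_def sum_distrib_right)
  also have "(\<Sum>t\<in>UNIV. \<Sum>c\<in>UNIV. bc c (t - c) * xi c x * xi (t - c) y * xi (- t) z) =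
    (\<Sum>c\<in>UNIV. \<Sum>t\<in>UNIV. bc c (t - c) * xi c x * xi (t - c) y * xi (- t) z)" by (rule sum.swap)
  also have "\<dots> = (\<Sum>c\<in>UNIV. \<Sum>p\<in>UNIV. bc c p * xi c x * xi p y * xi (- c - p) z)"
  proof (rule sum.cong[OF refl])
    fix c
    show "(\<Sum>t\<in>UNIV. bc c (t - c) * xi c x * xi (t - c) y * xi (- t) z) = (\<Sum>p\<in>UNIV. bc c p * xi c x * xi p y * xi (- c - p) z)"
      by (rule sum.reindex_bij_witness[of _ "\<lambda>p. p + c" "\<lambda>t. t - c"]) (auto simp: algebra_simps)
  qed
  finally show ?thesis .
qed

lemma cross_cyclic: "cross x y \<bullet> z = x \<bullet> cross y z"
proof -
  have "(\<Sum>c\<in>UNIV. \<Sum>p\<in>UNIV. bc c p * xi c x * xi p y * xi (- c - p) z) =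
     (\<Sum>p\<in>UNIV. \<Sum>c\<in>UNIV. bc p (- c - p) * xi p y * xi (- c - p) z * xi c x)"
    by (subst sum.swap) (simp add: bc_cyclic mult_ac)
  also have "\<dots> = (\<Sum>p\<in>UNIV. \<Sum>r\<in>UNIV. bc p r * xi p y * xi r z * xi (- p - r) x)"
  proof (rule sum.cong[OF refl])
    fix p
    show "(\<Sum>c\<in>UNIV. bc p (- c - p) * xi p y * xi (- c - p) z * xi c x) = (\<Sum>r\<in>UNIV. bc p r * xi p y * xi r z * xi (- p - r) x)"
      by (rule sum.reindex_bij_witness[of _ "\<lambda>r. - p - r" "\<lambda>c. - c - p"]) (auto simp: algebra_simps)
  qed
  finally have "complex_of_real (cross x y \<bullet> z) = complex_of_real (cross y z \<bullet> x)"
    by (simp only: cross_inner)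
  then show ?thesis by (simp only: of_real_eq_iff inner_commute[of x])
qed

lemma cross_commute: "cross x y = cross y x"
  by (rule xi_inject) (simp only: xi_cross conv_commute)

lemma cross_add: "cross (x + y) z = cross x z + cross y z"
  by (rule xi_inject) (simp add: xi_cross xi_add conv_def algebra_simps sum.distrib)

lemma cross_scaleR: "cross (r *\<^sub>R x) z = r *\<^sub>R cross x z"
  by (rule xi_inject) (simp add: xi_cross xi_scaleR conv_def sum_distrib_left mult_ac)

lemma bounded_bilinear_cross: "bounded_bilinear cross"
proof -
  have "bilinear cross"
    unfolding bilinear_def
  proof (intro conjI allI)
    fix x y
    show l: "linear (\<lambda>x. cross x y)" for y by (intro linearI cross_add cross_scaleR)
    show "linear (cross x)" using l[of x] by (simp only: cross_commute[of _ x])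
  qed
  then show ?thesis by (simp add: bilinear_conv_bounded_bilinear)
qed

lemma cross_unit: "cross unit x = (x \<bullet> unit) *\<^sub>R unit - x"
proof (rule xi_inject)
  fix t
  have "conv unit x t = (\<Sum>c\<in>(UNIV::grp set). if c = 0 then bc 0 t * xi t x else 0)"
    unfolding conv_def by (intro sum.cong refl) (auto simp: xi_unit)
  then have 1: "xi t (cross unit x) = bc 0 t * xi t x" by (simp add: xi_cross)
  have 2: "xi t ((x \<bullet> unit) *\<^sub>R unit - x) = 3 * xi 0 x * xi t unit - xi t x"
    using xi_add[of t "(x \<bullet> unit) *\<^sub>R unit" "(-1) *\<^sub>R x"] by (simp only: xi_scaleR inner_unit) simp
  show "xi t (cross unit x) = xi t ((x \<bullet> unit) *\<^sub>R unit - x)"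
    unfolding 1 2 by (simp add: bc_def xi_unit ph_0)
qed

lemma unit_norm: "unit \<bullet> unit = 3"
  using inner_unit[of unit] by (simp add: xi_unit complex_eq_iff)

text \<open>The standard basis consists of all translates of one vector, so only the trivial
  character survives. There the structure constants add up to 2 - 26 = -24, and 27/81 * (-24) =
  -8.\<close>

lemma sum_cross_Basis: "(\<Sum>b\<in>Basis. cross b b) = (-8) *\<^sub>R unit"
proof (rule xi_inject)
  fix t
  have b1: "(\<Sum>u\<in>Basis. F u) = F 1" for F :: "real \<Rightarrow> real" by simp
  have B: "(Basis :: alg set) = (\<lambda>g. axis g 1) ` UNIV"
    by (auto simp: Basis_vec_def)
  have inj: "inj (\<lambda>g::grp. axis g (1::real))" by (auto intro: injI simp: axis_eq_axis simp del: split_paired_All)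
  have xs: "xi t (sum F S) = (\<Sum>b\<in>S. xi t (F b))" if "finite S" for F and S :: "'q set"
    using that by (induction S rule: finite_induct) (simp_all add: xi_add, simp add: xi_def)
  have "xi t (\<Sum>b\<in>Basis. cross b b) = (\<Sum>g\<in>UNIV. xi t (cross (axis g 1) (axis g 1)))"
    unfolding B by (subst sum.reindex[OF inj]) (simp add: xs)
  also have "\<dots> = (\<Sum>g\<in>UNIV. \<Sum>c\<in>UNIV. bc c (t - c) * cnj (chr t g) / 81)"
    unfolding xi_cross conv_def xi_axis
    by (intro sum.cong refl) (simp add: mult.assoc complex_cnj_mult[symmetric] chr_add(1)[symmetric])
  also have "\<dots> = (\<Sum>c\<in>UNIV. bc c (t - c)) * cnj (\<Sum>g\<in>UNIV. chr t g) / 81"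
    by (simp add: sum_distrib_left sum_distrib_right sum_divide_distrib) (rule sum.swap)?
  also have "\<dots> = (if t = 0 then - 8 else 0)"
  proof -
    have "(\<Sum>c\<in>UNIV. bc c (0 - c)) = (\<Sum>c\<in>(UNIV::grp set). (if c = 0 then 3 else 0) - 1)"
    proof (intro sum.cong refl)
      fix c :: grp
      have "c = - c \<longleftrightarrow> c = 0" by (simp only: eq_neg_iff_add_eq_0 grp_double neg_equal_0_iff_equal)
      then show "bc c (0 - c) = (if c = 0 then 3 else 0) - 1" by (auto simp: bc_def ph_neg)
    qed
    then have "(\<Sum>c\<in>UNIV. bc c (0 - c)) = - 24" by (simp add: sum_subtractf card_tri)
    then show ?thesis by (auto simp: chr_orthogonal)
  qed
  also have "\<dots> = xi t ((-8) *\<^sub>R unit)" by (simp only: xi_scaleR xi_unit) simp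
  finally show "xi t (\<Sum>b\<in>Basis. cross b b) = xi t ((-8) *\<^sub>R unit)" .
qed

section \<open>Matrix coordinates and the adjoint identity\<close>

text \<open>Matrices are expanded in the Weyl basis \<open>D\<^sub>j\<^sub>k\<close> with entries \<open>\<omega>\<close>\<open>^(-k (r + i))\<close> at \<open>(r, i)\<close>, \<open>r - i = j\<close>,
  which satisfies \<open>D\<^sub>u D\<^sub>v = \<omega>\<close>\<open>^[u, v]\<close>\<open> D\<^sub>u\<^sub>+\<^sub>v\<close> for the symplectic form \<open>[u, v]\<close>.\<close>

definition weyl :: "(tri \<Rightarrow> tri \<Rightarrow> complex) \<Rightarrow> tri \<Rightarrow> tri \<Rightarrow> complex" where
  "weyl a r i = (\<Sum>k\<in>UNIV. om (- (k * (r + i))) * a (r - i) k)"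

definition adj3 :: "(tri \<Rightarrow> tri \<Rightarrow> complex) \<Rightarrow> tri \<Rightarrow> tri \<Rightarrow> complex" where
  "adj3 a r i = a (i + T1) (r + T1) * a (i + T2) (r + T2) - a (i + T1) (r + T2) * a (i + T2) (r + T1)"

definition mult3 :: "(tri \<Rightarrow> tri \<Rightarrow> complex) \<Rightarrow> (tri \<Rightarrow> tri \<Rightarrow> complex) \<Rightarrow> tri \<Rightarrow> tri \<Rightarrow> complex" where
  "mult3 a b r i = (\<Sum>m\<in>UNIV. a r m * b m i)"

lemmas tri_eval = tri_sum minus_tri_def zero_tri_def one_tri_def plus_tri.simps uminus_tri.simps times_tri.simps
  om.simps mult_1

lemma sum_tri_rotate: "(\<Sum>i\<in>UNIV. \<Sum>j\<in>UNIV. \<Sum>k\<in>UNIV. f i j k) = (\<Sum>k\<in>UNIV. \<Sum>i\<in>UNIV. \<Sum>j\<in>UNIV. f i j (k::tri))"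
  for f :: "tri \<Rightarrow> tri \<Rightarrow> tri \<Rightarrow> 'a::comm_monoid_add"
  by (simp add: tri_sum ac_simps)

lemma weyl_mult:
  "mult3 (weyl a) (weyl b) r i =
   weyl (\<lambda>j k. \<Sum>j'\<in>UNIV. \<Sum>k'\<in>UNIV. om (j' * (k - k') - k' * (j - j')) * a j' k' * b (j - j') (k - k')) r i"
proof -
  have "\<forall>r i. mult3 (weyl a) (weyl b) r i =
   weyl (\<lambda>j k. \<Sum>j'\<in>UNIV. \<Sum>k'\<in>UNIV. om (j' * (k - k') - k' * (j - j')) * a j' k' * b (j - j') (k - k')) r i"
    unfolding tri_all by (intro conjI; simp only: weyl_def mult3_def tri_eval; insert omega_square; algebra)
  then show ?thesis by blast
qed

lemma weyl_adj3:
  "weyl (\<lambda>j k. 3 * (a (- j) (- k) * a (- j) (- k)) - (\<Sum>j'\<in>UNIV. \<Sum>k'\<in>UNIV. a j' k' * a (j - j') (k - k'))) r i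
   = 2 * adj3 (weyl a) r i"
proof -
  have "\<forall>r i. weyl (\<lambda>j k. 3 * (a (- j) (- k) * a (- j) (- k)) - (\<Sum>j'\<in>UNIV. \<Sum>k'\<in>UNIV. a j' k' * a (j - j') (k - k'))) r i
   = 2 * adj3 (weyl a) r i"
    unfolding tri_all by (intro conjI; simp only: weyl_def adj3_def tri_eval; insert omega_square; algebra)
  then show ?thesis by blast
qed

lemma weyl_diff: "weyl (\<lambda>j k. a j k - b j k) r i = weyl a r i - weyl b r i"
  by (simp add: weyl_def right_diff_distrib sum_subtractf)

lemma weyl_scale: "weyl (\<lambda>j k. s * a j k) r i = s * weyl a r i"
  by (simp add: weyl_def sum_distrib_left mult_ac)

text \<open>Multiplication by the phase of \<open>pot\<close> undoes the coboundary, leaving the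
  cocycle \<open>coc\<close> of the Weyl basis.\<close>

definition eta :: "grp \<Rightarrow> alg \<Rightarrow> complex" where
  "eta c x = om (pot c) * xi c x"

text \<open>The three matrices of the Tits construction. By \<open>mx_adjoint\<close> the first is
  Hermitian and the other two are adjoint to each other, which is the reality condition.\<close>

definition mx :: "tri \<Rightarrow> alg \<Rightarrow> tri \<Rightarrow> tri \<Rightarrow> complex" where
  "mx l x = weyl (\<lambda>j k. eta (j, k, l) x)"

lemma eta_square: "eta t (cross x x) = 3 * (eta (- t) x * eta (- t) x) - (\<Sum>c\<in>UNIV. om (coc c (t - c)) * eta c x * eta (t - c) x)"
proof -
  have e: "om (pot t) * bc c (t - c) * xi c x * xi (t - c) x =
      (if c = - t then 3 * (eta (- t) x * eta (- t) x) else 0) - om (coc c (t - c)) * eta c x * eta (t - c) x" for c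
  proof (cases "c = - t")
    case True
    then have tc: "t - c = c" using grp_double[of t] by (simp add: diff_conv_add_uminus)
    have "coc c c = 0" by (cases c) simp
    moreover have "om (pot t) = om (pot c) * om (pot c)"
    proof -
      have "pot c + pot c = pot t" using True tri_double[of "- pot t"] by (simp only: pot_uminus minus_minus)
      then show ?thesis by (simp only: om_add[symmetric])
    qed
    ultimately show ?thesis using True tc by (simp add: bc_def eta_def)
  next
    case False
    have "c \<noteq> t - c"
    proof
      assume "c = t - c"
      then have "c + c = t" by (simp only: eq_diff_eq)
      then show False using False by (simp only: grp_double) (simp add: minus_equation_iff[of c])
    qed
    moreover have "om (pot t) * om (ph c (t - c)) = om (coc c (t - c)) * om (pot c) * om (pot (t - c))"
      by (simp add: om_add[symmetric] ph_def add.assoc)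
    ultimately show ?thesis using False by (simp add: bc_def eta_def algebra_simps)
  qed
  have "eta t (cross x x) = (\<Sum>c\<in>UNIV. om (pot t) * bc c (t - c) * xi c x * xi (t - c) x)"
    by (simp add: eta_def xi_cross conv_def sum_distrib_left mult_ac)
  then show ?thesis unfolding e by (simp add: sum_subtractf)
qed

text \<open>Twice the Tits adjoint, which sends \<open>(a, b, c)\<close> to the adjugates of
  \<open>a\<close>, \<open>c\<close>, \<open>b\<close> minus the products \<open>b c\<close>,
  \<open>a b\<close>, \<open>c a\<close>.\<close>

lemma mx_square:
  "mx T0 (cross x x) r i = 2 * (adj3 (mx T0 x) r i - mult3 (mx T1 x) (mx T2 x) r i)"
  "mx T1 (cross x x) r i = 2 * (adj3 (mx T2 x) r i - mult3 (mx T0 x) (mx T1 x) r i)"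
  "mx T2 (cross x x) r i = 2 * (adj3 (mx T1 x) r i - mult3 (mx T2 x) (mx T0 x) r i)"
proof -
  define P where "P l l' j k = (\<Sum>j'\<in>UNIV. \<Sum>k'\<in>UNIV. om (j' * (k - k') - k' * (j - j')) * eta (j', k', l) x * eta (j - j', k - k', l') x)" for l l' j k
  define Q where "Q l j k = 3 * (eta (- j, - k, l) x * eta (- j, - k, l) x) - (\<Sum>j'\<in>UNIV. \<Sum>k'\<in>UNIV. eta (j', k', l) x * eta (j - j', k - k', l) x)" for l j k
  have P: "weyl (P l l') r i = mult3 (mx l x) (mx l' x) r i" for l l' r i
    unfolding mx_def P_def weyl_mult ..
  have Q: "weyl (Q l) r i = 2 * adj3 (mx l x) r i" for l r i
    unfolding mx_def Q_def by (rule weyl_adj3)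
  \<comment> \<open>Exchanging the two factors inverts the phase, so the slot pairs in either order
    contribute the same matrix product; this is the source of the factor 2.\<close>
  have swap: "(\<Sum>j'\<in>UNIV. \<Sum>k'\<in>UNIV. om (- (j' * (k - k') - k' * (j - j'))) * eta (j', k', l) x * eta (j - j', k - k', l') x) = P l' l j k" for l l' j k
    unfolding P_def sum.cartesian_product UNIV_Times_UNIV
    by (rule sum.reindex_bij_witness[of _ "\<lambda>(j', k'). (j - j', k - k')" "\<lambda>(j', k'). (j - j', k - k')"])
      (auto simp: algebra_simps)
  have e: "eta (j, k, l) (cross x x) = 3 * (eta (- j, - k, - l) x * eta (- j, - k, - l) x) -
      (\<Sum>l'\<in>UNIV. \<Sum>j'\<in>UNIV. \<Sum>k'\<in>UNIV. om ((l - l' - l') * (j' * (k - k') - k' * (j - j'))) * eta (j', k', l') x * eta (j - j', k - k', l - l') x)" for j k l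
    unfolding eta_square grp_sum
    by (subst (2) sum.swap, subst sum.swap) (simp add: algebra_simps)
  have t: "T1 - T0 - T0 = T1" "T1 - T1 - T1 = T2" "T1 - T2 - T2 = T0" "T0 - T0 - T0 = T0" "T0 - T1 - T1 = T1" "T0 - T2 - T2 = T2"
     "T2 - T0 - T0 = T2" "T2 - T1 - T1 = T0" "T2 - T2 - T2 = T1"
     "T1 - T0 = T1" "T1 - T1 = T0" "T1 - T2 = T2" "T0 - T0 = T0" "T0 - T1 = T2" "T0 - T2 = T1" "T2 - T0 = T2" "T2 - T1 = T1" "T2 - T2 = T0"
    by (simp_all only: minus_tri_def uminus_tri.simps plus_tri.simps)
  have "eta (j, k, T0) (cross x x) = Q T0 j k - 2 * P T1 T2 j k"
       "eta (j, k, T1) (cross x x) = Q T2 j k - 2 * P T0 T1 j k"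
       "eta (j, k, T2) (cross x x) = Q T1 j k - 2 * P T2 T0 j k" for j k
    unfolding e tri_sum[of "\<lambda>l'. \<Sum>j'\<in>UNIV. \<Sum>k'\<in>UNIV. F l' j' k'" for F] t times_tri.simps uminus_tri.simps swap
    by (simp_all add: P_def[symmetric] Q_def)
  then have m: "mx T0 (cross x x) = weyl (\<lambda>j k. Q T0 j k - 2 * P T1 T2 j k)"
     "mx T1 (cross x x) = weyl (\<lambda>j k. Q T2 j k - 2 * P T0 T1 j k)"
     "mx T2 (cross x x) = weyl (\<lambda>j k. Q T1 j k - 2 * P T2 T0 j k)"
    unfolding mx_def by simp_all
  show "mx T0 (cross x x) r i = 2 * (adj3 (mx T0 x) r i - mult3 (mx T1 x) (mx T2 x) r i)"
  "mx T1 (cross x x) r i = 2 * (adj3 (mx T2 x) r i - mult3 (mx T0 x) (mx T1 x) r i)"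
  "mx T2 (cross x x) r i = 2 * (adj3 (mx T1 x) r i - mult3 (mx T2 x) (mx T0 x) r i)"
    unfolding m weyl_diff weyl_scale P Q by (simp_all add: algebra_simps)
qed

lemma weyl_inversion:
  "3 * a j k = (\<Sum>i\<in>UNIV. om (k * (j + i + i)) * weyl a (j + i) i)"
proof -
  have "\<forall>j k. 3 * a j k = (\<Sum>i\<in>UNIV. om (k * (j + i + i)) * weyl a (j + i) i)"
    unfolding tri_all by (intro conjI; simp only: weyl_def tri_eval; (simp add: algebra_simps; fail | (insert omega_square, algebra)))
  then show ?thesis by blast
qed

lemma mx_inject:
  assumes "\<And>l r i. mx l x r i = mx l y r i" shows "x = y"
proof (rule xi_inject)
  fix c :: grp
  obtain j k l where c: "c = (j, k, l)" by (cases c) auto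
  have "3 * eta (j, k, l) x = 3 * eta (j, k, l) y"
    using weyl_inversion[of "\<lambda>j k. eta (j, k, l) x" j k] weyl_inversion[of "\<lambda>j k. eta (j, k, l) y" j k] assms[of l]
    by (simp add: mx_def)
  then show "xi c x = xi c y" by (simp add: c eta_def)
qed

lemma weyl_adjoint: "cnj (weyl a i r) = weyl (\<lambda>j k. cnj (a (- j) (- k))) r i"
proof -
  have "\<forall>r i. cnj (weyl a i r) = weyl (\<lambda>j k. cnj (a (- j) (- k))) r i"
    unfolding tri_all by (intro conjI; simp only: weyl_def tri_eval complex_cnj_add complex_cnj_mult complex_cnj_diff complex_cnj_one complex_cnj_minus complex_cnj_numeral cnj_omega; algebra)
  then show ?thesis by blast
qed

lemma mx_adjoint: "mx (- l) x r i = cnj (mx l x i r)"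
proof -
  have "eta (j, k, - l) x = cnj (eta (- j, - k, l) x)" for j k
  proof -
    have "eta (- (- j, - k, l)) x = cnj (eta (- j, - k, l) x)"
      unfolding eta_def xi_hermitian pot_uminus om_uminus by simp
    then show ?thesis by simp
  qed
  then show ?thesis by (simp add: mx_def weyl_adjoint)
qed

lemma weyl_trace: "(\<Sum>r\<in>UNIV. \<Sum>i\<in>UNIV. weyl a r i * weyl b i r) = 3 * (\<Sum>j\<in>UNIV. \<Sum>k\<in>UNIV. a j k * b (- j) (- k))"
  by (simp only: weyl_def tri_eval; insert omega_square; algebra)

lemma inner_mx: "complex_of_real (x \<bullet> y) = (\<Sum>l\<in>UNIV. \<Sum>r\<in>UNIV. \<Sum>i\<in>UNIV. mx l x r i * mx (- l) y i r)"
proof -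
  have "eta c x * eta (- c) y = xi c x * xi (- c) y" for c
    using om_cnj[of "pot c"] by (simp add: eta_def pot_uminus om_uminus)
  then have "complex_of_real (x \<bullet> y) = 3 * (\<Sum>c\<in>UNIV. eta c x * eta (- c) y)" by (simp add: xi_parseval)
  also have "\<dots> = (\<Sum>l\<in>UNIV. 3 * (\<Sum>j\<in>UNIV. \<Sum>k\<in>UNIV. eta (j, k, l) x * eta (- j, - k, - l) y))"
    unfolding grp_sum sum_tri_rotate[of "\<lambda>j k l. eta (j, k, l) x * eta (- (j, k, l)) y"] by (simp add: sum_distrib_left)
  also have "\<dots> = (\<Sum>l\<in>UNIV. \<Sum>r\<in>UNIV. \<Sum>i\<in>UNIV. mx l x r i * mx (- l) y i r)"
    unfolding mx_def weyl_trace ..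
  finally show ?thesis .
qed

section \<open>Polarisation, and the adjoint of the adjoint\<close>

lemma quartic_polarization:
  fixes \<Phi> :: "'a::real_vector \<Rightarrow> 'a \<Rightarrow> 'a \<Rightarrow> 'a \<Rightarrow> 'b::real_vector"
  assumes lin: "\<And>y z w. linear (\<lambda>x. \<Phi> x y z w)"
    and sym: "\<And>x y z w. \<Phi> x y z w = \<Phi> y x z w" "\<And>x y z w. \<Phi> x y z w = \<Phi> x z y w" "\<And>x y z w. \<Phi> x y z w = \<Phi> x y w z"
    and diag: "\<And>x. \<Phi> x x x x = 0"
  shows "\<Phi> x y z w = 0"
proof -
  have a1: "\<Phi> (x + x') y z w = \<Phi> x y z w + \<Phi> x' y z w" "\<Phi> (s *\<^sub>R x) y z w = s *\<^sub>R \<Phi> x y z w" for x x' y z w s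
    using lin by (auto simp: linear_iff)
  have a2: "\<Phi> y (x + x') z w = \<Phi> y x z w + \<Phi> y x' z w" "\<Phi> y (s *\<^sub>R x) z w = s *\<^sub>R \<Phi> y x z w" for x x' y z w s
    using a1 sym(1) by metis+
  have a3: "\<Phi> y z (x + x') w = \<Phi> y z x w + \<Phi> y z x' w" "\<Phi> y z (s *\<^sub>R x) w = s *\<^sub>R \<Phi> y z x w" for x x' y z w s
    using a2 sym(2) by metis+
  have a4: "\<Phi> y z w (x + x') = \<Phi> y z w x + \<Phi> y z w x'" "\<Phi> y z w (s *\<^sub>R x) = s *\<^sub>R \<Phi> y z w x" for x x' y z w s
    using a3 sym(3) by metis+
  have cube: "\<Phi> x x x y = 0" for x y
  proof -
    have p: "\<Phi> y x x x = \<Phi> x x x y" "\<Phi> x y x x = \<Phi> x x x y" "\<Phi> x x y x = \<Phi> x x x y"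
      "\<Phi> x y x y = \<Phi> x x y y" "\<Phi> x y y x = \<Phi> x x y y" "\<Phi> y x x y = \<Phi> x x y y" "\<Phi> y x y x = \<Phi> x x y y" "\<Phi> y y x x = \<Phi> x x y y"
      "\<Phi> x y y y = \<Phi> y y y x" "\<Phi> y x y y = \<Phi> y y y x" "\<Phi> y y x y = \<Phi> y y y x"
      using sym by metis+
    have e: "(4 * s) *\<^sub>R \<Phi> x x x y + (6 * s^2) *\<^sub>R \<Phi> x x y y + (4 * s^3) *\<^sub>R \<Phi> y y y x = 0" for s
    proof -
      have r: "(4 * u) *\<^sub>R A = u *\<^sub>R A + u *\<^sub>R A + u *\<^sub>R A + u *\<^sub>R A"
        "(6 * u) *\<^sub>R A = u *\<^sub>R A + u *\<^sub>R A + u *\<^sub>R A + u *\<^sub>R A + u *\<^sub>R A + u *\<^sub>R A" for u and A :: 'b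
        by (simp_all add: scaleR_left_distrib[symmetric])
      have "\<Phi> (x + s *\<^sub>R y) (x + s *\<^sub>R y) (x + s *\<^sub>R y) (x + s *\<^sub>R y) =
        (4 * s) *\<^sub>R \<Phi> x x x y + (6 * s^2) *\<^sub>R \<Phi> x x y y + (4 * s^3) *\<^sub>R \<Phi> y y y x"
        unfolding a1 a2 a3 a4 r
        by (simp add: diag p scaleR_right_distrib power2_eq_square power3_eq_cube mult.assoc add_ac)
      then show ?thesis using diag by metis
    qed
    \<comment> \<open>The values 1, -1 and 2 of \<open>s\<close> separate the three coefficients of
      the polynomial in \<open>s\<close>.\<close>
    have 1: "4 *\<^sub>R \<Phi> x x x y + 6 *\<^sub>R \<Phi> x x y y + 4 *\<^sub>R \<Phi> y y y x = 0" using e[of 1] by simp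
    have 2: "- (4 *\<^sub>R \<Phi> x x x y) + 6 *\<^sub>R \<Phi> x x y y - 4 *\<^sub>R \<Phi> y y y x = 0" using e[of "-1"] by simp
    have 3: "8 *\<^sub>R \<Phi> x x x y + 24 *\<^sub>R \<Phi> x x y y + 32 *\<^sub>R \<Phi> y y y x = 0" using e[of 2] by simp
    have "12 *\<^sub>R \<Phi> x x y y = (4 *\<^sub>R \<Phi> x x x y + 6 *\<^sub>R \<Phi> x x y y + 4 *\<^sub>R \<Phi> y y y x) + (- (4 *\<^sub>R \<Phi> x x x y) + 6 *\<^sub>R \<Phi> x x y y - 4 *\<^sub>R \<Phi> y y y x)"
      by (simp add: scaleR_left_distrib[of 6 6, simplified])
    then have B: "\<Phi> x x y y = 0" unfolding 1 2 by simp
    have "24 *\<^sub>R \<Phi> x x x y = 8 *\<^sub>R (4 *\<^sub>R \<Phi> x x x y + 6 *\<^sub>R \<Phi> x x y y + 4 *\<^sub>R \<Phi> y y y x) - (8 *\<^sub>R \<Phi> x x x y + 24 *\<^sub>R \<Phi> x x y y + 32 *\<^sub>R \<Phi> y y y x)"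
      unfolding B by (simp add: scaleR_right_distrib scaleR_left_diff_distrib[of 32 8, simplified])
    then show ?thesis unfolding 1 3 by simp
  qed
  have sq: "\<Phi> x x z w = 0" for x z w
  proof -
    have "\<Phi> x z x w = \<Phi> x x z w" "\<Phi> z x x w = \<Phi> x x z w" "\<Phi> z x z w = \<Phi> z z x w" "\<Phi> x z z w = \<Phi> z z x w" using sym by metis+
    note q = this
    have 1: "3 *\<^sub>R \<Phi> x x z w + 3 *\<^sub>R \<Phi> z z x w = 0"
      using cube[of "x + z" w] unfolding a1 a2 a3 by (simp add: cube q scaleR_3 add_ac)
    have 2: "- (3 *\<^sub>R \<Phi> x x z w) + 3 *\<^sub>R \<Phi> z z x w = 0"
      using cube[of "x + (-1) *\<^sub>R z" w] unfolding a1 a2 a3 by (simp add: cube q scaleR_3 algebra_simps)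
    have "6 *\<^sub>R \<Phi> x x z w = (3 *\<^sub>R \<Phi> x x z w + 3 *\<^sub>R \<Phi> z z x w) - (- (3 *\<^sub>R \<Phi> x x z w) + 3 *\<^sub>R \<Phi> z z x w)"
      by (simp add: scaleR_left_distrib[of 3 3, simplified])
    then show ?thesis unfolding 1 2 by simp
  qed
  have "\<Phi> x y z w + \<Phi> x y z w = 0 + 0"
    using sq[of "x + y" z w] unfolding a1 a2 by (simp add: sq sym(1)[of y x])
  then show ?thesis by (rule double_cancel)
qed

definition sharp3 :: "(tri \<Rightarrow> tri \<Rightarrow> complex) \<Rightarrow> (tri \<Rightarrow> tri \<Rightarrow> complex) \<Rightarrow> (tri \<Rightarrow> tri \<Rightarrow> complex) \<Rightarrow> tri \<Rightarrow> tri \<Rightarrow> complex" where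
  "sharp3 a b c r i = adj3 a r i - mult3 b c r i"

definition trace3 :: "(tri \<Rightarrow> tri \<Rightarrow> complex) \<Rightarrow> (tri \<Rightarrow> tri \<Rightarrow> complex) \<Rightarrow> complex" where
  "trace3 a b = (\<Sum>r\<in>UNIV. \<Sum>i\<in>UNIV. a r i * b i r)"

text \<open>The rule that the adjoint of the adjoint is the norm times the element. The bracket of
  traces is three times the norm, so the norm itself need not be defined.\<close>

lemma sharp3_sharp3:
  "3 * sharp3 (sharp3 a b c) (sharp3 c a b) (sharp3 b c a) r i =
     (trace3 (sharp3 a b c) a + trace3 (sharp3 c a b) c + trace3 (sharp3 b c a) b) * a r i"
proof -
  have "\<forall>r i. 3 * sharp3 (sharp3 a b c) (sharp3 c a b) (sharp3 b c a) r i =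
     (trace3 (sharp3 a b c) a + trace3 (sharp3 c a b) c + trace3 (sharp3 b c a) b) * a r i"
    unfolding tri_all by (intro conjI; simp only: sharp3_def adj3_def mult3_def trace3_def tri_eval; algebra)
  then show ?thesis by blast
qed

lemma mx_cross_square:
  "mx T0 (cross x x) = (\<lambda>r i. 2 * sharp3 (mx T0 x) (mx T1 x) (mx T2 x) r i)"
  "mx T1 (cross x x) = (\<lambda>r i. 2 * sharp3 (mx T2 x) (mx T0 x) (mx T1 x) r i)"
  "mx T2 (cross x x) = (\<lambda>r i. 2 * sharp3 (mx T1 x) (mx T2 x) (mx T0 x) r i)"
  by (auto simp: fun_eq_iff mx_square sharp3_def)

lemma sharp3_scale:
  "sharp3 (\<lambda>r i. 2 * a r i) (\<lambda>r i. 2 * b r i) (\<lambda>r i. 2 * c r i) r i = 4 * sharp3 a b c r i"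
  by (simp add: sharp3_def adj3_def mult3_def sum_distrib_left right_diff_distrib mult_ac)

lemma mx_scaleR: "mx l (s *\<^sub>R x) r i = complex_of_real s * mx l x r i"
  by (simp add: mx_def weyl_def eta_def xi_scaleR sum_distrib_left mult_ac)

lemma cross_cross_square: "cross (cross x x) (cross x x) = (4/3 * (cross x x \<bullet> x)) *\<^sub>R x"
proof (rule mx_inject)
  fix l r i
  let ?a = "mx T0 x" and ?b = "mx T1 x" and ?c = "mx T2 x"
  define N where "N = trace3 (sharp3 ?a ?b ?c) ?a + trace3 (sharp3 ?c ?a ?b) ?c + trace3 (sharp3 ?b ?c ?a) ?b"
  have "complex_of_real (cross x x \<bullet> x) = trace3 (mx T0 (cross x x)) ?a + trace3 (mx T1 (cross x x)) ?c + trace3 (mx T2 (cross x x)) ?b"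
    unfolding inner_mx trace3_def tri_sum uminus_tri.simps ..
  also have "\<dots> = 2 * N"
    unfolding mx_cross_square N_def trace3_def
    by (simp only: sum_distrib_left distrib_left mult.assoc)
  finally have N: "complex_of_real (4/3 * (cross x x \<bullet> x)) = 8/3 * N" by simp
  have rot: "N = trace3 (sharp3 ?c ?a ?b) ?c + trace3 (sharp3 ?b ?c ?a) ?b + trace3 (sharp3 ?a ?b ?c) ?a"
     "N = trace3 (sharp3 ?b ?c ?a) ?b + trace3 (sharp3 ?a ?b ?c) ?a + trace3 (sharp3 ?c ?a ?b) ?c"
    by (simp_all add: N_def)
  note s = sharp3_sharp3[of ?a ?b ?c r i, folded N_def] sharp3_sharp3[of ?b ?c ?a r i, folded rot(2)] sharp3_sharp3[of ?c ?a ?b r i, folded rot(1)]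
  show "mx l (cross (cross x x) (cross x x)) r i = mx l ((4/3 * (cross x x \<bullet> x)) *\<^sub>R x) r i"
  proof (cases l)
    case T0
    show ?thesis unfolding T0 mx_scaleR N mx_cross_square(1)[of "cross x x"]
      unfolding mx_cross_square sharp3_scale using s(1) by simp
  next
    case T1
    show ?thesis unfolding T1 mx_scaleR N mx_cross_square(2)[of "cross x x"]
      unfolding mx_cross_square sharp3_scale using s(2) by simp
  next
    case T2
    show ?thesis unfolding T2 mx_scaleR N mx_cross_square(3)[of "cross x x"]
      unfolding mx_cross_square sharp3_scale using s(3) by simp
  qed
qed

lemma cross_adjoint_identity:
  "cross (cross x y) (cross z w) + cross (cross x z) (cross y w) + cross (cross x w) (cross y z) =
    (cross x y \<bullet> z) *\<^sub>R w + (cross x y \<bullet> w) *\<^sub>R z + (cross x z \<bullet> w) *\<^sub>R y + (cross y z \<bullet> w) *\<^sub>R x"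
proof -
  define \<Phi> where "\<Phi> x y z w = cross (cross x y) (cross z w) + cross (cross x z) (cross y w) + cross (cross x w) (cross y z) -
    ((cross x y \<bullet> z) *\<^sub>R w + (cross x y \<bullet> w) *\<^sub>R z + (cross x z \<bullet> w) *\<^sub>R y + (cross y z \<bullet> w) *\<^sub>R x)" for x y z w
  have ex: "cross u v \<bullet> w = cross u w \<bullet> v" for u v w
    by (metis cross_commute cross_cyclic inner_commute)
  have "\<Phi> x y z w = 0"
  proof (rule quartic_polarization[where \<Phi>=\<Phi>])
    show "linear (\<lambda>x. \<Phi> x y z w)" for y z w
      unfolding \<Phi>_def
      by (intro linearI) (simp_all add: cross_add cross_scaleR inner_add_left scaleR_left_distrib scaleR_right_distrib scaleR_diff_right
          algebra_simps)
    show "\<Phi> x y z w = \<Phi> y x z w" for x y z w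
      by (simp add: \<Phi>_def cross_commute[of y x] cross_commute[of "cross x z"] cross_commute[of "cross x w"] add_ac)
    show "\<Phi> x y z w = \<Phi> x z y w" for x y z w
      by (simp add: \<Phi>_def cross_commute[of z y] ex[of x z y] add_ac)
    show "\<Phi> x y z w = \<Phi> x y w z" for x y z w
      by (simp add: \<Phi>_def cross_commute[of w z] ex[of x w z] ex[of y w z] add_ac)
    show "\<Phi> x x x x = 0" for x
      unfolding \<Phi>_def cross_cross_square by (simp add: scaleR_left_distrib[symmetric])
  qed
  then show ?thesis by (simp add: \<Phi>_def)
qed

interpretation albert_alg: albert cross unit
proof (intro albert.intro albert_axioms.intro)
  show "bounded_bilinear cross" by (rule bounded_bilinear_cross)
  show "DIM(alg) = 27" by (simp add: card_tri)
qed (fact cross_commute cross_cyclic cross_adjoint_identity cross_unit unit_norm sum_cross_Basis)+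

interpretation albert_index cross unit "TYPE(grp)"
  by unfold_locales (rule card_grp)

section \<open>Exact arithmetic with cubic Gauss sums\<close>

text \<open>Up to a unit, \<open>z\<close> is a cubic Gauss sum modulo 13.\<close>

lemma ex_gauss: "\<exists>z. z * z = (4 + 3 * omega) * cnj z \<and> z * cnj z = 13"
proof -
  define w where "w = 13 * (4 + 3 * omega)"
  define z where "z = rcis (root 3 (cmod w)) (Arg w / 3)"
  have z3: "z ^ 3 = w"
    unfolding z_def DeMoivre2 by (simp add: rcis_cmod_Arg)
  have n: "(4 + 3 * omega) * cnj (4 + 3 * omega) = 13"
    using omega_square by (simp add: cnj_omega) algebra
  have "w * cnj w = 169 * ((4 + 3 * omega) * cnj (4 + 3 * omega))" by (simp add: w_def algebra_simps)
  then have ww: "w * cnj w = 2197" unfolding n by simp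
  have "(z * cnj z) ^ 3 = w * cnj w" by (simp add: power_mult_distrib z3 flip: complex_cnj_power)
  moreover have "complex_of_real ((cmod z ^ 2) ^ 3) = (z * cnj z) ^ 3"
    unfolding complex_norm_square[symmetric] by simp
  ultimately have "complex_of_real ((cmod z ^ 2) ^ 3) = complex_of_real (13 ^ 3)"
    by (simp add: ww)
  then have "(cmod z ^ 2) ^ 3 = 13 ^ 3" by (simp only: of_real_eq_iff)
  then have "cmod z ^ 2 = 13" by (rule power_eq_imp_eq_base) auto
  then have 13: "z * cnj z = 13" by (simp add: complex_norm_square[symmetric])
  then have nz: "z \<noteq> 0" by auto
  have "z * (z * z) = z * ((4 + 3 * omega) * cnj z)"
  proof -
    have "z * (z * z) = (z * cnj z) * (4 + 3 * omega)" unfolding 13 using z3 by (simp add: power3_eq_cube w_def mult.assoc)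
    then show ?thesis by (simp only: mult_ac)
  qed
  then show ?thesis using nz 13 by auto
qed

definition gs :: complex where
  "gs = (SOME z. z * z = (4 + 3 * omega) * cnj z \<and> z * cnj z = 13)"

lemma gs_square: "gs * gs = (4 + 3 * omega) * cnj gs" and gs_norm: "gs * cnj gs = 13"
  using someI_ex[OF ex_gauss] by (simp_all add: gs_def)

lemma cnj_gs_square: "cnj gs * cnj gs = (1 - 3 * omega) * gs"
proof -
  have "cnj gs * cnj gs = cnj ((4 + 3 * omega) * cnj gs)" using gs_square by (simp flip: complex_cnj_mult)
  then show ?thesis by (simp add: cnj_omega algebra_simps)
qed

text \<open>\<open>zw\<close> models the Eisenstein integers, and \<open>r6\<close> the ring they
  span together with \<open>gs\<close> and \<open>cnj gs\<close>. All coordinates are integers, so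
  identities are checked by evaluation and carried to complex numbers by
  \<open>rev6\<close>.\<close>

type_synonym zw = "int \<times> int"
type_synonym r6 = "zw \<times> zw \<times> zw"

fun zadd :: "zw \<Rightarrow> zw \<Rightarrow> zw" where "zadd (a, b) (c, d) = (a + c, b + d)"
fun zmul :: "zw \<Rightarrow> zw \<Rightarrow> zw" where "zmul (a, b) (c, d) = (a * c - b * d, a * d + b * c - b * d)"
fun zev :: "zw \<Rightarrow> complex" where "zev (a, b) = of_int a + of_int b * omega"

lemma zev_add: "zev (zadd x y) = zev x + zev y"
  by (cases x; cases y) (simp add: algebra_simps)

lemma zev_mul: "zev (zmul x y) = zev x * zev y"
proof (cases x; cases y)
  fix a b c d assume "x = (a, b)" "y = (c, d)"
  moreover have "of_int a * of_int c - of_int b * of_int d + (of_int a * of_int d + of_int b * of_int c - of_int b * of_int d) * omega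
     = (of_int a + of_int b * omega) * (of_int c + of_int d * omega)"
    using omega_square by algebra
  ultimately show ?thesis by simp
qed

fun radd :: "r6 \<Rightarrow> r6 \<Rightarrow> r6" where
  "radd (x0, x1, x2) (y0, y1, y2) = (zadd x0 y0, zadd x1 y1, zadd x2 y2)"

text \<open>The constants encode \<open>gs_norm\<close>, \<open>gs_square\<close> and
  \<open>cnj_gs_square\<close>: 13, then 4 + 3 omega for the square of \<open>gs\<close>, and 1 - 3
  omega for that of its conjugate.\<close>

fun rmul :: "r6 \<Rightarrow> r6 \<Rightarrow> r6" where
  "rmul (x0, x1, x2) (y0, y1, y2) =
    (zadd (zmul x0 y0) (zmul (13, 0) (zadd (zmul x1 y2) (zmul x2 y1))),
     zadd (zadd (zmul x0 y1) (zmul x1 y0)) (zmul (1, -3) (zmul x2 y2)),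
     zadd (zadd (zmul x0 y2) (zmul x2 y0)) (zmul (4, 3) (zmul x1 y1)))"

fun rev6 :: "r6 \<Rightarrow> complex" where
  "rev6 (x0, x1, x2) = zev x0 + zev x1 * gs + zev x2 * cnj gs"

lemma rev6_add: "rev6 (radd x y) = rev6 x + rev6 y"
  by (cases x; cases y) (simp add: zev_add algebra_simps del: zev.simps zadd.simps)

lemma rev6_mul: "rev6 (rmul x y) = rev6 x * rev6 y"
proof (cases x; cases y)
  fix x0 x1 x2 y0 y1 y2 assume xy: "x = (x0, x1, x2)" "y = (y0, y1, y2)"
  have c: "zev (13, 0) = 13" "zev (1, -3) = 1 - 3 * omega" "zev (4, 3) = 4 + 3 * omega" by simp_all
  show ?thesis
    unfolding xy rmul.simps rev6.simps zev_add zev_mul c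
    using gs_square gs_norm cnj_gs_square by algebra
qed

definition rsum :: "r6 list \<Rightarrow> r6" where
  "rsum xs = foldr radd xs ((0, 0), (0, 0), (0, 0))"

lemma rev6_sum: "rev6 (rsum xs) = sum_list (map rev6 xs)"
  by (induction xs) (simp_all add: rsum_def rev6_add del: rev6.simps, simp)

section \<open>A fiducial point with a symmetry of order 13\<close>

text \<open>A linear map of order 13. Since 13 is odd, minus the identity is not among its powers,
  and the 26 nonzero vectors form the orbit of \<open>gen\<close> and its negative.\<close>

fun rot :: "grp \<Rightarrow> grp" where
  "rot (a, b, c) = (c, a + T2 * c, T2 * a + b + c)"

definition gen :: grp where "gen = (T1, T0, T0)"

definition orbit_gen :: "grp list" where
  "orbit_gen = map (\<lambda>n. (rot ^^ n) gen) [0..<13]"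

definition tris :: "tri list" where "tris = [T0, T1, T2]"

definition grps :: "grp list" where
  "grps = concat (map (\<lambda>a. concat (map (\<lambda>b. map (\<lambda>c. (a, b, c)) tris) tris)) tris)"

fun gadd :: "grp \<Rightarrow> grp \<Rightarrow> grp" where "gadd (a, b, c) (d, e, f) = (a + d, b + e, c + f)"
fun gneg :: "grp \<Rightarrow> grp" where "gneg (a, b, c) = (- a, - b, - c)"

lemma gadd: "gadd x y = x + y" and gneg: "gneg x = - x"
  by (cases x; cases y; simp)+

lemma set_grps: "set grps = UNIV"
proof -
  have "(a, b, c) \<in> set grps" for a b c
    by (cases a; cases b; cases c) (simp_all add: grps_def tris_def)
  then show ?thesis by auto
qed

lemma distinct_grps: "distinct grps"
  by (simp add: grps_def tris_def)

lemma sum_grps: "(\<Sum>c\<in>UNIV. f c) = sum_list (map f grps)"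
  using sum_list_distinct_conv_sum_set[OF distinct_grps, of f] by (simp add: set_grps)

definition orb_list :: "grp list" where
  "orb_list = [(T1, T0, T0), (T0, T1, T2), (T2, T1, T0), (T0, T2, T2), (T2, T1, T1), (T1, T1, T0), (T0, T1, T0), (T0, T0, T1),
     (T1, T2, T1), (T1, T0, T2), (T2, T2, T1), (T1, T1, T1), (T1, T0, T1)]"

lemma orb_list: "orb_list = map (\<lambda>n. (rot ^^ n) gen) [0..<13]"
  by (simp add: orb_list_def gen_def upt_rec numeral_eq_Suc)

lemma orb_list_code: "list_all (\<lambda>c. c = gadd gen (gneg gen) \<or> c \<in> set orb_list \<or> gneg c \<in> set orb_list) grps
   \<and> list_all (\<lambda>c. gneg c \<notin> set orb_list) orb_list \<and> distinct orb_list
   \<and> list_all (\<lambda>c. (rot c \<in> set orb_list) = (c \<in> set orb_list)) grps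
   \<and> list_all (\<lambda>c. (rot ^^ 13) c = c) grps"
  by code_simp

fun zom :: "tri \<Rightarrow> zw" where
  "zom T0 = (1, 0)"
| "zom T1 = (0, 1)"
| "zom T2 = (-1, -1)"

lemma zev_zom: "zev (zom t) = om t"
  by (cases t) simp_all

definition zbc :: "grp \<Rightarrow> grp \<Rightarrow> zw" where
  "zbc c p = (if c = p then (2, 0) else zmul (-1, 0) (zom (coc c p + pot c + pot p - pot (gadd c p))))"

lemma zev_zbc: "zev (zbc c p) = bc c p"
  by (simp add: zbc_def bc_def ph_def gadd zev_mul zev_zom del: zev.simps zmul.simps) simp

lemma ph_rot_code: "list_all (\<lambda>c. list_all (\<lambda>p. zbc (rot c) (rot p) = zbc c p) grps) grps"
  by code_simp

lemma bc_rot: "bc (rot c) (rot p) = bc c p"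
proof -
  have "zbc (rot c) (rot p) = zbc c p" using ph_rot_code unfolding list_all_iff set_grps by blast
  then show ?thesis by (simp flip: zev_zbc)
qed

lemma rot_add: "rot (x + y) = rot x + rot y"
  by (cases x; cases y) (simp add: algebra_simps)

lemma rot_uminus: "rot (- x) = - rot x"
  by (cases x) (simp add: algebra_simps)

lemma rot_diff: "rot (x - y) = rot x - rot y"
  using rot_add[of x "- y"] by (simp add: rot_uminus)

lemma rot_13: "(rot ^^ 13) c = c"
  using orb_list_code unfolding list_all_iff set_grps by blast

lemma bij_rot: "bij rot"
proof (rule o_bij)
  show "(rot ^^ 12) \<circ> rot = id" "rot \<circ> (rot ^^ 12) = id"
    using rot_13 by (simp_all add: fun_eq_iff numeral_eq_Suc funpow_swap1 del: split_paired_All)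
qed

definition orb :: "grp set" where "orb = set orb_list"

lemma orb_rot: "rot c \<in> orb \<longleftrightarrow> c \<in> orb"
  using orb_list_code unfolding list_all_iff set_grps orb_def by blast

lemma orb_cases: "c = 0 \<or> c \<in> orb \<or> - c \<in> orb"
  using orb_list_code unfolding list_all_iff set_grps gadd gneg orb_def by (simp only: add.right_inverse) blast

lemma orb_uminus: "c \<in> orb \<Longrightarrow> - c \<notin> orb"
  using orb_list_code unfolding list_all_iff gneg orb_def by blast

lemma zero_notin_orb: "0 \<notin> orb"
  using orb_uminus[of 0] by auto

lemma card_orb: "card orb = 13"
  using orb_list_code distinct_card[of orb_list] by (simp add: orb_def) (simp add: orb_list_def)

lemma orb_induct [consumes 1, case_names gen rot]:
  assumes "c \<in> orb" "P gen" "\<And>c. c \<in> orb \<Longrightarrow> P c \<Longrightarrow> P (rot c)"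
  shows "P c"
proof -
  have g: "gen \<in> orb" by (simp add: orb_def orb_list_def gen_def)
  have "P ((rot ^^ n) gen) \<and> (rot ^^ n) gen \<in> orb" for n
    by (induction n) (use assms(2,3) g orb_rot in auto)
  moreover obtain n where "c = (rot ^^ n) gen"
    using assms(1) by (auto simp: orb_def orb_list)
  ultimately show ?thesis by blast
qed

definition rfid :: "grp \<Rightarrow> r6" where
  "rfid c = (if c = (T0, T0, T0) then ((13, 0), (0, 0), (0, 0))
     else if c \<in> set orb_list then ((0, 0), (1, 0), (0, 0)) else ((0, 0), (0, 0), (1, 0)))"

definition fid :: "grp \<Rightarrow> complex" where
  "fid c = (if c = 0 then 13 else if c \<in> orb then gs else cnj gs)"

lemma rev6_rfid: "rev6 (rfid c) = fid c"
  by (simp add: rfid_def fid_def zero_prod_def zero_tri_def orb_def)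

lemma fid_hermitian: "fid (- c) = cnj (fid c)"
  using orb_uminus[of c] orb_uminus[of "- c"] orb_cases[of c] zero_notin_orb by (auto simp: fid_def)

lemma fid_rot: "fid (rot c) = fid c"
proof -
  have "rot c = 0 \<longleftrightarrow> c = 0" using bij_rot by (metis bij_pointE diff_self rot_diff)
  then show ?thesis by (simp add: fid_def orb_rot)
qed

lemma fid_norm: "fid c * cnj (fid c) = (if c = 0 then 169 else 13)"
  by (simp add: fid_def gs_norm mult.commute[of "cnj gs"])

definition rbc :: "grp \<Rightarrow> grp \<Rightarrow> r6" where
  "rbc c p = (zbc c p, (0, 0), (0, 0))"

lemma rev6_rbc: "rev6 (rbc c p) = bc c p"
  by (simp add: rbc_def zev_zbc del: zev.simps) simp

text \<open>The finite computation behind the existence of the simplex: all 27 Fourier coefficients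
  of the cross square of the fiducial vector vanish.\<close>

lemma fid_code: "list_all (\<lambda>t. rsum (map (\<lambda>c. rmul (rbc c (gadd t (gneg c))) (rmul (rfid c) (rfid (gadd t (gneg c))))) grps)
    = ((0, 0), (0, 0), (0, 0))) grps"
  by code_simp

lemma fid_conv: "(\<Sum>c\<in>UNIV. bc c (t - c) * fid c * fid (t - c)) = 0"
proof -
  have "(\<Sum>c\<in>UNIV. bc c (t - c) * fid c * fid (t - c)) =
    rev6 (rsum (map (\<lambda>c. rmul (rbc c (gadd t (gneg c))) (rmul (rfid c) (rfid (gadd t (gneg c))))) grps))"
    unfolding sum_grps rev6_sum map_map o_def rev6_mul rev6_rbc rev6_rfid gadd gneg by (simp add: mult.assoc)
  also have "\<dots> = rev6 ((0, 0), (0, 0), (0, 0))"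
    using bspec[OF fid_code[unfolded list_all_iff set_grps] UNIV_I, of t] by (simp only:)
  finally show ?thesis by simp
qed

text \<open>Multiplying coefficients by a character is a translation. Division by 39 makes the
  trivial coefficient 1/3, hence the trace 1; the others get squared modulus 13 / 39^2 =
  1/117.\<close>

definition pt :: "grp \<Rightarrow> alg" where
  "pt g = synth (\<lambda>c. chr c g * fid c / 39)"

lemma xi_pt: "xi c (pt g) = chr c g * fid c / 39"
  unfolding pt_def by (rule xi_synth) (auto simp: hermitian_def fid_hermitian chr_uminus simp del: split_paired_All)

definition config :: "alg ^ grp" where "config = (\<chi> g. pt g)"

lemma tight_config: "tight config"
proof -
  have "cross (pt g) (pt g) = 0" for g
  proof (rule xi_inject)
    fix t
    have "conv (pt g) (pt g) t = (\<Sum>c\<in>UNIV. bc c (t - c) * fid c * fid (t - c)) * (chr t g / 1521)"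
      unfolding conv_def xi_pt sum_distrib_right
    proof (intro sum.cong refl)
      fix c
      have "chr c g * chr (t - c) g = chr t g" by (simp flip: chr_add(1))
      then show "bc c (t - c) * (chr c g * fid c / 39) * (chr (t - c) g * fid (t - c) / 39) = bc c (t - c) * fid c * fid (t - c) * (chr t g / 1521)"
        by (simp add: field_simps)
    qed
    then show "xi t (cross (pt g) (pt g)) = xi t 0" by (simp add: xi_cross fid_conv) (simp add: xi_def)
  qed
  moreover have "pt g \<bullet> unit = 1" for g
    using inner_unit[of "pt g"] by (simp add: xi_pt fid_def complex_eq_iff)
  moreover have "pt g \<bullet> pt h = 4/13" if "g \<noteq> h" for g h
  proof -
    \<comment> \<open>The power spectrum is flat except for 1/9 = 1/117 + 12/117 at the trivial
      character. For distinct translates only the excess survives: 3 * 12/117 = 4/13.\<close>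
    have e: "xi c (pt g) * xi (- c) (pt h) = (1/117) * chr c (g - h) + (if c = 0 then 12/117 else 0)" for c
    proof -
      have "xi c (pt g) * xi (- c) (pt h) = (chr c g * cnj (chr c h)) * (fid c * cnj (fid c)) / 1521"
        by (simp add: xi_pt chr_uminus fid_hermitian)
      then show ?thesis by (cases "c = 0") (simp_all add: fid_norm chr_diff(2))
    qed
    have "complex_of_real (pt g \<bullet> pt h) = 3 * ((1/117) * (\<Sum>c\<in>UNIV. chr c (g - h)) + 12/117)"
      unfolding xi_parseval e by (simp add: sum.distrib sum_distrib_left)
    also have "\<dots> = complex_of_real (4/13)" using that by (simp add: chr_orthogonal')
    finally show ?thesis by (simp only: of_real_eq_iff)
  qed
  ultimately show ?thesis by (simp add: tight_def albert_alg.plane_def config_def)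
qed

section \<open>The homogeneous linear systems\<close>

text \<open>The mirror map sending \<open>q\<close> to \<open>- q - d\<close> has \<open>d\<close>
  as its only fixed point, where a skew solution vanishes; so 13 entries are independent.\<close>

definition skew_at :: "grp \<Rightarrow> (grp \<Rightarrow> complex) \<Rightarrow> bool" where
  "skew_at d a \<longleftrightarrow> (\<forall>q. a (- q - d) = - a q)"

text \<open>The equations for an operator to be an infinitesimal deformation of the configuration, or a derivation,
  decouple in Fourier coordinates: they only relate the entries \<open>a q = m (q + d) q\<close> of its matrix \<open>m\<close>
  with the same shift \<open>d\<close>.\<close>

definition inf_at :: "grp \<Rightarrow> (grp \<Rightarrow> complex) \<Rightarrow> bool" where
  "inf_at d a \<longleftrightarrow> skew_at d a \<and> (\<forall>t. (\<Sum>s\<in>UNIV. bc (t - d - s) (s + d) * fid (t - d - s) * fid s * a s) = 0)"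

definition der_at :: "grp \<Rightarrow> (grp \<Rightarrow> complex) \<Rightarrow> bool" where
  "der_at d a \<longleftrightarrow> skew_at d a \<and>
     (\<forall>c p. bc (c + d) p * a c + bc c (p + d) * a p + bc c p * a (- c - p - d) = 0)"

definition rcoef :: "grp \<Rightarrow> grp \<Rightarrow> grp \<Rightarrow> r6" where
  "rcoef d t s = (let c = gadd (gadd t (gneg d)) (gneg s) in rmul (rbc c (gadd s d)) (rmul (rfid c) (rfid s)))"

text \<open>Skewness folds the two unknowns of a mirror pair into one, whose coefficient is the
  difference of theirs.\<close>

definition rrow :: "grp \<Rightarrow> grp \<Rightarrow> grp \<Rightarrow> r6" where
  "rrow d t q = radd (rcoef d t q) (rmul ((-1, 0), (0, 0), (0, 0)) (rcoef d t (gneg (gadd q d))))"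

text \<open>The rows of \<open>ivs\<close>, each paired with a denominator, invert the square block of the system formed by the
  equations \<open>rws\<close> and the unknowns \<open>piv\<close>; so the remaining unknowns determine a solution.\<close>

definition check_inverse :: "grp \<Rightarrow> grp list \<Rightarrow> grp list \<Rightarrow> (int \<times> r6 list) list \<Rightarrow> bool" where
  "check_inverse d rws piv ivs \<longleftrightarrow> (let cols = map (\<lambda>q. map (\<lambda>t. rrow d t q) rws) piv in
     list_all (\<lambda>(i, m, cs). m \<noteq> 0 \<and> list_all (\<lambda>(j, col). rsum (map2 rmul cs col) = (if i = j then ((m, 0), (0, 0), (0, 0)) else ((0, 0), (0, 0), (0, 0))))
       (zip [0..<length cols] cols)) (zip [0..<length ivs] ivs))"

text \<open>The 13 mirror pairs are represented by 9 pivots and 4 free unknowns, chosen with 9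
  equations whose block in the pivots is invertible.\<close>

definition gen_piv :: "grp list" where
  "gen_piv = [(T0, T0, T0), (T0, T0, T2), (T0, T1, T1), (T0, T2, T0), (T0, T2, T2), (T1, T0, T1), (T1, T1, T0), (T1, T1, T1), (T1, T1, T2)]"

definition gen_free :: "grp list" where
  "gen_free = [(T0, T0, T1), (T0, T1, T0), (T0, T1, T2), (T0, T2, T1)]"

definition gen_rows :: "grp list" where
  "gen_rows = [(T0, T1, T0), (T0, T2, T0), (T1, T0, T0), (T1, T0, T2), (T1, T2, T1), (T2, T0, T1), (T2, T0, T2), (T2, T1, T2), (T2, T2, T2)]"

text \<open>The inverse of the 9 by 9 block, each row multiplied by an integer clearing its
  denominators. It is a certificate: \<open>gen_check\<close> multiplies it out.\<close>

definition gen_inv :: "(int \<times> r6 list) list" where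
  "gen_inv = [
   (156, [((0,0),(0,0),(0,0)), ((0,0),(0,0),(0,0)), ((-1,0),(0,0),(0,0)), ((0,0),(0,0),(0,0)), ((0,0),(0,0),(0,0)), ((0,0),(0,0),(0,0)), ((0,0),(0,0),(0,0)), ((0,0),(0,0),(0,0)), ((0,0),(0,0),(0,0))]),
   (6465420, [((2416,-152992),(-15716,-59392),(49864,155840)), ((159716,-195112),(-30680,99828),(-18360,-41900)), ((-818066,-27256),(79084,166040),(83752,-51103)), ((-199164,-641436),(-90932,-2308),(90692,152716)), ((-207888,-34652),(-6880,158600),(220048,188448)), ((-62904,104324),(227172,94412),(-110544,-134284)), ((-500360,-26116),(113280,71784),(-44524,-85508)), ((94032,582464),(164608,64864),(109460,-15396)), ((-365024,-257284),(-27808,71704),(-2376,12492))]),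
   (6465420, [((156156,-445848),(-84744,-18636),(-103188,10404)), ((162944,-127184),(-126584,656),(139692,79332)), ((-1016615,-751564),(315592,212372),(222256,-123016)), ((274984,-793644),(-134780,145392),(83176,207768)), ((-1119384,-1326128),(-117872,48180),(297224,113840)), ((-131244,680592),(135120,92820),(-95664,-366240)), ((-385228,-99056),(274780,129824),(61752,-170496)), ((-1130824,-254928),(90592,-33284),(-140832,-196864)), ((18732,-128236),(10100,8652),(200992,52972))]),
   (6465420, [((-550992,-243672),(131496,12852),(85032,20136)), ((181636,379964),(97436,82540),(-83460,-172356)), ((1013022,910386),(-179664,-293199),(-167829,112320)), ((-640692,264940),(260292,-17984),(-103284,-174296)), ((638872,1123096),(116936,-153444),(-157584,-148420)), ((639340,-608556),(-107988,-23192),(-85732,150236)), ((624884,216788),(-149020,-130576),(-87256,141224)), ((728884,189072),(-224028,-192548),(104012,150560)), ((204932,304408),(57872,26140),(-111280,-49292))]),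
   (84050460, [((-4252612,-4980404),(351260,1788904),(367328,545584)), ((-5165368,-1646580),(777348,710216),(1294384,-1301612)), ((2000089,7837115),(251962,-3840565),(-4082741,-3978091)), ((-10605036,-5580536),(3255356,3552536),(1927744,-1315392)), ((-11927500,4506684),(2240212,493636),(-2091492,-3803176)), ((11967020,9390940),(-1910532,-2062476),(-3081572,-312676)), ((5686928,4281888),(-419120,-2978456),(-2789904,-2006992)), ((3522012,9006868),(-1169480,-1271244),(-2997592,720044)), ((-2172456,-2019836),(-304512,-1202864),(-147264,-1772732))]),
   (84050460, [((764036,1460368),(464048,131404),(-587392,-1984424)), ((1168024,4661332),(376272,-1576276),(-84448,299832)), ((11331034,-1837303),(-1386662,-1104481),(783328,2697617)), ((5228236,10456888),(355836,-1177852),(-2253004,-1953120)), ((8937500,420836),(-624052,-2867800),(-2079688,-573508)), ((-2727712,-5916196),(-2350348,-33592),(2032472,1894724)), ((6128980,-1234792),(-1186692,47268),(1931540,2217124)), ((-2824588,-10709088),(-1922128,-642876),(60476,178620)), ((5878288,2937168),(661336,-212628),(323752,559416))]),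
   (6465420, [((-323128,-101192),(-105328,-45308),(228020,82660)), ((-580164,-545272),(220508,145152),(-22472,-23816)), ((711162,1367622),(115116,-130023),(-177780,-222447)), ((-1005316,-72332),(105976,104864),(273720,30924)), ((-101296,363740),(313176,175024),(-42872,-289092)), ((225680,103168),(-9120,-307836),(-151388,158360)), ((539604,932672),(-21840,-169624),(-120780,-27496)), ((1102192,698620),(-98256,-137824),(-152320,-174012)), ((-119028,44564),(159340,91612),(-57388,-41988))]),
   (6465420, [((234104,-463580),(144464,133300),(-183064,-26216)), ((200148,521612),(-237396,-74596),(157236,7076)), ((-755982,-507372),(105666,119853),(2937,49182)), ((373360,-606996),(45384,158704),(-126640,-51928)), ((-461136,-254592),(14504,-14000),(144208,240440)), ((667056,768352),(-21456,167620),(-1740,-276920)), ((-236756,-158860),(90808,126560),(-68960,-107836)), ((-566644,-174200),(179664,-19020),(109192,166436)), ((-116272,14352),(-68472,4100),(24220,17212))]),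
   (6465420, [((605644,-177424),(-136568,41984),(-73232,-7900)), ((-513760,-451516),(-176952,-48824),(255064,218244)), ((-1201518,-301569),(411498,307896),(59298,-299400)), ((152412,-944268),(-197348,237344),(261416,197500)), ((-1344980,-1444976),(166536,325520),(269972,99768)), ((13936,1432184),(81096,-120708),(-52660,-294584)), ((-369928,461240),(236408,113300),(-39856,-306028)), ((-480688,191672),(272280,57808),(-180296,-213396)), ((-344448,-341276),(18260,51152),(96532,39252))])]"

text \<open>The same data for the shift 0, the other representative of the blocks under rotation and
  conjugation.\<close>

definition inv_piv :: "grp list" where
  "inv_piv = [(T0, T0, T1), (T0, T1, T0), (T1, T0, T0), (T1, T0, T1), (T1, T0, T2), (T1, T1, T0), (T1, T1, T1), (T1, T2, T1), (T1, T2, T2)]"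

definition inv_free :: "grp list" where
  "inv_free = [(T0, T1, T1), (T0, T1, T2), (T1, T1, T2), (T1, T2, T0)]"

definition inv_rows :: "grp list" where
  "inv_rows = [(T0, T0, T2), (T0, T1, T1), (T1, T1, T2), (T1, T2, T0), (T2, T0, T1), (T2, T0, T2), (T2, T1, T2), (T2, T2, T0), (T2, T2, T2)]"

definition inv_inv :: "(int \<times> r6 list) list" where
  "inv_inv = [
   (27378, [((-98,-93),(87,-50),(47,26)), ((-196,-186),(-53,-206),(42,182)), ((-445,300),(44,-120),(56,123)), ((106,151),(7,88),(-89,-20)), ((-424,-201),(75,92),(43,-2)), ((-131,-277),(75,0),(5,-83)), ((342,289),(-88,8),(-71,-132)), ((459,-36),(-17,14),(-88,-5)), ((153,-181),(104,174),(1,-71))]),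
   (136890, [((1918,-1207),(348,-441),(539,-542)), ((2003,-2583),(65,498),(77,-720)), ((2746,4380),(408,1672),(-1189,-352)), ((-2030,1175),(60,-165),(245,670)), ((-564,1553),(112,-5),(-343,102)), ((2250,-581),(-128,-891),(278,-748)), ((-1889,-2642),(-363,-955),(212,72)), ((-1655,1323),(99,898),(296,824)), ((-1375,454),(-133,-611),(173,442))]),
   (136890, [((1243,2853),(-167,174),(-311,243)), ((-1752,-443),(425,68),(487,450)), ((-1564,-2720),(-387,-588),(616,128)), ((-305,-1675),(175,-100),(115,245)), ((791,-177),(-203,-620),(-93,137)), ((315,1039),(262,594),(-457,197)), ((391,498),(162,460),(422,257)), ((-1000,-1647),(144,-52),(-509,-776)), ((945,-536),(57,64),(-342,-233))]),
   (136890, [((771,-829),(-94,33),(118,-104)), ((3856,929),(185,901),(-516,-1110)), ((3547,655),(296,1059),(-663,-739)), ((-1615,495),(-280,-315),(380,600)), ((-183,451),(114,295),(-246,-86)), ((320,188),(-46,-682),(311,-181)), ((-2983,-1584),(9,-430),(34,454)), ((215,1146),(-377,-374),(657,593)), ((-1120,1123),(-41,-487),(591,429))]),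
   (136890, [((-2221,619),(-306,462),(-563,-31)), ((199,2941),(-185,-56),(-419,205)), ((168,-2045),(-41,-834),(653,-286)), ((655,-825),(220,-360),(55,-435)), ((123,-1341),(346,-310),(491,151)), ((-1985,1212),(-99,862),(-346,341)), ((1388,1834),(341,550),(-34,166)), ((595,-1286),(-8,-566),(-92,-443)), ((-560,-1343),(-34,252),(-231,26))]),
   (136890, [((309,-51),(219,132),(-3,69)), ((2464,431),(-365,44),(31,-130)), ((-512,500),(19,26),(-392,-406)), ((675,165),(45,-30),(15,165)), ((-477,-621),(321,600),(111,-249)), ((-565,457),(26,-98),(149,121)), ((-67,304),(206,-80),(-4,181)), ((-80,239),(-278,-616),(-47,152)), ((-1045,-488),(41,22),(284,-29))]),
   (136890, [((1487,-1423),(62,-829),(641,-28)), ((-2343,53),(80,-858),(388,-200)), ((-2596,1680),(-243,623),(469,1417)), ((565,375),(570,835),(-475,-190)), ((1029,697),(-632,-45),(-397,308)), ((855,-3249),(-17,-604),(512,-107)), ((-196,-1928),(-102,165),(-227,-712)), ((-625,2427),(761,807),(-541,21)), ((1590,-504),(223,-94),(-298,13))]),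
   (136890, [((-264,1791),(156,573),(-552,6)), ((226,-331),(160,701),(-101,20)), ((587,-3125),(11,-296),(-103,-674)), ((250,545),(-410,-445),(130,-250)), ((1262,121),(-136,-245),(14,-296)), ((-125,2048),(79,503),(-119,494)), ((-228,336),(444,-180),(279,564)), ((-995,-964),(-197,-379),(232,-352)), ((-245,983),(-341,-232),(256,164))]),
   (136890, [((1583,118),(68,-146),(-166,-167)), ((1918,67),(100,268),(-383,-980)), ((151,-930),(283,1062),(-194,243)), ((-1275,2180),(-170,-140),(-70,345)), ((1031,-322),(-288,130),(112,327)), ((410,-856),(-133,-316),(398,-118)), ((-2459,-1737),(-328,-430),(147,187)), ((505,2813),(59,-212),(-39,-141)), ((-460,-631),(-293,-216),(573,412))])]"

lemma gen_check: "check_inverse gen gen_rows gen_piv gen_inv"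
  by code_simp

lemma inv_check: "check_inverse (T0, T0, T0) inv_rows inv_piv inv_inv"
  by code_simp

lemma skew_sum:
  assumes skew: "skew_at d a" and free: "\<And>q. q \<in> set free \<Longrightarrow> a q = 0" and f: "- f - d = f"
    and L: "L = f # piv @ map (\<lambda>q. - q - d) piv @ free @ map (\<lambda>q. - q - d) free" "distinct L" "set L = UNIV"
  shows "(\<Sum>s\<in>UNIV. F s * a s) = (\<Sum>q\<leftarrow>piv. (F q - F (- q - d)) * a q)"
proof -
  have m: "a (- q - d) = - a q" for q using skew unfolding skew_at_def by blast
  have "a f = 0" using m[of f] f by simp
  have z: "sum_list (map g xs) = 0" if "\<And>x. x \<in> set xs \<Longrightarrow> g x = 0" for g :: "grp \<Rightarrow> complex" and xs
    using that by (induction xs) auto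
  have "(\<Sum>s\<in>UNIV. F s * a s) = sum_list (map (\<lambda>s. F s * a s) L)"
    using sum_list_distinct_conv_sum_set[OF L(2), of "\<lambda>s. F s * a s"] L(3) by simp
  also have "\<dots> = (\<Sum>q\<leftarrow>piv. F q * a q) + (\<Sum>q\<leftarrow>piv. F (- q - d) * - a q)"
    using free \<open>a f = 0\<close> by (simp add: L(1) o_def m z)
  also have "\<dots> = (\<Sum>q\<leftarrow>piv. (F q - F (- q - d)) * a q)"
    by (simp add: sum_list_addf[symmetric] algebra_simps)
  finally show ?thesis .
qed

lemma rev6_rcoef: "rev6 (rcoef d t s) = bc (t - d - s) (s + d) * fid (t - d - s) * fid s"
  by (simp only: rcoef_def Let_def rev6_mul rev6_rbc rev6_rfid gadd gneg mult.assoc diff_conv_add_uminus)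

lemma rev6_rrow: "rev6 (rrow d t q) = rev6 (rcoef d t q) - rev6 (rcoef d t (- q - d))"
proof -
  have "gneg (gadd q d) = - q - d" by (simp only: gadd gneg minus_add_distrib diff_conv_add_uminus)
  then show ?thesis by (simp only: rrow_def rev6_add rev6_mul) simp
qed

lemma inf_at_eq_0:
  assumes a: "inf_at d a" and free: "\<And>q. q \<in> set free \<Longrightarrow> a q = 0" and f: "- f - d = f"
    and L: "L = f # piv @ map (\<lambda>q. - q - d) piv @ free @ map (\<lambda>q. - q - d) free" "distinct L" "set L = UNIV"
    and chk: "check_inverse d rws piv ivs" "length ivs = length piv"
  shows "a c = 0"
proof -
  have skew: "skew_at d a" using a by (simp add: inf_at_def)
  have row: "(\<Sum>j<length piv. rev6 (rrow d t (piv ! j)) * a (piv ! j)) = 0" for t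
  proof -
    have "(\<Sum>s\<in>UNIV. rev6 (rcoef d t s) * a s) = 0"
      using a unfolding inf_at_def rev6_rcoef by blast
    then have "(\<Sum>q\<leftarrow>piv. (rev6 (rcoef d t q) - rev6 (rcoef d t (- q - d))) * a q) = 0"
      using skew_sum[OF skew free f L, of "\<lambda>s. rev6 (rcoef d t s)"] by simp
    then show ?thesis
      by (simp add: rev6_rrow sum_list_sum_nth atLeast0LessThan)
  qed
  have "a (piv ! i) = 0" if i: "i < length piv" for i
  proof -
    obtain m cs where mc: "ivs ! i = (m, cs)" by (cases "ivs ! i")
    define cols where "cols = map (\<lambda>q. map (\<lambda>t. rrow d t q) rws) piv"
    have "(i, m, cs) \<in> set (zip [0..<length ivs] ivs)"
      using i chk(2) mc by (auto simp: set_zip intro!: exI[of _ i])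
    then have m: "m \<noteq> 0" and c: "\<And>j col. (j, col) \<in> set (zip [0..<length cols] cols) \<Longrightarrow>
        rsum (map2 rmul cs col) = (if i = j then ((m, 0), (0, 0), (0, 0)) else ((0, 0), (0, 0), (0, 0)))"
      using chk(1) unfolding check_inverse_def Let_def list_all_iff cols_def by fastforce+
    \<comment> \<open>\<open>map2\<close> stops at the end of the shorter list.\<close>
    define n where "n = min (length cs) (length rws)"
    have prod: "(\<Sum>k<n. rev6 (cs ! k) * rev6 (rrow d (rws ! k) (piv ! j))) = (if i = j then of_int m else 0)"
      if j: "j < length piv" for j
    proof -
      have "(j, cols ! j) \<in> set (zip [0..<length cols] cols)"
        using j by (auto simp: set_zip cols_def intro!: exI[of _ j])
      from c[OF this] have "rev6 (rsum (map2 rmul cs (cols ! j))) = (if i = j then of_int m else 0)" by simp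
      moreover have "rev6 (rsum (map2 rmul cs (cols ! j))) = (\<Sum>k<n. rev6 (cs ! k) * rev6 (rrow d (rws ! k) (piv ! j)))"
        using j by (simp add: rev6_sum sum_list_sum_nth n_def cols_def rev6_mul atLeast0LessThan del: rev6.simps)
      ultimately show ?thesis by simp
    qed
    have "0 = (\<Sum>k<n. rev6 (cs ! k) * (\<Sum>j<length piv. rev6 (rrow d (rws ! k) (piv ! j)) * a (piv ! j)))"
      by (simp add: row)
    also have "\<dots> = (\<Sum>j<length piv. (\<Sum>k<n. rev6 (cs ! k) * rev6 (rrow d (rws ! k) (piv ! j))) * a (piv ! j))"
      unfolding sum_distrib_left sum_distrib_right by (subst sum.swap) (simp add: mult.assoc)
    also have "\<dots> = (\<Sum>j<length piv. if i = j then of_int m * a (piv ! j) else 0)"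
      by (intro sum.cong refl) (auto simp: prod)
    also have "\<dots> = of_int m * a (piv ! i)" using i by simp
    finally show ?thesis using m by simp
  qed
  then have piv: "a q = 0" if "q \<in> set piv" for q using that by (metis in_set_conv_nth)
  have mir: "a (- q - d) = - a q" for q using skew unfolding skew_at_def by blast
  have f0: "a f = 0" using mir[of f] f by simp
  have m0: "a (- q - d) = 0" if "q \<in> set piv \<or> q \<in> set free" for q
    using that piv[of q] free[of q] mir[of q] by auto
  have "c \<in> set L" using L(3) by blast
  then have "c = f \<or> c \<in> set piv \<or> (\<exists>q\<in>set piv. c = - q - d) \<or> c \<in> set free \<or> (\<exists>q\<in>set free. c = - q - d)"
    unfolding L(1) set_append set_map list.set by blast
  then show ?thesis using f0 m0 piv free by blast
qed

text \<open>The fixed point, the pivots, the free unknowns and the mirrors exhaust the group without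
  repetition: 27 = 1 + 2 * (9 + 4).\<close>

lemma lists_code:
  "distinct (gen # gen_piv @ map (\<lambda>q. gneg (gadd q gen)) gen_piv @ gen_free @ map (\<lambda>q. gneg (gadd q gen)) gen_free) \<and>
   distinct ((T0, T0, T0) # inv_piv @ map (\<lambda>q. gneg (gadd q (T0, T0, T0))) inv_piv @ inv_free @ map (\<lambda>q. gneg (gadd q (T0, T0, T0))) inv_free) \<and>
   list_all (\<lambda>c. c \<in> set (gen # gen_piv @ map (\<lambda>q. gneg (gadd q gen)) gen_piv @ gen_free @ map (\<lambda>q. gneg (gadd q gen)) gen_free)) grps \<and>
   list_all (\<lambda>c. c \<in> set ((T0, T0, T0) # inv_piv @ map (\<lambda>q. gneg (gadd q (T0, T0, T0))) inv_piv @ inv_free @ map (\<lambda>q. gneg (gadd q (T0, T0, T0))) inv_free)) grps \<and>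
   length gen_inv = length gen_piv \<and> length inv_inv = length inv_piv"
  by code_simp

lemma gneg_gadd: "gneg (gadd q d) = - q - d"
  by (simp only: gadd gneg minus_add_distrib diff_conv_add_uminus)

lemma zero_grp: "(T0, T0, T0) = (0::grp)"
  by (simp add: zero_prod_def zero_tri_def)

lemmas lists_facts = lists_code[unfolded list_all_iff set_grps gneg_gadd zero_grp]

lemma inf_at_gen:
  assumes "inf_at gen a" "\<And>q. q \<in> set gen_free \<Longrightarrow> a q = 0" shows "a c = 0"
proof (rule inf_at_eq_0[OF assms _ refl _ _ gen_check])
  show "- gen - gen = gen" by (simp add: gen_def minus_tri_def zero_tri_def zero_prod_def)
qed (use lists_facts in blast)+

lemma inf_at_0:
  assumes "inf_at 0 a" "\<And>q. q \<in> set inv_free \<Longrightarrow> a q = 0" shows "a c = 0"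
proof (rule inf_at_eq_0[OF assms _ refl _ _ inv_check[unfolded zero_grp]])
  show "- (0::grp) - 0 = 0" by simp
qed (use lists_facts in blast)+

text \<open>At \<open>p = c\<close> all three terms are \<open>bc c c = 2\<close> times the same
  unknown, as \<open>- c - c = c\<close> in characteristic 3. So the trivial shift carries no
  derivations.\<close>

lemma der_at_0:
  assumes "der_at 0 a" shows "a c = 0"
proof -
  have "bc (c + 0) c * a c + bc c (c + 0) * a c + bc c c * a (- c - c - 0) = 0"
    using assms unfolding der_at_def by blast
  moreover have "- c - c = c" using grp_double[of c] by (metis add_uminus_conv_diff minus_add_distrib minus_minus)
  ultimately show ?thesis by (simp add: bc_def)
qed

lemma omega_nz: "omega \<noteq> 0" "- 1 - omega \<noteq> 0" "1 + omega \<noteq> 0"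
  using om_nz[of T1] om_nz[of T2] by (auto simp: add_eq_0_iff)

text \<open>The two given zeros propagate: each equation is chosen so that, after mirroring, a
  single unknown with nonzero coefficient is left.\<close>

lemma der_at_gen:
  assumes d: "der_at gen a" and free: "a (T0, T0, T1) = 0" "a (T0, T1, T0) = 0"
  shows "a c = 0"
proof -
  have eq: "bc (c + gen) p * a c + bc c (p + gen) * a p + bc c p * a (- c - p - gen) = 0" for c p
    using d unfolding der_at_def by blast
  have mir: "a (- q - gen) = - a q" for q using d unfolding der_at_def skew_at_def by blast
  note ev = omega_nz bc_def ph_def gen_def minus_tri_def zero_tri_def zero_prod_def
  have g: "a gen = 0" using mir[of gen] by (simp add: ev)
  have 1: "a (T0, T0, T0) = 0" using eq[of "(T0, T0, T0)" "(T0, T0, T0)"] mir[of "(T0, T0, T0)"] by (simp add: ev)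
  have 2: "a (T0, T0, T2) = 0" using eq[of "(T0, T0, T1)" "(T0, T0, T1)"] mir[of "(T0, T0, T2)"] free by (simp add: ev)
  have 3: "a (T0, T1, T1) = 0" using eq[of "(T0, T0, T1)" "(T0, T1, T0)"] mir[of "(T0, T1, T1)"] free by (simp add: ev)
  have 4: "a (T0, T1, T2) = 0" using eq[of "(T0, T0, T1)" "(T0, T1, T1)"] mir[of "(T0, T1, T2)"] free 3 by (simp add: ev)
  have 5: "a (T1, T0, T1) = 0" using eq[of "(T0, T0, T1)" "(T1, T0, T0)"] mir[of "(T1, T0, T1)"] free g by (simp add: ev)
  have 6: "a (T0, T2, T0) = 0" using eq[of "(T0, T1, T0)" "(T0, T1, T0)"] mir[of "(T0, T2, T0)"] free by (simp add: ev)
  have 7: "a (T0, T2, T1) = 0" using eq[of "(T0, T1, T0)" "(T0, T1, T1)"] mir[of "(T0, T2, T1)"] free 3 by (simp add: ev)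
  have 8: "a (T0, T2, T2) = 0" using eq[of "(T0, T1, T0)" "(T0, T1, T2)"] mir[of "(T0, T2, T2)"] free 4 by (simp add: ev)
  have 9: "a (T1, T1, T0) = 0" using eq[of "(T0, T1, T0)" "(T1, T0, T0)"] mir[of "(T1, T1, T0)"] free g by (simp add: ev)
  have 10: "a (T1, T1, T1) = 0" using eq[of "(T0, T1, T0)" "(T1, T0, T1)"] mir[of "(T1, T1, T1)"] free 5 by (simp add: ev)
  have 11: "a (T1, T0, T2) = 0" using mir[of "(T1, T0, T1)"] 5 by (simp add: ev)
  have 12: "a (T1, T1, T2) = 0" using eq[of "(T0, T1, T0)" "(T1, T0, T2)"] mir[of "(T1, T1, T2)"] free 11 by (simp add: ev)
  note z = g[unfolded gen_def] free 1 2 3 4 5 6 7 8 9 10 11 12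
  show ?thesis
    using mir[of c] z by (cases c rule: prod_cases3; rename_tac x y w; case_tac x; case_tac y; case_tac w) (simp_all add: ev)
qed

section \<open>Derivations in Fourier coordinates\<close>

text \<open>Multiplying the Weyl matrix at \<open>(j, k)\<close> by that of \<open>gen\<close> gives
  the phase \<open>om k\<close> from the left and \<open>om (- k)\<close> from the right. The third
  slot, holding the adjoint of the second, transforms by minus right multiplication.\<close>

definition raw_left :: "grp \<Rightarrow> zw" where
  "raw_left c = (case c of (j, k, l) \<Rightarrow>
     (case l of T0 \<Rightarrow> zadd (zom k) (zmul (-1, 0) (zom (- k))) | T1 \<Rightarrow> zom k | T2 \<Rightarrow> zmul (-1, 0) (zom (- k))))"

definition raw_right :: "grp \<Rightarrow> zw" where
  "raw_right c = (case c of (j, k, l) \<Rightarrow>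
     (case l of T0 \<Rightarrow> (0, 0) | T1 \<Rightarrow> zmul (-1, 0) (zom (- k)) | T2 \<Rightarrow> zom k))"

text \<open>The derivations \<open>(A, B) \<mapsto> ([D, A], D B)\<close> and \<open>(A, B) \<mapsto> (0, - B D)\<close> for the Weyl matrix \<open>D\<close> of \<open>gen\<close>.\<close>

definition zleft :: "grp \<Rightarrow> zw" where
  "zleft c = zmul (zom (pot c - pot (gadd c gen))) (raw_left c)"

text \<open>The prefactor, here as in \<open>zleft\<close>, changes coordinates from
  \<open>eta\<close> back to \<open>xi\<close>.\<close>

definition zright :: "grp \<Rightarrow> zw" where
  "zright c = zmul (zom (pot c - pot (gadd c gen))) (raw_right c)"

definition zder :: "(grp \<Rightarrow> zw) \<Rightarrow> bool" where
  "zder a \<longleftrightarrow> list_all (\<lambda>q. a (gneg (gadd q gen)) = zmul (-1, 0) (a q)) grps \<and>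
     list_all (\<lambda>c. list_all (\<lambda>p. zadd (zadd (zmul (zbc (gadd c gen) p) (a c)) (zmul (zbc c (gadd p gen)) (a p)))
       (zmul (zbc c p) (a (gneg (gadd (gadd c p) gen)))) = (0, 0)) grps) grps"

lemma zder_code: "zder zleft \<and> zder zright"
  unfolding zder_def by code_simp

lemma der_at_zder:
  assumes "zder a" shows "der_at gen (\<lambda>c. zev (a c))"
proof -
  have m1: "zev (zmul (-1, 0) x) = - zev x" for x by (simp only: zev_mul) simp
  have "a (- q - gen) = zmul (-1, 0) (a q)" for q
    using assms unfolding zder_def list_all_iff set_grps gneg_gadd by blast
  then have 1: "zev (a (- q - gen)) = - zev (a q)" for q by (simp only: m1)
  have 2: "bc (c + gen) p * zev (a c) + bc c (p + gen) * zev (a p) + bc c p * zev (a (- c - p - gen)) = 0" for c p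
  proof -
    have "zadd (zadd (zmul (zbc (gadd c gen) p) (a c)) (zmul (zbc c (gadd p gen)) (a p)))
       (zmul (zbc c p) (a (gneg (gadd (gadd c p) gen)))) = (0, 0)"
      using assms unfolding zder_def list_all_iff set_grps by blast
    moreover have "gneg (gadd (gadd c p) gen) = - c - p - gen"
      by (simp only: gadd gneg minus_add_distrib diff_conv_add_uminus)
    ultimately have "zadd (zadd (zmul (zbc (c + gen) p) (a c)) (zmul (zbc c (p + gen)) (a p)))
       (zmul (zbc c p) (a (- c - p - gen))) = (0, 0)" by (simp only: gadd)
    from arg_cong[OF this, of zev] show ?thesis
      unfolding zev_add zev_mul zev_zbc by simp
  qed
  show ?thesis unfolding der_at_def skew_at_def using 1 2 by blast
qed

lemma skew_at_lincomb:
  assumes "skew_at d a" "skew_at d b" shows "skew_at d (\<lambda>c. s * a c + t * b c)"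
  using assms unfolding skew_at_def by (simp add: algebra_simps del: split_paired_All)

lemma der_at_lincomb:
  assumes "der_at d a" "der_at d b" shows "der_at d (\<lambda>c. s * a c + t * b c)"
proof -
  have "bc (c + d) p * (s * a c + t * b c) + bc c (p + d) * (s * a p + t * b p) + bc c p * (s * a (- c - p - d) + t * b (- c - p - d))
    = s * (bc (c + d) p * a c + bc c (p + d) * a p + bc c p * a (- c - p - d)) +
      t * (bc (c + d) p * b c + bc c (p + d) * b p + bc c p * b (- c - p - d))" for c p
    by (simp add: algebra_simps)
  moreover have "bc (c + d) p * a c + bc c (p + d) * a p + bc c p * a (- c - p - d) = 0"
     "bc (c + d) p * b c + bc c (p + d) * b p + bc c p * b (- c - p - d) = 0" for c p
    using assms unfolding der_at_def by blast+
  ultimately show ?thesis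
    using skew_at_lincomb assms unfolding der_at_def by (simp only: mult_zero_right add_0_right) blast
qed

lemma der_at_conj:
  assumes "der_at d a" shows "der_at (- d) (\<lambda>c. cnj (a (- c)))"
proof -
  have "a (- q - d) = - a q" for q using assms unfolding der_at_def skew_at_def by blast
  from this[of "- q" for q] have 1: "cnj (a (- (- q - - d))) = - cnj (a (- q))" for q by simp
  have eq: "bc (c + d) p * a c + bc c (p + d) * a p + bc c p * a (- c - p - d) = 0" for c p
    using assms unfolding der_at_def by blast
  have 2: "bc (c + - d) p * cnj (a (- c)) + bc c (p + - d) * cnj (a (- p)) + bc c p * cnj (a (- (- c - p - - d))) = 0" for c p
  proof -
    have b: "bc (c + - d) p = cnj (bc (- c + d) (- p))" "bc c (p + - d) = cnj (bc (- c) (- p + d))" "bc c p = cnj (bc (- c) (- p))"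
      using bc_uminus[of "- c + d" "- p"] bc_uminus[of "- c" "- p + d"] bc_uminus[of "- c" "- p"] by simp_all
    have "- (- c - p - - d) = - (- c) - - p - d" by simp
    then show ?thesis
      unfolding b using arg_cong[OF eq[of "- c" "- p"], of cnj] by (simp add: add.commute[of p c])
  qed
  show ?thesis unfolding der_at_def skew_at_def using 1 2 by blast
qed

text \<open>Complex dimension 2 expressed by coordinates: the two positions \<open>fr\<close>
  determine a solution, and \<open>E\<close> is the dual pair of solutions.\<close>

definition dual_at :: "grp \<Rightarrow> (bool \<Rightarrow> grp) \<Rightarrow> (bool \<Rightarrow> grp \<Rightarrow> complex) \<Rightarrow> bool" where
  "dual_at d fr E \<longleftrightarrow> (\<forall>b. der_at d (E b)) \<and> (\<forall>b b'. E b (fr b') = (if b = b' then 1 else 0)) \<and>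
     (\<forall>a. der_at d a \<longrightarrow> (\<forall>b. a (fr b) = 0) \<longrightarrow> (\<forall>c. a c = 0))"

lemma dual_at_gen: "\<exists>fr E. dual_at gen fr E"
proof -
  define l where "l = (\<lambda>c. zev (zleft c))"
  define r where "r = (\<lambda>c. zev (zright c))"
  have lr: "der_at gen l" "der_at gen r" unfolding l_def r_def using zder_code by (auto intro: der_at_zder)
  have "zleft (T0, T0, T1) = (0, 1) \<and> zright (T0, T0, T1) = (0, -1) \<and> zright (T0, T1, T0) = (0, 0) \<and> zleft (T0, T1, T0) = (-2, -1)"
    by code_simp
  then have v: "l (T0, T0, T1) = omega" "r (T0, T0, T1) = - omega" "r (T0, T1, T0) = 0" "l (T0, T1, T0) = -2 - omega"
    by (simp_all add: l_def r_def)
  \<comment> \<open>This inverts the 2 by 2 matrix of values at the two positions: \<open>r\<close>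
    vanishes at the second one, and \<open>l + r\<close> at the first.\<close>
  define E where "E b = (if b then (\<lambda>c. 0 * l c + (- 1 / omega) * r c)
      else (\<lambda>c. (1 / (-2 - omega)) * l c + (1 / (-2 - omega)) * r c))" for b
  define fr :: "bool \<Rightarrow> grp" where "fr b = (if b then (T0, T0, T1) else (T0, T1, T0))" for b
  have nz: "-2 - omega \<noteq> 0" by (simp add: omega_def complex_eq_iff)
  have "der_at gen (E b)" for b unfolding E_def by (cases b; simp only: if_True if_False; rule der_at_lincomb[OF lr])
  moreover have "E b (fr b') = (if b = b' then 1 else 0)" for b b'
    using omega_nz(1) nz by (auto simp: E_def fr_def v)
  moreover have "a c = 0" if "der_at gen a" "\<forall>b. a (fr b) = 0" for a c
    using der_at_gen[OF that(1)] that(2)[rule_format, of True] that(2)[rule_format, of False] by (simp add: fr_def)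
  ultimately show ?thesis unfolding dual_at_def by (intro exI[of _ fr] exI[of _ E]) blast
qed

section \<open>Transport of the linear systems along the symmetry of order 13\<close>

definition rot' :: "grp \<Rightarrow> grp" where "rot' = inv rot"

lemma rot_rot' [simp]: "rot (rot' c) = c" "rot' (rot c) = c"
  using bij_rot by (simp_all add: rot'_def bij_is_surj surj_f_inv_f bij_is_inj)

lemma skew_at_rot: "skew_at (rot d) a \<Longrightarrow> skew_at d (\<lambda>c. a (rot c))"
  unfolding skew_at_def by (simp only: rot_diff rot_uminus) blast

lemma der_at_rot: "der_at (rot d) a \<Longrightarrow> der_at d (\<lambda>c. a (rot c))"
  unfolding der_at_def using skew_at_rot[of d a]
  by (simp only: rot_diff rot_uminus) (metis bc_rot rot_add)

lemma der_at_rot': assumes "der_at d a" shows "der_at (rot d) (\<lambda>c. a (rot' c))"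
proof -
  have r: "rot' (x + y) = rot' x + rot' y" "rot' (x - y) = rot' x - rot' y" "rot' (- x) = - rot' x" for x y
    by (metis rot_add rot_diff rot_uminus rot_rot')+
  have b: "bc (rot' c) (rot' p) = bc c p" for c p using bc_rot[of "rot' c" "rot' p"] by simp
  have m: "a (- q - d) = - a q" for q using assms unfolding der_at_def skew_at_def by blast
  have eq: "bc (c + d) p * a c + bc c (p + d) * a p + bc c p * a (- c - p - d) = 0" for c p
    using assms unfolding der_at_def by blast
  have 2: "bc (c + rot d) p * a (rot' c) + bc c (p + rot d) * a (rot' p) + bc c p * a (rot' (- c - p - rot d)) = 0" for c p
    using eq[of "rot' c" "rot' p"] b[of "c + rot d" p] b[of c "p + rot d"] b[of c p] by (simp add: r)
  show ?thesis unfolding der_at_def skew_at_def using 2 m by (simp add: r del: split_paired_All)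
qed

lemma dual_at_orb: "d \<in> orb \<Longrightarrow> \<exists>fr E. dual_at d fr E"
proof (induction rule: orb_induct)
  case gen
  show ?case by (rule dual_at_gen)
next
  case (rot d)
  then obtain fr E where E: "dual_at d fr E" by blast
  have "a c = 0" if a: "der_at (rot d) a" "\<forall>b. a (rot (fr b)) = 0" for a c
  proof -
    have "a (rot (rot' c)) = 0" using E der_at_rot[OF a(1)] a(2) unfolding dual_at_def by blast
    then show ?thesis by simp
  qed
  then have "dual_at (rot d) (\<lambda>b. rot (fr b)) (\<lambda>b c. E b (rot' c))"
    using E der_at_rot' unfolding dual_at_def by simp
  then show ?case by blast
qed

lemma inf_at_rot: assumes "inf_at (rot d) a" shows "inf_at d (\<lambda>c. a (rot c))"
proof -
  have "(\<Sum>s\<in>UNIV. bc (t - d - s) (s + d) * fid (t - d - s) * fid s * a (rot s)) = 0" for t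
  proof -
    have "(\<Sum>s\<in>UNIV. bc (rot t - rot d - s) (s + rot d) * fid (rot t - rot d - s) * fid s * a s) = 0"
      using assms unfolding inf_at_def by blast
    then have "(\<Sum>s\<in>UNIV. bc (rot t - rot d - rot s) (rot s + rot d) * fid (rot t - rot d - rot s) * fid (rot s) * a (rot s)) = 0"
      using sum.reindex_bij_betw[of rot UNIV UNIV "\<lambda>s. bc (rot t - rot d - s) (s + rot d) * fid (rot t - rot d - s) * fid s * a s"] bij_rot
      by simp
    then show ?thesis by (simp only: rot_diff[symmetric] rot_add[symmetric] bc_rot fid_rot)
  qed
  then show ?thesis using assms skew_at_rot unfolding inf_at_def by blast
qed

text \<open>The four positions \<open>fr\<close> determine a solution, which bounds the complex
  dimension by 4; \<open>bool \<times> bool\<close> is merely a four-element index type.\<close>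

definition detect :: "grp \<Rightarrow> (bool \<times> bool \<Rightarrow> grp) \<Rightarrow> bool" where
  "detect d fr \<longleftrightarrow> (\<forall>a. inf_at d a \<longrightarrow> (\<forall>b. a (fr b) = 0) \<longrightarrow> (\<forall>c. a c = 0))"

lemma detect_list:
  assumes "length xs = 4" "\<And>a c. inf_at d a \<Longrightarrow> (\<And>q. q \<in> set xs \<Longrightarrow> a q = 0) \<Longrightarrow> a c = 0"
  shows "\<exists>fr. detect d fr"
proof -
  obtain p q r s where xs: "xs = [p, q, r, s]"
    using assms(1) by (auto simp: length_Suc_conv numeral_eq_Suc)
  define fr where "fr = (\<lambda>(x, y). if x then (if y then p else q) else (if y then r else s))"
  have U: "(UNIV :: (bool \<times> bool) set) = {(True, True), (True, False), (False, True), (False, False)}" by auto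
  have "range fr = {p, q, r, s}" unfolding U fr_def by simp
  then have "set xs = range fr" by (simp add: xs)
  then have "detect d fr" unfolding detect_def using assms(2) by (metis imageE)
  then show ?thesis by blast
qed

lemma detect_0: "\<exists>fr. detect 0 fr"
  by (rule detect_list[of inv_free]) (simp add: inv_free_def, rule inf_at_0)

lemma detect_orb: "d \<in> orb \<Longrightarrow> \<exists>fr. detect d fr"
proof (induction rule: orb_induct)
  case gen
  show ?case by (rule detect_list[of gen_free]) (simp add: gen_free_def, rule inf_at_gen)
next
  case (rot d)
  then obtain fr where fr: "detect d fr" by blast
  have "a c = 0" if a: "inf_at (rot d) a" "\<forall>b. a (rot (fr b)) = 0" for a c
  proof -
    have "a (rot (rot' c)) = 0" using fr inf_at_rot[OF a(1)] a(2) unfolding detect_def by blast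
    then show ?thesis by simp
  qed
  then have "detect (rot d) (\<lambda>b. rot (fr b))" unfolding detect_def by blast
  then show ?case by blast
qed

section \<open>Dimension of the infinitesimal deformations\<close>

definition mc :: "(alg \<Rightarrow> alg) \<Rightarrow> grp \<Rightarrow> grp \<Rightarrow> complex" where
  "mc X c q = (\<Sum>h\<in>UNIV. chr q h * xi c (X (axis h 1))) / 3"

lemma component_xi: "complex_of_real (x $ h) = (\<Sum>q\<in>UNIV. chr q h * xi q x) / 3"
proof -
  have "complex_of_real (synth (\<lambda>c. xi c x) $ h) = (\<Sum>q\<in>UNIV. chr q h * xi q x) / 3"
  proof -
    have "cnj (\<Sum>c\<in>UNIV. chr c h * xi c x) = (\<Sum>c\<in>UNIV. chr c h * xi c x)"
      using sum_uminus_reindex[of "\<lambda>c. chr c h * xi c x"] by (simp add: xi_hermitian chr_uminus)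
    then have "cnj ((\<Sum>c\<in>UNIV. chr c h * xi c x) / 3) = (\<Sum>c\<in>UNIV. chr c h * xi c x) / 3"
      by (simp only: complex_cnj_divide complex_cnj_numeral)
    then show ?thesis unfolding synth_def
      by (simp only: vec_lambda_beta Reals_cnj_iff[symmetric] of_real_Re)
  qed
  then show ?thesis by (simp only: synth_xi)
qed

lemma xi_sum: "xi c (sum f S) = (\<Sum>b\<in>S. xi c (f b))"
proof (induction S rule: infinite_finite_induct)
  case (insert x F)
  then show ?case by (simp add: xi_add)
qed (simp_all add: xi_def)

lemma xi_operator:
  assumes "linear X" shows "xi c (X x) = (\<Sum>q\<in>UNIV. mc X c q * xi q x)"
proof -
  have "x = (\<Sum>h\<in>UNIV. (x $ h) *\<^sub>R axis h 1)"
    by (simp add: vec_eq_iff axis_def if_distrib cong: if_cong)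
  then have "X x = (\<Sum>h\<in>UNIV. (x $ h) *\<^sub>R X (axis h 1))"
    by (metis (no_types, lifting) assms linear_scale linear_sum sum.cong)
  then have "xi c (X x) = (\<Sum>h\<in>UNIV. complex_of_real (x $ h) * xi c (X (axis h 1)))"
    by (simp add: xi_sum xi_scaleR)
  also have "\<dots> = (\<Sum>h\<in>UNIV. \<Sum>q\<in>UNIV. chr q h * xi c (X (axis h 1)) / 3 * xi q x)"
    unfolding component_xi sum_divide_distrib sum_distrib_right by (intro sum.cong refl) simp
  also have "\<dots> = (\<Sum>q\<in>UNIV. mc X c q * xi q x)"
    by (subst sum.swap) (simp add: mc_def sum_divide_distrib sum_distrib_right)
  finally show ?thesis .
qed

lemma mc_hermitian: "mc X (- c) (- q) = cnj (mc X c q)"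
  by (simp add: mc_def xi_hermitian chr_uminus)

section \<open>The conditions on an operator, separated into shifts\<close>

lemma skew_form:
  assumes "\<And>c x. xi c (X x) = (\<Sum>q\<in>UNIV. m c q * xi q x)"
  shows "complex_of_real (X x \<bullet> y + x \<bullet> X y) = 3 * (\<Sum>q\<in>UNIV. (\<Sum>r\<in>UNIV. (m (- r) q + m (- q) r) * xi r y) * xi q x)"
proof -
  have "complex_of_real (X x \<bullet> y) = 3 * (\<Sum>r\<in>UNIV. xi (- r) (X x) * xi r y)"
    unfolding xi_parseval using sum_uminus_reindex[of "\<lambda>c. xi c (X x) * xi (- c) y"] by simp
  also have "(\<Sum>r\<in>UNIV. xi (- r) (X x) * xi r y) = (\<Sum>q\<in>UNIV. (\<Sum>r\<in>UNIV. m (- r) q * xi r y) * xi q x)"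
    unfolding assms sum_distrib_right by (subst sum.swap) (simp only: mult_ac)
  finally have 1: "complex_of_real (X x \<bullet> y) = 3 * (\<Sum>q\<in>UNIV. (\<Sum>r\<in>UNIV. m (- r) q * xi r y) * xi q x)" .
  have 2: "complex_of_real (x \<bullet> X y) = 3 * (\<Sum>q\<in>UNIV. (\<Sum>r\<in>UNIV. m (- q) r * xi r y) * xi q x)"
    unfolding xi_parseval assms by (simp only: mult.commute)
  show ?thesis by (simp only: of_real_add 1 2 distrib_right sum.distrib distrib_left)
qed

lemma cross_inner_left: "complex_of_real (cross x y \<bullet> z) = 3 * (\<Sum>p\<in>UNIV. \<Sum>r\<in>UNIV. bc (- p - r) p * xi (- p - r) x * xi p y * xi r z)"
proof -
  have "cross x y \<bullet> z = cross y z \<bullet> x" using cross_cyclic[of x y z] by (simp only: inner_commute)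
  moreover have "bc p r = bc (- p - r) p" for p r
    using bc_cyclic[of p "- p - r"] by simp
  ultimately show ?thesis by (simp add: cross_inner mult_ac)
qed

lemma cross_inner_middle: "complex_of_real (cross x y \<bullet> z) = 3 * (\<Sum>q\<in>UNIV. \<Sum>r\<in>UNIV. bc q (- q - r) * xi q x * xi (- q - r) y * xi r z)"
proof -
  have "cross x y \<bullet> z = cross y x \<bullet> z" by (simp only: cross_commute[of x])
  then show ?thesis by (simp only: cross_inner_left bc_commute mult_ac)
qed

text \<open>The coefficient of \<open>xi q x * xi p y * xi r z\<close> in the derivation identity;
  the three summands come from the operator acting on each argument.\<close>

definition derform :: "(grp \<Rightarrow> grp \<Rightarrow> complex) \<Rightarrow> grp \<Rightarrow> grp \<Rightarrow> grp \<Rightarrow> complex" where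
  "derform m q p r = bc (- p - r) p * m (- p - r) q + bc q (- q - r) * m (- q - r) p + bc q p * m (- q - p) r"

lemma derivation_form:
  assumes "\<And>c x. xi c (X x) = (\<Sum>q\<in>UNIV. m c q * xi q x)"
  shows "complex_of_real (cross (X x) y \<bullet> z + cross x (X y) \<bullet> z + cross x y \<bullet> X z) =
    3 * (\<Sum>q\<in>UNIV. (\<Sum>p\<in>UNIV. (\<Sum>r\<in>UNIV. derform m q p r * xi r z) * xi p y) * xi q x)"
proof -
  have 1: "complex_of_real (cross (X x) y \<bullet> z) =
    3 * (\<Sum>q\<in>UNIV. (\<Sum>p\<in>UNIV. (\<Sum>r\<in>UNIV. bc (- p - r) p * m (- p - r) q * xi r z) * xi p y) * xi q x)"
  proof -
    have "(\<Sum>p\<in>UNIV. \<Sum>r\<in>UNIV. bc (- p - r) p * xi (- p - r) (X x) * xi p y * xi r z) =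
      (\<Sum>p\<in>UNIV. \<Sum>r\<in>UNIV. \<Sum>q\<in>UNIV. bc (- p - r) p * m (- p - r) q * xi r z * xi p y * xi q x)"
      unfolding assms sum_distrib_left sum_distrib_right by (simp only: mult_ac)
    also have "\<dots> = (\<Sum>p\<in>UNIV. \<Sum>q\<in>UNIV. \<Sum>r\<in>UNIV. bc (- p - r) p * m (- p - r) q * xi r z * xi p y * xi q x)"
      by (rule sum.cong[OF refl], rule sum.swap)
    also have "\<dots> = (\<Sum>q\<in>UNIV. \<Sum>p\<in>UNIV. \<Sum>r\<in>UNIV. bc (- p - r) p * m (- p - r) q * xi r z * xi p y * xi q x)"
      by (rule sum.swap)
    finally show ?thesis by (simp only: cross_inner_left sum_distrib_right)
  qed
  have 2: "complex_of_real (cross x (X y) \<bullet> z) =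
    3 * (\<Sum>q\<in>UNIV. (\<Sum>p\<in>UNIV. (\<Sum>r\<in>UNIV. bc q (- q - r) * m (- q - r) p * xi r z) * xi p y) * xi q x)"
  proof -
    have "(\<Sum>q\<in>UNIV. \<Sum>r\<in>UNIV. bc q (- q - r) * xi q x * xi (- q - r) (X y) * xi r z) =
      (\<Sum>q\<in>UNIV. \<Sum>r\<in>UNIV. \<Sum>p\<in>UNIV. bc q (- q - r) * m (- q - r) p * xi r z * xi p y * xi q x)"
      unfolding assms sum_distrib_left sum_distrib_right by (simp only: mult_ac)
    also have "\<dots> = (\<Sum>q\<in>UNIV. \<Sum>p\<in>UNIV. \<Sum>r\<in>UNIV. bc q (- q - r) * m (- q - r) p * xi r z * xi p y * xi q x)"
      by (rule sum.cong[OF refl], rule sum.swap)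
    finally show ?thesis by (simp only: cross_inner_middle sum_distrib_right)
  qed
  have 3: "complex_of_real (cross x y \<bullet> X z) =
    3 * (\<Sum>q\<in>UNIV. (\<Sum>p\<in>UNIV. (\<Sum>r\<in>UNIV. bc q p * m (- q - p) r * xi r z) * xi p y) * xi q x)"
    unfolding cross_inner assms sum_distrib_left sum_distrib_right by (simp only: mult_ac)
  show ?thesis
    by (simp only: of_real_add 1 2 3 derform_def distrib_right sum.distrib distrib_left)
qed

lemma derform_at: "derform m q p (- q - p - d) = bc (q + d) p * m (q + d) q + bc q (p + d) * m (p + d) p + bc q p * m (- q - p - d + d) (- q - p - d)"
proof -
  have "- p - (- q - p - d) = q + d" "- q - (- q - p - d) = p + d" "- q - p = - q - p - d + d" by simp_all
  then show ?thesis unfolding derform_def by (simp only:)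
qed

definition blk :: "(alg \<Rightarrow> alg) \<Rightarrow> grp \<Rightarrow> grp \<Rightarrow> complex" where
  "blk X d q = mc X (q + d) q"

lemma blk_conj: "blk X (- d) (- q) = cnj (blk X d q)"
  using mc_hermitian[of X "q + d" q] by (simp add: blk_def)

lemma skew_blk:
  assumes "linear X" "\<And>x y. X x \<bullet> y + x \<bullet> X y = 0"
  shows "skew_at d (blk X d)"
  unfolding skew_at_def
proof
  fix q
  have "(\<Sum>q\<in>UNIV. (\<Sum>r\<in>UNIV. (mc X (- r) q + mc X (- q) r) * xi r y) * xi q x) = 0" for x y
    using skew_form[OF xi_operator[OF assms(1)], of x y] assms(2)[of x y] by simp
  from xi_independent[OF this] have "(\<Sum>r\<in>UNIV. (mc X (- r) q + mc X (- q) r) * xi r y) = 0" for y .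
  from xi_independent[OF this, of "- q - d"] have "mc X (- (- q - d)) q + mc X (- q) (- q - d) = 0" .
  moreover have "- (- q - d) = q + d" "- q = - q - d + d" by simp_all
  ultimately show "blk X d (- q - d) = - blk X d q"
    unfolding blk_def by (simp only: add_eq_0_iff)
qed

lemma der_blk:
  assumes "skew_derivation X" shows "der_at d (blk X d)"
proof -
  have X: "linear X" "\<And>x y. X x \<bullet> y + x \<bullet> X y = 0" "\<And>x y z. cross (X x) y \<bullet> z + cross x (X y) \<bullet> z + cross x y \<bullet> X z = 0"
    using assms by (auto simp: skew_derivation_def)
  have "(\<Sum>q\<in>UNIV. (\<Sum>p\<in>UNIV. (\<Sum>r\<in>UNIV. derform (mc X) q p r * xi r z) * xi p y) * xi q x) = 0" for x y z
    using derivation_form[OF xi_operator[OF X(1)], of x y z] X(3)[of x y z] by simp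
  from xi_independent[OF this] have "(\<Sum>p\<in>UNIV. (\<Sum>r\<in>UNIV. derform (mc X) q p r * xi r z) * xi p y) = 0" for q y z .
  from xi_independent[OF this] have "(\<Sum>r\<in>UNIV. derform (mc X) q p r * xi r z) = 0" for q p z .
  from xi_independent[OF this] have "derform (mc X) q p r = 0" for q p r .
  then have "bc (q + d) p * blk X d q + bc q (p + d) * blk X d p + bc q p * blk X d (- q - p - d) = 0" for q p
    unfolding blk_def using derform_at[of "mc X" q p d] by simp
  then show ?thesis unfolding der_at_def using skew_blk[OF X(1,2)] by blast
qed

text \<open>Each Fourier coefficient of \<open>cross (pt g) (X (pt g))\<close> is a combination of
  characters of \<open>g\<close>. As it vanishes for all translations, independence of characters
  makes every combination coefficient vanish, which isolates one shift.\<close>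

lemma inf_blk:
  assumes X: "linear X" "\<And>x y. X x \<bullet> y + x \<bullet> X y = 0" and t: "\<And>g. cross (pt g) (X (pt g)) = 0"
  shows "inf_at d (blk X d)"
proof -
  have "(\<Sum>s\<in>UNIV. bc (t - d - s) (s + d) * fid (t - d - s) * fid s * blk X d s) = 0" for t
  proof -
    have reind: "(\<Sum>c\<in>UNIV. \<Sum>q\<in>UNIV. F c q) = (\<Sum>r\<in>UNIV. \<Sum>q\<in>UNIV. F (r - q) q)" for F :: "grp \<Rightarrow> grp \<Rightarrow> complex"
    proof -
      have "(\<Sum>c\<in>UNIV. \<Sum>q\<in>UNIV. F c q) = (\<Sum>q\<in>UNIV. \<Sum>c\<in>UNIV. F c q)" by (rule sum.swap)
      also have "\<dots> = (\<Sum>q\<in>UNIV. \<Sum>r\<in>UNIV. F (r - q) q)"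
      proof (rule sum.cong[OF refl])
        fix q
        show "(\<Sum>c\<in>UNIV. F c q) = (\<Sum>r\<in>UNIV. F (r - q) q)"
          by (rule sum.reindex_bij_witness[of _ "\<lambda>r. r - q" "\<lambda>c. c + q"]) auto
      qed
      also have "\<dots> = (\<Sum>r\<in>UNIV. \<Sum>q\<in>UNIV. F (r - q) q)" by (rule sum.swap)
      finally show ?thesis .
    qed
    \<comment> \<open>\<open>k r\<close> gathers the terms with \<open>c + q = r\<close>, all of
      which vary with \<open>g\<close> by the same character; \<open>r = t - d\<close> selects the
      shift \<open>d\<close>.\<close>
    define k where "k r = (\<Sum>q\<in>UNIV. bc (r - q) (t - (r - q)) * fid (r - q) * fid q * mc X (t - (r - q)) q)" for r
    have "(\<Sum>r\<in>UNIV. k r * chr r g) = 0" for g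
    proof -
      have "0 = 1521 * xi t (cross (pt g) (X (pt g)))" by (simp add: t) (simp add: xi_def)
      also have "\<dots> = 1521 * (\<Sum>c\<in>UNIV. \<Sum>q\<in>UNIV. bc c (t - c) * (chr c g * fid c / 39) * (mc X (t - c) q * (chr q g * fid q / 39)))"
        unfolding xi_cross conv_def xi_operator[OF X(1)] xi_pt sum_distrib_left ..
      also have "\<dots> = (\<Sum>c\<in>UNIV. \<Sum>q\<in>UNIV. bc c (t - c) * fid c * fid q * mc X (t - c) q * chr (c + q) g)"
        unfolding sum_distrib_left by (intro sum.cong refl) (simp add: chr_add(1))
      also have "\<dots> = (\<Sum>r\<in>UNIV. k r * chr r g)"
        unfolding k_def sum_distrib_right
        by (subst reind) (simp only: diff_add_cancel)
      finally show ?thesis by simp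
    qed
    from chr_independent[OF this, of "t - d"] have "k (t - d) = 0" .
    moreover have "t - (t - d - q) = q + d" for q by simp
    ultimately show ?thesis unfolding k_def blk_def by (simp only:)
  qed
  then show ?thesis using skew_blk[OF X] unfolding inf_at_def by blast
qed

lemma operator_eq_0:
  assumes "linear X" "\<And>d q. blk X d q = 0" shows "X x = 0"
proof (rule xi_inject)
  fix c
  have "mc X c q = 0" for c q using assms(2)[of "c - q" q] by (simp add: blk_def)
  then show "xi c (X x) = xi c 0" by (simp add: xi_operator[OF assms(1)]) (simp add: xi_def)
qed

lemma blk_linear:
  "blk (extend config (v + w)) d q = blk (extend config v) d q + blk (extend config w) d q"
  "blk (extend config (s *\<^sub>R v)) d q = complex_of_real s * blk (extend config v) d q"
proof -
  have "extend config (v + w) x = extend config v x + extend config w x" "extend config (s *\<^sub>R v) x = s *\<^sub>R extend config v x" for x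
    by (simp_all add: extend_def scaleR_add_right sum.distrib scaleR_sum_right mult.commute)
  then show "blk (extend config (v + w)) d q = blk (extend config v) d q + blk (extend config w) d q"
    "blk (extend config (s *\<^sub>R v)) d q = complex_of_real s * blk (extend config v) d q"
    by (simp_all add: blk_def mc_def xi_add xi_scaleR distrib_left sum.distrib add_divide_distrib sum_distrib_left mult_ac)
qed

lemma infinitesimal_extend:
  assumes "v \<in> infinitesimal config"
  shows "linear (extend config v)" "extend config v x \<bullet> y + x \<bullet> extend config v y = 0"
    "cross (pt g) (extend config v (pt g)) = 0" "inf_at d (blk (extend config v) d)"
proof -
  have v: "config $ i \<bullet> v $ j + v $ i \<bullet> config $ j = 0" "v $ i \<in> albert_alg.tangent (config $ i)" for i j
    using assms constr'_eq_0[OF tight_config, of v] unfolding infinitesimal_def by blast+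
  show l: "linear (extend config v)" by (rule extend_linear)
  show s: "extend config v x \<bullet> y + x \<bullet> extend config v y = 0" for x y
    by (rule skew_on_tight[OF tight_config l]) (simp add: extend_at[OF tight_config] v(1))
  show t: "cross (pt g) (extend config v (pt g)) = 0" for g
    using v(2)[of g] extend_at[OF tight_config, of v g] by (simp add: albert_alg.tangent_def config_def)
  show "inf_at d (blk (extend config v) d)" by (rule inf_blk[OF l s t])
qed

lemma blk_eq_0_extend:
  assumes "\<And>d q. blk (extend config v) d q = 0" shows "v = 0"
proof -
  have "v $ g = 0" for g
    using operator_eq_0[OF extend_linear assms, of "config $ g"] extend_at[OF tight_config, of v g] by simp
  then show ?thesis by (simp add: vec_eq_iff del: split_paired_All)
qed

lemma blk_eq_0_orb:
  assumes "\<And>d q. d \<in> orb \<Longrightarrow> blk X d q = 0" "\<And>q. blk X 0 q = 0"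
  shows "blk X d q = 0"
proof -
  have "blk X d q = cnj (blk X (- d) (- q))" by (simp flip: blk_conj)
  then show ?thesis using orb_cases[of d] assms by (metis complex_cnj_zero)
qed

section \<open>Dimension counts at the configuration\<close>

lemma orb_enumeration: obtains \<beta> :: "13 \<Rightarrow> grp" where "bij_betw \<beta> UNIV orb"
  using finite_same_card_bij[of "UNIV :: 13 set" orb] card_orb by (auto simp: orb_def)

lemma dim_le_DIM:
  fixes L :: "'a::euclidean_space \<Rightarrow> 'b::euclidean_space"
  assumes "linear L" "subspace S" "\<And>x. x \<in> S \<Longrightarrow> L x = 0 \<Longrightarrow> x = 0"
  shows "dim S \<le> DIM('b)"
proof -
  have "{x\<in>S. L x = 0} \<subseteq> {0}" using assms(3) by auto
  then have "dim {x\<in>S. L x = 0} = 0" by (simp add: dim_eq_0)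
  then have "dim (L ` S) = dim S" using dim_kernel_plus_dim_image[OF assms(1,2)] by linarith
  then show ?thesis using dim_subset_UNIV[of "L ` S"] by simp
qed

text \<open>The 13 shifts in \<open>orb\<close> contribute four complex coordinates each, and their
  negatives are conjugate to them. In the shift 0, skewness and reality make the entries purely
  imaginary, so four real coordinates suffice: 13 * 8 + 4 = 108.\<close>

proposition dim_infinitesimal_config: "dim (infinitesimal config) \<le> 108"
proof -
  obtain \<beta> :: "13 \<Rightarrow> grp" where \<beta>: "bij_betw \<beta> UNIV orb" by (rule orb_enumeration)
  obtain fr where fr: "\<And>d. d \<in> orb \<Longrightarrow> detect d (fr d)" using detect_orb by metis
  obtain f0 where f0: "detect 0 f0" using detect_0 by blast
  define L :: "alg ^ grp \<Rightarrow> ((complex ^ (bool \<times> bool)) ^ 13) \<times> (real ^ (bool \<times> bool))"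
    where "L v = ((\<chi> i b. blk (extend config v) (\<beta> i) (fr (\<beta> i) b)), \<chi> b. Im (blk (extend config v) 0 (f0 b)))" for v
  have lin: "linear L" unfolding L_def
    by (intro linearI) (simp_all add: blk_linear vec_eq_iff scaleR_conv_of_real[where 'a=complex])
  have "dim (infinitesimal config) \<le> DIM(((complex ^ (bool \<times> bool)) ^ 13) \<times> (real ^ (bool \<times> bool)))"
  proof (rule dim_le_DIM[OF lin subspace_infinitesimal])
    fix v assume v: "v \<in> infinitesimal config" and "L v = 0"
    then have z: "blk (extend config v) (\<beta> i) (fr (\<beta> i) b) = 0" "Im (blk (extend config v) 0 (f0 b)) = 0" for i b
      by (simp_all add: L_def zero_prod_def vec_eq_iff del: split_paired_All)
    have 1: "blk (extend config v) d q = 0" if "d \<in> orb" for d q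
    proof -
      obtain i where "d = \<beta> i" using \<beta> \<open>d \<in> orb\<close> by (auto simp: bij_betw_def)
      then show ?thesis
        using fr[OF that] infinitesimal_extend(4)[OF v, of d] z(1)[of i] unfolding detect_def by blast
    qed
    have "blk (extend config v) 0 (f0 b) = 0" for b
    proof -
      have "blk (extend config v) 0 (- f0 b) = - blk (extend config v) 0 (f0 b)"
      proof -
        have "skew_at 0 (blk (extend config v) 0)"
          using infinitesimal_extend(4)[OF v, of 0] unfolding inf_at_def by (rule conjunct1)
        then have "blk (extend config v) 0 (- f0 b - 0) = - blk (extend config v) 0 (f0 b)"
          unfolding skew_at_def by (rule spec)
        then show ?thesis by (simp only: diff_zero)
      qed
      moreover have "blk (extend config v) 0 (- f0 b) = cnj (blk (extend config v) 0 (f0 b))"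
        using blk_conj[of "extend config v" 0 "f0 b"] by simp
      ultimately show ?thesis using z(2)[of b] by (simp add: complex_eq_iff)
    qed
    then have "blk (extend config v) 0 q = 0" for q
      using f0 infinitesimal_extend(4)[OF v, of 0] unfolding detect_def by blast
    then show "v = 0" using blk_eq_0_extend blk_eq_0_orb[OF 1] by blast
  qed
  then show ?thesis by simp
qed

lemma subspace_trivial_inf: "subspace (trivial_inf q)"
proof -
  have "trivial_inf q = {v. constr' q v = 0} \<inter> {v. cubics' q v = 0}" by (auto simp: trivial_inf_def)
  then show ?thesis
    using subspace_inter[OF linear_subspace_kernel[OF linear_constr'] linear_subspace_kernel[OF linear_cubics']] by simp
qed

proposition dim_trivial_inf_config: "dim (trivial_inf config) = 52"
proof -
  obtain \<beta> :: "13 \<Rightarrow> grp" where \<beta>: "bij_betw \<beta> UNIV orb" by (rule orb_enumeration)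
  obtain fr E where E: "\<And>d. d \<in> orb \<Longrightarrow> dual_at d (fr d) (E d)" using dual_at_orb by metis
  define L :: "alg ^ grp \<Rightarrow> (complex ^ bool) ^ 13"
    where "L v = (\<chi> i b. blk (extend config v) (\<beta> i) (fr (\<beta> i) b))" for v
  have lin: "linear L" unfolding L_def
    by (intro linearI) (simp_all add: blk_linear vec_eq_iff scaleR_conv_of_real[where 'a=complex])
  have inj: "v = 0" if v: "v \<in> trivial_inf config" and "L v = 0" for v
  proof -
    have der: "der_at d (blk (extend config v) d)" for d
      by (rule der_blk[OF trivial_inf_extend[OF tight_config v]])
    have z: "blk (extend config v) (\<beta> i) (fr (\<beta> i) b) = 0" for i b
      using that(2) by (simp add: L_def vec_eq_iff del: split_paired_All)
    have 1: "blk (extend config v) d q = 0" if "d \<in> orb" for d q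
    proof -
      obtain i where "d = \<beta> i" using \<beta> \<open>d \<in> orb\<close> by (auto simp: bij_betw_def)
      then show ?thesis using E[OF that] der[of d] z[of i] unfolding dual_at_def by blast
    qed
    show ?thesis using blk_eq_0_extend blk_eq_0_orb[OF 1] der_at_0[OF der[of 0]] by blast
  qed
  have surj: "\<exists>v\<in>trivial_inf config. L v = w" for w
  proof -
    define \<gamma> where "\<gamma> = inv_into UNIV \<beta>"
    have \<gamma>: "\<gamma> (\<beta> i) = i" "\<beta> i \<in> orb" for i using \<beta> by (auto simp: \<gamma>_def bij_betw_def)
    define A where "A d q = (\<Sum>b\<in>UNIV. (w $ \<gamma> d $ b) * E d b q)" for d q
    \<comment> \<open>Prescribed solutions on \<open>orb\<close>, the conjugate ones on the
      negatives, and zero at the trivial shift; this is what makes the assembled operator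
      real.\<close>
    define B where "B d q = (if d \<in> orb then A d q else if - d \<in> orb then cnj (A (- d) (- q)) else 0)" for d q
    have dA: "der_at d (A d)" if "d \<in> orb" for d
      unfolding A_def UNIV_bool using der_at_lincomb E[OF that] unfolding dual_at_def by simp
    have dB: "der_at d (B d)" for d
    proof -
      have "der_at d (\<lambda>q. 0)" by (simp add: der_at_def skew_at_def)
      moreover have "der_at d (\<lambda>q. cnj (A (- d) (- q)))" if "- d \<in> orb" using der_at_conj[OF dA[OF that]] by simp
      ultimately show ?thesis using dA[of d] unfolding B_def by (cases "d \<in> orb"; cases "- d \<in> orb") auto
    qed
    have Bc: "B (- d) (- q) = cnj (B d q)" for d q
      using orb_uminus[of d] orb_uminus[of "- d"] by (auto simp: B_def)
    define m where "m c q = B (c - q) q" for c q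
    define X where "X x = synth (\<lambda>c. \<Sum>q\<in>UNIV. m c q * xi q x)" for x
    have xiX: "xi c (X x) = (\<Sum>q\<in>UNIV. m c q * xi q x)" for c x
      unfolding X_def
    proof (rule xi_synth)
      show "hermitian (\<lambda>c. \<Sum>q\<in>UNIV. m c q * xi q x)"
        unfolding hermitian_def
      proof
        fix c
        have "m (- c) (- q) = cnj (m c q)" for q using Bc[of "c - q" q] by (simp add: m_def)
        then show "(\<Sum>q\<in>UNIV. m (- c) q * xi q x) = cnj (\<Sum>q\<in>UNIV. m c q * xi q x)"
          using sum_uminus_reindex[of "\<lambda>q. m (- c) q * xi q x"] by (simp add: xi_hermitian)
      qed
    qed
    have linX: "linear X"
      by (intro linearI; rule xi_inject)
        (simp_all add: xiX xi_add xi_scaleR distrib_left sum.distrib sum_distrib_left mult_ac)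
    have sk: "m (- r) q + m (- q) r = 0" for q r
    proof -
      have "B (- q - r) (- q - (- q - r)) = - B (- q - r) q"
        using dB unfolding der_at_def skew_at_def by blast
      moreover have "- q - (- q - r) = r" "- r - q = - q - r" by simp_all
      ultimately show ?thesis unfolding m_def by (simp only:) simp
    qed
    have df: "derform m q p r = 0" for q p r
    proof -
      define d where "d = - q - p - r"
      have r: "r = - q - p - d" by (simp add: d_def)
      have "bc (q + d) p * B d q + bc q (p + d) * B d p + bc q p * B d (- q - p - d) = 0"
        using dB unfolding der_at_def by blast
      then show ?thesis unfolding r derform_at by (simp add: m_def)
    qed
    have "skew_derivation X"
      unfolding skew_derivation_def
    proof (intro conjI allI)
      show "linear X" by (rule linX)
      fix x y z
      have "complex_of_real (X x \<bullet> y + x \<bullet> X y) = 0"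
        unfolding skew_form[OF xiX] sk by simp
      then show "X x \<bullet> y + x \<bullet> X y = 0" by (simp only: of_real_eq_0_iff)
      have "complex_of_real (cross (X x) y \<bullet> z + cross x (X y) \<bullet> z + cross x y \<bullet> X z) = 0"
        unfolding derivation_form[OF xiX] df by simp
      then show "cross (X x) y \<bullet> z + cross x (X y) \<bullet> z + cross x y \<bullet> X z = 0" by (simp only: of_real_eq_0_iff)
    qed
    then have v: "(\<chi> i. X (config $ i)) \<in> trivial_inf config" (is "?v \<in> _")
      by (rule skew_derivation_trivial_inf[OF tight_config])
    have ext: "extend config ?v = X"
    proof
      fix x
      show "extend config ?v x = X x"
        by (rule linear_eq_on_tight[OF tight_config extend_linear linX]) (simp add: extend_at[OF tight_config])
    qed
    have mcX: "mc X c q = m c q" for c q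
    proof -
      have "(\<Sum>q\<in>UNIV. (mc X c q - m c q) * xi q x) = 0" for x
        using xi_operator[OF linX, of c x] xiX[of c x] by (simp add: left_diff_distrib sum_subtractf)
      from xi_independent[OF this, of q] show ?thesis by simp
    qed
    have "blk X (\<beta> i) (fr (\<beta> i) b) = w $ i $ b" for i b
    proof -
      have "blk X (\<beta> i) (fr (\<beta> i) b) = A (\<beta> i) (fr (\<beta> i) b)" using \<gamma>(2) by (simp add: blk_def mcX m_def B_def)
      also have "\<dots> = (\<Sum>b'\<in>UNIV. (w $ i $ b') * (if b' = b then 1 else 0))"
        unfolding A_def \<gamma>(1) using E[OF \<gamma>(2)] unfolding dual_at_def by simp
      also have "\<dots> = w $ i $ b" by (simp add: if_distrib cong: if_cong)
      finally show ?thesis .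
    qed
    then have "L ?v = w" by (simp add: L_def ext vec_eq_iff)
    then show ?thesis using v by blast
  qed
  have "{x\<in>trivial_inf config. L x = 0} \<subseteq> {0}" using inj by auto
  then have "dim {x\<in>trivial_inf config. L x = 0} = 0" by (simp add: dim_eq_0)
  moreover have "L ` trivial_inf config = UNIV" using surj by (metis UNIV_eq_I imageI)
  then have "dim (L ` trivial_inf config) = 52" by simp
  ultimately show ?thesis
    using dim_kernel_plus_dim_image[OF lin subspace_trivial_inf, of config] by linarith
qed

section \<open>Octonionic Hermitian matrices\<close>

text \<open>The inverse of \<open>mx\<close>: inverse Weyl transform in each slot, removal of the
  phase of \<open>pot\<close>, then Fourier synthesis.\<close>

definition mat_alg :: "(tri \<Rightarrow> tri \<Rightarrow> tri \<Rightarrow> complex) \<Rightarrow> alg" where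
  "mat_alg M = synth (\<lambda>(j, k, l). cnj (om (pot (j, k, l))) * ((\<Sum>i\<in>UNIV. om (k * (j + i + i)) * M l (j + i) i) / 3))"

lemma weyl_synthesis:
  "weyl (\<lambda>j k. (\<Sum>i\<in>UNIV. om (k * (j + i + i)) * m (j + i) i) / 3) r i = m r i"
proof -
  have "weyl (\<lambda>j k. (1/3) * (\<Sum>i\<in>UNIV. om (k * (j + i + i)) * m (j + i) i)) r i =
    (1/3) * weyl (\<lambda>j k. \<Sum>i\<in>UNIV. om (k * (j + i + i)) * m (j + i) i) r i" by (rule weyl_scale)
  moreover have "\<forall>r i. weyl (\<lambda>j k. \<Sum>i\<in>UNIV. om (k * (j + i + i)) * m (j + i) i) r i = 3 * m r i"
    unfolding tri_all by (intro conjI; simp only: weyl_def tri_eval; (simp add: algebra_simps; fail | (insert omega_square, algebra)))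
  then have "weyl (\<lambda>j k. \<Sum>i\<in>UNIV. om (k * (j + i + i)) * m (j + i) i) r i = 3 * m r i" by blast
  ultimately show ?thesis by simp
qed

lemma mx_mat_alg:
  assumes M: "\<And>l r i. M (- l) r i = cnj (M l i r)"
  shows "mx l (mat_alg M) r i = M l r i"
proof -
  define a where "a l j k = (\<Sum>i\<in>UNIV. om (k * (j + i + i)) * M l (j + i) i) / 3" for l j k
  have "a (- l) (- j) (- k) = cnj (a l j k)" for l j k
  proof -
    have "(\<Sum>i\<in>UNIV. om (- k * (- j + i + i)) * M (- l) (- j + i) i) = (\<Sum>i\<in>UNIV. cnj (om (k * (j + i + i)) * M l (j + i) i))"
    proof (rule sum.reindex_bij_witness[of _ "\<lambda>i. i + j" "\<lambda>i. i - j"])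
      fix i
      have "- k * (- j + i + i) = - (k * (j + (i - j) + (i - j)))"
        by (simp add: algebra_simps)
      then show "cnj (om (k * (j + (i - j) + (i - j))) * M l (j + (i - j)) (i - j)) = om (- k * (- j + i + i)) * M (- l) (- j + i) i"
        by (simp only: om_uminus M) (simp add: algebra_simps)
    qed auto
    then show ?thesis by (simp add: a_def)
  qed
  note ah = this
  have "hermitian (\<lambda>(j, k, l). cnj (om (pot (j, k, l))) * a l j k)"
    unfolding hermitian_def
  proof
    fix c :: grp
    obtain j k l where c: "c = (j, k, l)" by (cases c) auto
    have "om (pot (- j, - k, - l)) = cnj (om (pot (j, k, l)))" using pot_uminus[of c] by (simp only: c uminus_Pair om_uminus)
    then show "(case - c of (j, k, l) \<Rightarrow> cnj (om (pot (j, k, l))) * a l j k) = cnj (case c of (j, k, l) \<Rightarrow> cnj (om (pot (j, k, l))) * a l j k)"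
      by (simp add: c ah del: pot.simps)
  qed
  then have "xi c (mat_alg M) = (case c of (j, k, l) \<Rightarrow> cnj (om (pot (j, k, l))) * a l j k)" for c
    unfolding mat_alg_def a_def[symmetric] by (rule xi_synth)
  then have e: "eta (j, k, l) (mat_alg M) = a l j k" for j k l
    using om_cnj[of "pot (j, k, l)"] by (simp add: eta_def mult.assoc[symmetric] del: pot.simps)
  show ?thesis unfolding mx_def e a_def weyl_synthesis ..
qed

lemma mx_unit: "mx T0 unit r i = (if r = i then 1 else 0)" "mx T1 unit r i = 0" "mx T2 unit r i = 0"
proof -
  have e: "eta c unit = (if c = 0 then 1 else 0)" for c by (simp add: eta_def xi_unit)
  have "mx T1 unit r i = 0" "mx T2 unit r i = 0"
    by (simp_all add: mx_def weyl_def e zero_prod_def zero_tri_def)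
  moreover have "\<forall>r i. mx T0 unit r i = (if r = i then 1 else 0)"
    unfolding tri_all by (simp add: mx_def weyl_def e zero_prod_def tri_eval)
  ultimately show "mx T0 unit r i = (if r = i then 1 else 0)" "mx T1 unit r i = 0" "mx T2 unit r i = 0" by blast+
qed

lemma tri_diff:
  "T0 - T0 = T0" "T0 - T1 = T2" "T0 - T2 = T1" "T1 - T0 = T1" "T1 - T1 = T0" "T1 - T2 = T2"
  "T2 - T0 = T2" "T2 - T1 = T1" "T2 - T2 = T0"
  by (simp_all only: minus_tri_def uminus_tri.simps plus_tri.simps)

fun sg :: "tri \<Rightarrow> complex" where
  "sg T0 = 0" | "sg T1 = 1" | "sg T2 = -1"

lemma sg_0 [simp]: "sg 0 = 0"
  by (simp add: zero_tri_def)

text \<open>The octonion at an off-diagonal place has complex part from the Hermitian matrix \<open>a\<close> and its other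
  three coordinates from the row of \<open>b\<close> complementary to the two indices of the place.\<close>

definition ent :: "(tri \<Rightarrow> tri \<Rightarrow> complex) \<Rightarrow> (tri \<Rightarrow> tri \<Rightarrow> complex) \<Rightarrow> tri \<Rightarrow> tri \<Rightarrow> oct" where
  "ent a b r i = ((a r i, sg (r - i) * cnj (b (- r - i) T0)), (sg (r - i) * cnj (b (- r - i) T1), sg (r - i) * b (- r - i) T2))"

text \<open>The quadratic identity of Hermitian octonionic matrices: the square is the adjoint, plus
  the trace times the matrix, minus the trace of the adjoint times the identity. It matches the
  octonion product with the Tits coordinates.\<close>

lemma ent_square:
  assumes "\<And>r i. cnj (a r i) = a i r" "\<And>r i. c r i = cnj (b i r)"
  shows "(\<Sum>m\<in>UNIV. omul (ent a b r m) (ent a b m i)) =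
    ent (sharp3 a b c) (sharp3 c a b) r i + (\<Sum>m\<in>UNIV. Re (a m m)) *\<^sub>R ent a b r i
      - (if r = i then ((\<Sum>m\<in>UNIV. sharp3 a b c m m, 0), 0) else 0)"
proof -
  have "\<forall>r i. (\<Sum>m\<in>UNIV. omul (ent a b r m) (ent a b m i)) =
    ent (sharp3 a b c) (sharp3 c a b) r i + (\<Sum>m\<in>UNIV. Re (a m m)) *\<^sub>R ent a b r i
      - (if r = i then ((\<Sum>m\<in>UNIV. sharp3 a b c m m, 0), 0) else 0)"
  proof -
    have re: "complex_of_real (\<Sum>m\<in>UNIV. Re (a m m)) = a T0 T0 + a T1 T1 + a T2 T2"
    proof -
      have "complex_of_real (Re (a m m)) = a m m" for m
        using assms(1)[of m m] by (simp add: complex_eq_iff)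
      then show ?thesis by (simp add: tri_sum)
    qed
    show ?thesis
      unfolding tri_all
      by (intro conjI; simp only: ent_def sharp3_def adj3_def mult3_def omul_def qmul_def qcnj_def fst_conv snd_conv tri_sum[where 'a=oct]
        tri_sum[where 'a=complex] scaleR_Pair scaleR_conv_of_real re prod_eq_iff fst_add snd_add fst_diff snd_diff fst_zero snd_zero
        minus_tri_def plus_tri.simps uminus_tri.simps sg.simps assms complex_cnj_add complex_cnj_mult complex_cnj_diff complex_cnj_cnj
        complex_cnj_one complex_cnj_zero complex_cnj_minus tri.simps if_True if_False simp_thms;
        (intro conjI; algebra)?)
  qed
  then show ?thesis by blast
qed

text \<open>Every off-diagonal octonion occurs at two mirrored places, hence the factor 2 for
  \<open>b\<close>.\<close>

lemma ent_inner:
  assumes "\<And>r i. cnj (a r i) = a i r" "\<And>r i. cnj (a' r i) = a' i r"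
  shows "fst (fst (\<Sum>r\<in>UNIV. \<Sum>m\<in>UNIV. omul (ent a b r m) (ent a' b' m r))) =
    (\<Sum>r\<in>UNIV. \<Sum>m\<in>UNIV. a r m * a' m r) + 2 * (\<Sum>r\<in>UNIV. \<Sum>m\<in>UNIV. cnj (b r m) * b' r m)"
  by (simp only: ent_def omul_def qmul_def qcnj_def fst_conv snd_conv tri_sum[where 'a=oct]
        tri_sum[where 'a=complex] fst_add snd_add fst_diff snd_diff fst_zero snd_zero
        minus_tri_def plus_tri.simps uminus_tri.simps sg.simps assms complex_cnj_add complex_cnj_mult complex_cnj_diff complex_cnj_cnj
        complex_cnj_one complex_cnj_zero complex_cnj_minus; algebra)

lemma ent_Hermitian: "(\<And>r i. cnj (a r i) = a i r) \<Longrightarrow> ent a b i r = ocnj (ent a b r i)"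
  by (cases r; cases i) (simp_all add: ent_def ocnj_def qcnj_def tri_diff)

definition idx :: "3 \<Rightarrow> tri" where
  "idx i = (if i = 1 then T0 else if i = 2 then T1 else T2)"

fun num :: "tri \<Rightarrow> 3" where
  "num T0 = 1" | "num T1 = 2" | "num T2 = 3"

lemma idx_num [simp]: "idx (num r) = r" "num (idx i) = i"
proof -
  show "idx (num r) = r" by (cases r) (simp_all add: idx_def)
  show "num (idx i) = i" using exhaust_3[of i] by (auto simp: idx_def)
qed

lemma idx_numeral [simp]: "idx 1 = T0" "idx 2 = T1" "idx 3 = T2"
  by (simp_all add: idx_def)

lemma sum_idx: "(\<Sum>i\<in>UNIV. f (idx i)) = (\<Sum>r\<in>UNIV. f r)"
  by (rule sum.reindex_bij_witness[of _ num idx]) auto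

definition toct :: "alg \<Rightarrow> omat" where
  "toct x i j = ent (mx T0 x) (mx T1 x) (idx i) (idx j)"

text \<open>Row \<open>k\<close> of \<open>b\<close> is read off at the place
  \<open>(k + 1, k + 2)\<close>, where the index difference is \<open>T2\<close> and
  \<open>sg\<close> gives -1; hence the sign.\<close>

definition brow :: "omat \<Rightarrow> tri \<Rightarrow> tri \<Rightarrow> complex" where
  "brow P k j = - (case j of T0 \<Rightarrow> cnj (snd (fst (P (num (k + T1)) (num (k + T2)))))
     | T1 \<Rightarrow> cnj (fst (snd (P (num (k + T1)) (num (k + T2)))))
     | T2 \<Rightarrow> snd (snd (P (num (k + T1)) (num (k + T2)))))"

definition ofoct :: "omat \<Rightarrow> alg" where
  "ofoct P = mat_alg (\<lambda>l r i. case l of T0 \<Rightarrow> fst (fst (P (num r) (num i))) | T1 \<Rightarrow> brow P r i | T2 \<Rightarrow> cnj (brow P i r))"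

lemma mx_ofoct:
  assumes "ohermitian P"
  shows "mx T0 (ofoct P) r i = fst (fst (P (num r) (num i)))" "mx T1 (ofoct P) r i = brow P r i"
    "mx T2 (ofoct P) r i = cnj (brow P i r)"
proof -
  have P: "P (num r) (num i) = ocnj (P (num i) (num r))" for r i using assms unfolding ohermitian_def by blast
  have T0: "fst (fst (P (num r) (num i))) = cnj (fst (fst (P (num i) (num r))))" for r i
    by (subst P) (simp add: ocnj_def qcnj_def)
  define M where "M l r i = (case l of T0 \<Rightarrow> fst (fst (P (num r) (num i))) | T1 \<Rightarrow> brow P r i | T2 \<Rightarrow> cnj (brow P i r))" for l r i
  have "M (- l) r i = cnj (M l i r)" for l r i
    using T0[of r i] by (cases l) (simp_all add: M_def)
  from mx_mat_alg[of M, OF this]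
  have "mx l (ofoct P) r i = M l r i" for l unfolding ofoct_def M_def .
  then show "mx T0 (ofoct P) r i = fst (fst (P (num r) (num i)))" "mx T1 (ofoct P) r i = brow P r i"
    "mx T2 (ofoct P) r i = cnj (brow P i r)" by (simp_all add: M_def)
qed

lemma mx_T0_Hermitian: "cnj (mx T0 x r i) = mx T0 x i r" "mx T2 x r i = cnj (mx T1 x i r)"
  using mx_adjoint[of T0 x i r] mx_adjoint[of T1 x r i] by simp_all

lemma ohermitian_toct: "ohermitian (toct x)"
  unfolding ohermitian_def toct_def using ent_Hermitian[of "mx T0 x"] mx_T0_Hermitian by blast

lemma toct_ofoct: assumes "ohermitian P" shows "toct (ofoct P) = P"
proof -
  have P: "P (num i) (num r) = ocnj (P (num r) (num i))" for r i using assms unfolding ohermitian_def by blast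
  have "ent (mx T0 (ofoct P)) (mx T1 (ofoct P)) r i = P (num r) (num i)" for r i
    using P[of r i] P[of i r]
    by (cases r; cases i)
      (simp_all add: ent_def mx_ofoct[OF assms] brow_def tri_diff ocnj_def qcnj_def prod_eq_iff complex_eq_iff)
  from this[of "idx _" "idx _"] show ?thesis by (simp add: toct_def fun_eq_iff)
qed

lemma ofoct_toct: "ofoct (toct x) = x"
proof (rule mx_inject)
  fix l r i
  have b: "brow (toct x) k j = mx T1 x k j" for k j
    by (cases k; cases j) (simp_all add: brow_def toct_def ent_def tri_diff zero_tri_def)
  have "fst (fst (toct x (num r) (num i))) = mx T0 x r i" by (simp add: toct_def ent_def)
  then show "mx l (ofoct (toct x)) r i = mx l x r i"
    by (cases l) (simp_all add: mx_ofoct[OF ohermitian_toct] b mx_T0_Hermitian(2))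
qed

lemma oinner_toct: "oinner (toct x) (toct y) = x \<bullet> y"
proof -
  define Z where "Z = (\<Sum>r\<in>UNIV. \<Sum>i\<in>UNIV. mx T1 x r i * mx T2 y i r)"
  have "(\<Sum>r\<in>UNIV. \<Sum>i\<in>UNIV. mx T2 x r i * mx T1 y i r) = cnj Z"
    unfolding Z_def by (subst sum.swap) (simp add: mx_T0_Hermitian(2))
  then have "complex_of_real (x \<bullet> y) = (\<Sum>r\<in>UNIV. \<Sum>i\<in>UNIV. mx T0 x r i * mx T0 y i r) + Z + cnj Z"
    unfolding inner_mx tri_sum[of "\<lambda>l. \<Sum>r\<in>UNIV. \<Sum>i\<in>UNIV. mx l x r i * mx (- l) y i r"] by (simp add: Z_def)
  then have 1: "x \<bullet> y = Re (\<Sum>r\<in>UNIV. \<Sum>i\<in>UNIV. mx T0 x r i * mx T0 y i r) + 2 * Re Z"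
    by (drule_tac arg_cong[where f=Re]) simp
  have 2: "cnj Z = (\<Sum>r\<in>UNIV. \<Sum>m\<in>UNIV. cnj (mx T1 x r m) * mx T1 y r m)"
    unfolding Z_def by (simp add: mx_T0_Hermitian(2))
  have "otrace (omat_mult (toct x) (toct y)) = (\<Sum>r\<in>UNIV. \<Sum>m\<in>UNIV.
      omul (ent (mx T0 x) (mx T1 x) r m) (ent (mx T0 y) (mx T1 y) m r))"
    unfolding otrace_def omat_mult_def toct_def
    by (simp only: sum_idx[of "\<lambda>m. omul (ent (mx T0 x) (mx T1 x) (idx _) m) (ent (mx T0 y) (mx T1 y) m (idx _))"]
       sum_idx[of "\<lambda>r. \<Sum>m\<in>UNIV. omul (ent (mx T0 x) (mx T1 x) r m) (ent (mx T0 y) (mx T1 y) m r)"])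
  then have "oinner (toct x) (toct y) = Re ((\<Sum>r\<in>UNIV. \<Sum>i\<in>UNIV. mx T0 x r i * mx T0 y i r) + 2 * cnj Z)"
    unfolding oinner_def oct_re_def 2
    by (simp only: ent_inner[of "mx T0 x" "mx T0 y", OF mx_T0_Hermitian(1) mx_T0_Hermitian(1)])
  then show ?thesis by (simp add: 1)
qed

lemma inner_unit_trace: "x \<bullet> unit = (\<Sum>m\<in>UNIV. Re (mx T0 x m m))"
proof -
  have "complex_of_real (x \<bullet> unit) = (\<Sum>m\<in>UNIV. mx T0 x m m)"
    unfolding inner_mx tri_sum uminus_tri.simps mx_unit by simp
  then show ?thesis by (metis Re_complex_of_real Re_sum)
qed

lemma otrace_toct: "otrace (toct x) = oct_of_real (x \<bullet> unit)"
proof -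
  have "ent (mx T0 x) (mx T1 x) r r = oct_of_real (Re (mx T0 x r r))" for r
    using mx_T0_Hermitian(1)[of x r r] by (simp add: ent_def oct_of_real_def zero_prod_def complex_eq_iff)
  then show ?thesis
    unfolding otrace_def toct_def sum_idx[of "\<lambda>r. ent (mx T0 x) (mx T1 x) r r"] inner_unit_trace
    by (simp add: tri_sum oct_of_real_def)
qed

text \<open>By \<open>ent_square\<close>, for trace 1 idempotency says that the adjoint is its trace
  \<open>s\<close> times the identity. Taking traces gives \<open>s = 3 s\<close>, so the adjoint
  vanishes, which is \<open>cross x x = 0\<close>.\<close>

lemma toct_in_OP2: "toct x \<in> OP2 \<longleftrightarrow> x \<in> albert_alg.plane"
proof -
  let ?a = "mx T0 x" and ?b = "mx T1 x" and ?c = "mx T2 x"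
  let ?A = "sharp3 ?a ?b ?c" and ?B = "sharp3 ?c ?a ?b"
  have prod: "omat_mult (toct x) (toct x) i j = ent ?A ?B (idx i) (idx j) + (x \<bullet> unit) *\<^sub>R toct x i j
      - (if i = j then ((\<Sum>m\<in>UNIV. ?A m m, 0), 0) else 0)" for i j
  proof -
    have "i = j \<longleftrightarrow> idx i = idx j" by (metis idx_num(2))
    then show ?thesis
      unfolding omat_mult_def toct_def sum_idx[of "\<lambda>m. omul (ent ?a ?b (idx i) m) (ent ?a ?b m (idx j))"] inner_unit_trace
      by (simp only: ent_square[of ?a ?c ?b, OF mx_T0_Hermitian])
  qed
  show ?thesis
  proof
    assume "x \<in> albert_alg.plane"
    then have x: "cross x x = 0 *\<^sub>R x" "x \<bullet> unit = 1" by (simp_all add: albert_alg.plane_def)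
    have "?A r i = 0" "?B r i = 0" for r i
      using mx_cross_square(1,2)[of x] mx_scaleR[of _ 0 x r i] unfolding x by (metis mult_eq_0_iff of_real_0 zero_neq_numeral)+
    then have "omat_mult (toct x) (toct x) = toct x"
      by (simp add: fun_eq_iff prod x ent_def zero_prod_def[symmetric])
    then show "toct x \<in> OP2" using ohermitian_toct otrace_toct[of x] x by (simp add: OP2_def)
  next
    assume "toct x \<in> OP2"
    then have P: "omat_mult (toct x) (toct x) = toct x" "x \<bullet> unit = 1"
      using otrace_toct[of x] by (simp_all add: OP2_def oct_of_real_def)
    define s where "s = (\<Sum>m\<in>UNIV. ?A m m)"
    have e: "ent ?A ?B r i = (if r = i then ((s, 0), 0) else 0)" for r i
    proof -
      have "num r = num i \<longleftrightarrow> r = i" by (metis idx_num(1))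
      then show ?thesis using prod[of "num r" "num i"] by (simp add: P s_def split: if_splits)
    qed
    have "?A m m = s" for m using e[of m m] by (simp add: ent_def)
    then have "s = (\<Sum>m\<in>(UNIV::tri set). s)" by (subst s_def) (simp only:)
    then have "s = 3 * s" by (simp add: card_tri)
    then have s: "s = 0" by simp
    have A: "?A r i = 0" for r i using e[of r i] s by (simp add: ent_def zero_prod_def split: if_splits)
    have B: "?B r i = 0" for r i
      using e[of "r + T1" "r + T2"] s by (cases r; cases i) (simp_all add: ent_def tri_diff zero_prod_def zero_tri_def)
    have "mx l (cross x x) r i = mx l (0 *\<^sub>R x) r i" for l r i
      using mx_T0_Hermitian(2)[of "cross x x" r i] unfolding mx_scaleR
      by (cases l) (simp_all add: mx_cross_square A B)
    from mx_inject[of "cross x x", OF this] have "cross x x = 0" by simp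
    then show "x \<in> albert_alg.plane" using P(2) by (simp add: albert_alg.plane_def)
  qed
qed

lemma continuous_on_toct: "continuous_on S toct"
proof -
  have "continuous_on S (\<lambda>x. mx l x r i)" for l r i
    unfolding mx_def weyl_def eta_def xi_def by (intro continuous_intros) simp
  then show ?thesis
    unfolding toct_def[abs_def] ent_def
    by (intro continuous_on_coordinatewise_then_product continuous_intros)
qed

lemma continuous_on_ofoct: "continuous_on S ofoct"
proof -
  have P: "continuous_on S (\<lambda>P::omat. P i j)" for i j
    by (rule continuous_on_product_then_coordinatewise[OF continuous_on_product_then_coordinatewise[OF continuous_on_id]])
  have b: "continuous_on S (\<lambda>P. brow P k j)" for k j
    unfolding brow_def by (cases j; simp; intro continuous_intros P)
  have "continuous_on S (\<lambda>P. case l of T0 \<Rightarrow> fst (fst (P (num r) (num i))) | T1 \<Rightarrow> brow P r i | T2 \<Rightarrow> cnj (brow P i r))" for l r i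
    by (cases l; simp; intro continuous_intros P b)
  note M = this
  show ?thesis unfolding ofoct_def mat_alg_def synth_def case_prod_beta
    by (intro continuous_intros continuous_on_vec_lambda M) auto
qed

section \<open>The moduli space of tight simplices\<close>

lemma bij_toct: "bij_betw toct albert_alg.plane OP2" "bij_betw ofoct OP2 albert_alg.plane"
proof -
  have o: "toct (ofoct P) = P" "ofoct P \<in> albert_alg.plane" if "P \<in> OP2" for P
  proof -
    show "toct (ofoct P) = P" using that by (simp add: OP2_def toct_ofoct)
    then show "ofoct P \<in> albert_alg.plane" using that by (simp add: toct_in_OP2[symmetric])
  qed
  show "bij_betw toct albert_alg.plane OP2" "bij_betw ofoct OP2 albert_alg.plane"
    by (rule bij_betw_byWitness[where f'=ofoct], use o in \<open>auto simp: ofoct_toct toct_in_OP2\<close>)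
      (rule bij_betw_byWitness[where f'=toct], use o in \<open>auto simp: ofoct_toct toct_in_OP2\<close>)
qed

lemma OP2_cases: assumes "P \<in> OP2" obtains x where "x \<in> albert_alg.plane" "P = toct x"
  using bij_toct(1) assms by (auto simp: bij_betw_def)

lemma F4_comp: "g \<in> F4 \<Longrightarrow> h \<in> F4 \<Longrightarrow> g \<circ> h \<in> F4"
  by (auto simp: F4_def intro: bij_betw_trans dest: bij_betwE)

text \<open>Elements of \<open>F4\<close> are constrained only on \<open>OP2\<close>, so an inverse
  can be asked for only there.\<close>

lemma F4_inverse:
  assumes "g \<in> F4"
  obtains h where "h \<in> F4" "\<forall>P\<in>OP2. h (g P) = P"
proof
  have b: "bij_betw g OP2 OP2" and i: "\<And>P Q. P \<in> OP2 \<Longrightarrow> Q \<in> OP2 \<Longrightarrow> chordal (g P) (g Q) = chordal P Q"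
    using assms by (auto simp: F4_def)
  let ?h = "inv_into OP2 g"
  show "\<forall>P\<in>OP2. ?h (g P) = P" using bij_betw_inv_into_left[OF b] by blast
  have r: "g (?h P) = P" if "P \<in> OP2" for P using b that by (rule bij_betw_inv_into_right)
  have h: "bij_betw ?h OP2 OP2" using b by (rule bij_betw_inv_into)
  have "chordal (?h P) (?h Q) = chordal P Q" if "P \<in> OP2" "Q \<in> OP2" for P Q
    using i[of "?h P" "?h Q"] r that bij_betwE[OF h] by simp
  then show "?h \<in> F4" using h by (simp add: F4_def)
qed

definition transp :: "(omat \<Rightarrow> omat) \<Rightarrow> alg \<Rightarrow> alg" where
  "transp g x = ofoct (g (toct x))"

text \<open>Continuity comes from the metric: as the inner products on the plane are preserved, so
  are Euclidean distances of its points.\<close>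

lemma F4_transp:
  assumes "g \<in> F4"
  shows "x \<in> albert_alg.plane \<Longrightarrow> transp g x \<in> albert_alg.plane" "x \<in> albert_alg.plane \<Longrightarrow> toct (transp g x) = g (toct x)"
    "x \<in> albert_alg.plane \<Longrightarrow> y \<in> albert_alg.plane \<Longrightarrow> transp g x \<bullet> transp g y = x \<bullet> y"
    "continuous_on albert_alg.plane (transp g)"
proof -
  have g: "g P \<in> OP2" if "P \<in> OP2" for P using assms that by (auto simp: F4_def bij_betw_def)
  have t: "toct (transp g x) = g (toct x)" if "x \<in> albert_alg.plane" for x
  proof -
    have "g (toct x) \<in> OP2" using g that by (simp add: toct_in_OP2)
    then show ?thesis unfolding transp_def by (intro toct_ofoct) (simp add: OP2_def)
  qed
  then show "x \<in> albert_alg.plane \<Longrightarrow> toct (transp g x) = g (toct x)" .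
  show p: "x \<in> albert_alg.plane \<Longrightarrow> transp g x \<in> albert_alg.plane" for x
    using g[of "toct x"] by (simp add: toct_in_OP2[symmetric] t)
  show i: "transp g x \<bullet> transp g y = x \<bullet> y" if "x \<in> albert_alg.plane" "y \<in> albert_alg.plane" for x y
  proof -
    have "chordal (g (toct x)) (g (toct y)) = chordal (toct x) (toct y)"
      using assms that by (simp add: F4_def toct_in_OP2)
    then have "oinner (g (toct x)) (g (toct y)) = oinner (toct x) (toct y)" by (simp add: chordal_def)
    then show ?thesis using that by (simp only: t[symmetric] oinner_toct)
  qed
  have "dist (transp g x) (transp g y) = dist x y" if "x \<in> albert_alg.plane" "y \<in> albert_alg.plane" for x y
    using that by (simp add: dist_norm norm_eq_sqrt_inner inner_diff_left inner_diff_right i p)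
  then show "continuous_on albert_alg.plane (transp g)"
    unfolding continuous_on_iff by metis
qed

lemma F4_of_linear:
  assumes "bij L" "\<And>x. L x \<in> albert_alg.plane \<longleftrightarrow> x \<in> albert_alg.plane" "\<And>x y. L x \<bullet> L y = x \<bullet> y"
  shows "toct \<circ> L \<circ> ofoct \<in> F4"
proof -
  have "bij_betw L albert_alg.plane albert_alg.plane"
    unfolding bij_betw_def
  proof
    show "inj_on L albert_alg.plane" using assms(1) by (meson bij_is_inj inj_on_subset subset_UNIV)
    show "L ` albert_alg.plane = albert_alg.plane"
      using assms(1,2) by (auto simp: image_iff) (metis bij_pointE)
  qed
  then have "bij_betw (toct \<circ> L \<circ> ofoct) OP2 OP2"
    using bij_toct by (blast intro: bij_betw_trans)
  moreover have "chordal ((toct \<circ> L \<circ> ofoct) P) ((toct \<circ> L \<circ> ofoct) Q) = chordal P Q" if "P \<in> OP2" "Q \<in> OP2" for P Q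
    using that by (auto elim!: OP2_cases simp: chordal_def oinner_toct ofoct_toct assms(3))
  ultimately show ?thesis by (simp add: F4_def)
qed

section \<open>Labelled tight simplices and families in the algebra\<close>

definition lbl :: "27 \<Rightarrow> grp" where
  "lbl = (SOME s. bij s)"

lemma bij_lbl: "bij lbl"
proof -
  have "\<exists>s :: 27 \<Rightarrow> grp. bij s"
    using finite_same_card_bij[of "UNIV :: 27 set" "UNIV :: grp set"] card_grp by simp
  then show ?thesis unfolding lbl_def by (rule someI_ex)
qed

definition to_simplex :: "alg ^ grp \<Rightarrow> 27 \<Rightarrow> omat" where
  "to_simplex q i = toct (q $ lbl i)"

definition of_simplex :: "(27 \<Rightarrow> omat) \<Rightarrow> alg ^ grp" where
  "of_simplex p = (\<chi> g. ofoct (p (inv lbl g)))"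

lemma lbl_inv [simp]: "lbl (inv lbl g) = g" "inv lbl (lbl i) = i"
  using bij_lbl by (simp_all add: bij_is_surj surj_f_inv_f bij_is_inj)

lemma of_to_simplex: "of_simplex (to_simplex q) = q"
  by (simp add: of_simplex_def to_simplex_def ofoct_toct vec_eq_iff del: split_paired_All)

text \<open>Distinctness follows from the inner products, since coinciding points would pair to 1
  instead of 4/13.\<close>

lemma tight27_iff:
  "p \<in> tight27 \<longleftrightarrow> (\<forall>i. p i \<in> OP2) \<and> (\<forall>i j. i \<noteq> j \<longrightarrow> oinner (p i) (p j) = 4/13)"
proof
  assume "p \<in> tight27"
  then show "(\<forall>i. p i \<in> OP2) \<and> (\<forall>i j. i \<noteq> j \<longrightarrow> oinner (p i) (p j) = 4/13)"
    by (auto simp: tight27_def tight_simplex_def inj_eq)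
next
  assume r: "(\<forall>i. p i \<in> OP2) \<and> (\<forall>i j. i \<noteq> j \<longrightarrow> oinner (p i) (p j) = 4/13)"
  have 1: "oinner P P = 1" if "P \<in> OP2" for P
    using that by (auto elim!: OP2_cases simp: oinner_toct albert_alg.plane_norm)
  have "inj p"
  proof (rule injI)
    fix i j assume "p i = p j"
    then have "oinner (p i) (p j) = 1" using 1 r by simp
    then show "i = j" using r by (cases "i = j") auto
  qed
  moreover have "oinner P Q = 4/13" if "P \<in> range p" "Q \<in> range p" "P \<noteq> Q" for P Q
  proof -
    from that(1,2) obtain i j where "P = p i" "Q = p j" by blast
    then show ?thesis using r that(3) by metis
  qed
  ultimately show "p \<in> tight27" using r by (simp add: tight27_def tight_simplex_def card_image image_subset_iff)
qed

lemma to_simplex_tight27: "to_simplex q \<in> tight27 \<longleftrightarrow> tight q"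
proof -
  have "(\<forall>i. P (lbl i)) \<longleftrightarrow> (\<forall>g. P g)" for P using lbl_inv(1) by metis
  note all = this
  have "to_simplex q \<in> tight27 \<longleftrightarrow> (\<forall>i. q $ lbl i \<in> albert_alg.plane) \<and> (\<forall>i j. lbl i \<noteq> lbl j \<longrightarrow> q $ lbl i \<bullet> q $ lbl j = 4/13)"
    using bij_lbl by (simp add: tight27_iff to_simplex_def toct_in_OP2 oinner_toct bij_is_inj inj_eq)
  also have "\<dots> \<longleftrightarrow> tight q"
    unfolding tight_def all[of "\<lambda>g. q $ g \<in> albert_alg.plane"] all[of "\<lambda>h. lbl _ \<noteq> h \<longrightarrow> q $ lbl _ \<bullet> q $ h = 4/13"]
      all[of "\<lambda>g. \<forall>h. g \<noteq> h \<longrightarrow> q $ g \<bullet> q $ h = 4/13"] ..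
  finally show ?thesis .
qed

lemma to_of_simplex: "p \<in> tight27 \<Longrightarrow> to_simplex (of_simplex p) = p"
  by (auto simp: fun_eq_iff to_simplex_def of_simplex_def tight27_iff OP2_def toct_ofoct)

lemma of_simplex_tight: "p \<in> tight27 \<Longrightarrow> tight (of_simplex p)"
  by (simp add: to_simplex_tight27[symmetric] to_of_simplex)

lemma of_simplex_plane: "p \<in> tight27 \<Longrightarrow> of_simplex p $ i \<in> albert_alg.plane"
  using of_simplex_tight unfolding tight_def by blast

lemma F4_tight27:
  assumes "g \<in> F4" "p \<in> tight27"
  shows "of_simplex (g \<circ> p) = (\<chi> i. transp g (of_simplex p $ i))" "g \<circ> p \<in> tight27"
    "cubics (of_simplex (g \<circ> p)) = cubics (of_simplex p)"
proof -
  have p: "p = to_simplex (of_simplex p)" using assms(2) by (simp add: to_of_simplex)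
  show e: "of_simplex (g \<circ> p) = (\<chi> i. transp g (of_simplex p $ i))"
    by (subst p) (simp add: of_simplex_def to_simplex_def transp_def vec_eq_iff del: split_paired_All)
  have "g \<circ> p = to_simplex (\<chi> i. transp g (of_simplex p $ i))"
    by (subst p) (simp add: fun_eq_iff to_simplex_def F4_transp(2)[OF assms(1) of_simplex_plane[OF assms(2)]])
  moreover have "tight (\<chi> i. transp g (of_simplex p $ i))"
    using of_simplex_tight[OF assms(2)] F4_transp(1,3)[OF assms(1)]
    unfolding tight_def by (simp del: split_paired_All)
  ultimately show "g \<circ> p \<in> tight27" by (simp add: to_simplex_tight27)
  show "cubics (of_simplex (g \<circ> p)) = cubics (of_simplex p)"
    unfolding e cubics_def
    using albert_alg.plane_isometry_preserves_cubic[of "transp g", OF F4_transp(1,3)[OF assms(1)]] of_simplex_plane[OF assms(2)]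
    by (simp add: vec_eq_iff del: split_paired_All)
qed

lemma continuous_on_of_simplex: "continuous_on S of_simplex"
proof -
  have "continuous_on S (\<lambda>p :: 27 \<Rightarrow> omat. ofoct (p i))" for i
    by (rule continuous_on_compose2[OF continuous_on_ofoct[of UNIV]])
      (auto intro: continuous_on_product_then_coordinatewise[OF continuous_on_id])
  then show ?thesis unfolding of_simplex_def[abs_def] by (intro continuous_on_vec_lambda)
qed

lemma continuous_on_to_simplex: "continuous_on S to_simplex"
proof -
  have "continuous_on S (\<lambda>q. toct (q $ g))" for g
    by (rule continuous_on_compose2[OF continuous_on_toct[of UNIV]]) (auto intro: continuous_intros)
  then show ?thesis unfolding to_simplex_def[abs_def] by (rule continuous_on_coordinatewise_then_product)
qed

lemma continuous_on_F4_left: 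
  assumes "g \<in> F4" shows "continuous_on tight27 (\<lambda>p. g \<circ> p)"
proof -
  have "continuous_on tight27 (\<lambda>p. \<chi> i. transp g (of_simplex p $ i))"
    by (intro continuous_on_vec_lambda continuous_on_compose2[OF F4_transp(4)[OF assms]] continuous_intros continuous_on_of_simplex)
      (auto intro: of_simplex_plane)
  then have "continuous_on tight27 (\<lambda>p. to_simplex (\<chi> i. transp g (of_simplex p $ i)))"
    by (rule continuous_on_compose2[OF continuous_on_to_simplex[of UNIV]]) auto
  moreover have "to_simplex (\<chi> i. transp g (of_simplex p $ i)) = g \<circ> p" if "p \<in> tight27" for p
    using F4_tight27[OF assms that] to_of_simplex[of "g \<circ> p"] by simp
  ultimately show ?thesis by (simp cong: continuous_on_cong)
qed

section \<open>The chart of the quotient\<close>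

lemma quotient_locally_euclidean_config:
  "quotient_locally_euclidean_at (to_simplex config) TYPE(56)"
proof -
  obtain W and \<Lambda> :: "real ^ grp ^ grp ^ grp \<Rightarrow> real ^ 56" where W: "open W" "config \<in> W" "linear \<Lambda>"
    and open_map: "\<And>V. open V \<Longrightarrow> V \<subseteq> W \<Longrightarrow> open ((\<lambda>q. \<Lambda> (cubics q)) ` {q\<in>V. tight q})"
    and inj: "\<And>q r. \<lbrakk>q \<in> W; r \<in> W; tight q; tight r; \<Lambda> (cubics q) = \<Lambda> (cubics r)\<rbrakk> \<Longrightarrow> cubics q = cubics r"
    using moduli_chart[OF tight_config dim_infinitesimal_config dim_trivial_inf_config] by blast
  define \<phi> where "\<phi> p = \<Lambda> (cubics (of_simplex p))" for p
  \<comment> \<open>The union of all translates of the chart domain; \<open>\<phi>\<close> makes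
    sense on it because it is invariant.\<close>
  define U where "U = {p\<in>tight27. \<exists>g\<in>F4. of_simplex (g \<circ> p) \<in> W}"
  have U: "U \<subseteq> tight27" by (auto simp: U_def)
  have inv: "\<phi> (g \<circ> p) = \<phi> p" if "g \<in> F4" "p \<in> tight27" for g p
    using F4_tight27(3)[OF that] by (simp add: \<phi>_def)
  have undo: "h \<circ> (g \<circ> p) = p" if "p \<in> tight27" "\<forall>P\<in>OP2. h (g P) = P" for g h :: "omat \<Rightarrow> omat" and p
    using that by (auto simp: tight27_iff fun_eq_iff)
  have "id \<in> F4" by (simp add: F4_def)
  then have in_U: "to_simplex config \<in> U"
    using W(2) tight_config by (auto simp: U_def to_simplex_tight27 of_to_simplex intro!: bexI[of _ id])
  have open_U: "openin (top_of_set tight27) U"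
  proof -
    have "openin (top_of_set tight27) (tight27 \<inter> (\<lambda>p. of_simplex (g \<circ> p)) -` W)" if "g \<in> F4" for g
      by (rule continuous_openin_preimage_gen[OF continuous_on_compose2[OF continuous_on_of_simplex[of UNIV] continuous_on_F4_left[OF that]] W(1)])
        simp
    then have "openin (top_of_set tight27) (\<Union>g\<in>F4. tight27 \<inter> (\<lambda>p. of_simplex (g \<circ> p)) -` W)" by blast
    moreover have "U = (\<Union>g\<in>F4. tight27 \<inter> (\<lambda>p. of_simplex (g \<circ> p)) -` W)" by (auto simp: U_def)
    ultimately show ?thesis by simp
  qed
  have invariant: "g \<circ> p \<in> U" if p: "p \<in> U" and g: "g \<in> F4" for p g
  proof -
    have t: "p \<in> tight27" using p U by blast
    obtain k where k: "k \<in> F4" "of_simplex (k \<circ> p) \<in> W" using p by (auto simp: U_def)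
    obtain h where h: "h \<in> F4" "\<forall>P\<in>OP2. h (g P) = P" using F4_inverse[OF g] by metis
    have "(k \<circ> h) \<circ> (g \<circ> p) = k \<circ> p" using undo[where g=g and h=h, OF t h(2)] by (simp add: o_assoc[symmetric])
    then have "k \<circ> h \<in> F4 \<and> of_simplex ((k \<circ> h) \<circ> (g \<circ> p)) \<in> W" using k F4_comp[OF k(1) h(1)] by simp
    then show ?thesis using F4_tight27(2)[OF g t] unfolding U_def by blast
  qed
  have cont: "continuous_on U \<phi>"
  proof -
    have "continuous_on UNIV (\<lambda>q :: alg ^ grp. cubics q)"
      unfolding cubics_def by (intro continuous_on_vec_lambda continuous_intros albert_alg.cr.continuous_on)
    from continuous_on_compose2[OF linear_continuous_on[OF W(3)[unfolded linear_conv_bounded_linear], of UNIV] this]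
    have "continuous_on UNIV (\<lambda>q. \<Lambda> (cubics q))" by simp
    from continuous_on_compose2[OF this continuous_on_of_simplex[of U]]
    show ?thesis by (simp add: \<phi>_def[abs_def])
  qed
  have open_image: "open (\<phi> ` V)" if V: "openin (top_of_set U) V" for V
  proof -
    have "openin (top_of_set tight27) V" using V open_U by (rule openin_trans)
    then have VU: "V \<subseteq> U" "V \<subseteq> tight27" and openV: "openin (top_of_set tight27) V"
      using V openin_imp_subset by auto
    \<comment> \<open>\<open>Y h\<close> is the part of \<open>W\<close> that \<open>h\<close>
      carries into \<open>V\<close>. The translates of these sets cover \<open>V\<close>, and on
      each of them the chart is open.\<close>
    define Y where "Y h = {x\<in>W. tight x \<and> h \<circ> to_simplex x \<in> V}" for h
    have "open ((\<lambda>x. \<Lambda> (cubics x)) ` Y h)" if "h \<in> F4" for h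
    proof -
      have "continuous_on {x. tight x} (\<lambda>x. h \<circ> to_simplex x)"
        by (rule continuous_on_compose2[OF continuous_on_F4_left[OF that] continuous_on_to_simplex]) (auto simp: to_simplex_tight27)
      then have "openin (top_of_set {x. tight x}) ({x. tight x} \<inter> (\<lambda>x. h \<circ> to_simplex x) -` V)"
        by (rule continuous_openin_preimage[OF _ _ openV]) (auto simp: F4_tight27(2)[OF that] to_simplex_tight27)
      then obtain O' where "open O'" "{x. tight x} \<inter> (\<lambda>x. h \<circ> to_simplex x) -` V = {x. tight x} \<inter> O'"
        by (auto simp: openin_open)
      then have "open (W \<inter> O')" "Y h = {x\<in>W \<inter> O'. tight x}" using W(1) by (auto simp: Y_def)
      then show ?thesis using open_map[of "W \<inter> O'"] by simp
    qed
    then have "open (\<Union>h\<in>F4. (\<lambda>x. \<Lambda> (cubics x)) ` Y h)" by blast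
    moreover have "(\<Union>h\<in>F4. (\<lambda>x. \<Lambda> (cubics x)) ` Y h) = \<phi> ` V"
    proof (intro equalityI subsetI)
      fix z assume "z \<in> (\<Union>h\<in>F4. (\<lambda>x. \<Lambda> (cubics x)) ` Y h)"
      then obtain h x where hx: "h \<in> F4" "tight x" "h \<circ> to_simplex x \<in> V" "z = \<Lambda> (cubics x)" by (auto simp: Y_def)
      then have "z = \<phi> (h \<circ> to_simplex x)"
        using inv[OF hx(1), of "to_simplex x"] by (simp add: to_simplex_tight27) (simp add: \<phi>_def of_to_simplex)
      then show "z \<in> \<phi> ` V" using hx(3) by blast
    next
      fix z assume "z \<in> \<phi> ` V"
      then obtain p where p: "p \<in> V" "z = \<phi> p" by blast
      then have t: "p \<in> tight27" using VU by blast
      obtain g where g: "g \<in> F4" "of_simplex (g \<circ> p) \<in> W" using p(1) VU by (auto simp: U_def)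
      obtain h where h: "h \<in> F4" "\<forall>P\<in>OP2. h (g P) = P" using F4_inverse[OF g(1)] by metis
      have "h \<circ> to_simplex (of_simplex (g \<circ> p)) = p"
        using undo[where g=g and h=h, OF t h(2)] by (simp add: to_of_simplex F4_tight27(2)[OF g(1) t])
      then have "of_simplex (g \<circ> p) \<in> Y h"
        using g(2) p(1) of_simplex_tight[OF F4_tight27(2)[OF g(1) t]] by (simp add: Y_def)
      moreover have "z = \<Lambda> (cubics (of_simplex (g \<circ> p)))" using inv[OF g(1) t] p(2) by (simp add: \<phi>_def)
      ultimately show "z \<in> (\<Union>h\<in>F4. (\<lambda>x. \<Lambda> (cubics x)) ` Y h)" using h(1) by blast
    qed
    ultimately show ?thesis by simp
  qed
  have fibre: "\<phi> p = \<phi> r \<longleftrightarrow> (\<exists>g\<in>F4. r = g \<circ> p)" if p: "p \<in> U" and r: "r \<in> U" for p r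
  proof
    have t: "p \<in> tight27" "r \<in> tight27" using p r U by auto
    {
      assume e: "\<phi> p = \<phi> r"
      obtain g k where g: "g \<in> F4" "of_simplex (g \<circ> p) \<in> W" and k: "k \<in> F4" "of_simplex (k \<circ> r) \<in> W"
        using p r by (auto simp: U_def)
      \<comment> \<open>The chart separates values of the cubic form only inside \<open>W\<close>,
        so both simplices are moved there; invariance then brings the equality back to
        \<open>p\<close> and \<open>r\<close>.\<close>
      have "cubics (of_simplex (g \<circ> p)) = cubics (of_simplex (k \<circ> r))"
        using inj[OF g(2) k(2)] of_simplex_tight F4_tight27(2) g(1) k(1) t inv[OF g(1) t(1)] inv[OF k(1) t(2)] e
        by (simp add: \<phi>_def)
      then have c: "cubics (of_simplex p) = cubics (of_simplex r)" using F4_tight27(3) g(1) k(1) t by simp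
      obtain L where "linear L" and L: "\<And>i. L (of_simplex p $ i) = of_simplex r $ i" "\<And>x y. L x \<bullet> L y = x \<bullet> y"
        "\<And>x. L x \<in> albert_alg.plane \<longleftrightarrow> x \<in> albert_alg.plane" "bij L"
        by (rule same_cubics_automorphism[OF of_simplex_tight[OF t(1)] of_simplex_tight[OF t(2)] c]) (rule that)
      have "r i = (toct \<circ> L \<circ> ofoct \<circ> p) i" for i
      proof -
        have "p i = toct (of_simplex p $ lbl i)" "r i = toct (of_simplex r $ lbl i)"
          using to_of_simplex[OF t(1)] to_of_simplex[OF t(2)] by (simp_all add: to_simplex_def fun_eq_iff)
        then show ?thesis using L(1)[of "lbl i"] by (simp add: ofoct_toct)
      qed
      then show "\<exists>g\<in>F4. r = g \<circ> p" using F4_of_linear[OF L(4,3,2)] by (intro bexI[of _ "toct \<circ> L \<circ> ofoct"]) auto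
    next
      assume "\<exists>g\<in>F4. r = g \<circ> p"
      then show "\<phi> p = \<phi> r" using inv t(1) by auto
    }
  qed
  show ?thesis
    unfolding quotient_locally_euclidean_at_def
  proof (intro exI[of _ U] exI[of _ \<phi>] conjI ballI allI impI)
    show "open (\<phi> ` U)" by (rule open_image) simp
  qed (fact in_U open_U cont | erule (1) invariant | erule open_image | erule (1) fibre)+
qed

theorem theorem5p9:
  shows "(\<exists>S. tight_simplex 27 S) \<and>
         (\<exists>p\<in>tight27. quotient_locally_euclidean_at p TYPE(56))"
proof -
  have "to_simplex config \<in> tight27" by (simp add: to_simplex_tight27 tight_config)
  then show ?thesis using quotient_locally_euclidean_config by (auto simp: tight27_def)
qed

end
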